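(* Let $H<\mathrm{GL}(d,\mathbb{R})$, $d\ge2$, be a generalized shearlet dilation group whose scaling subgroup has infinitesimal generator $\mathrm{diag}(1,\lambda_2,\ldots,\lambda_d)$, and let $\lambda_{\max}=\max_{i\ge2}\lambda_i$ and $\lambda_{\min}=\min_{i\ge2}\lambda_i$. If $0<\lambda_{\min}\le\lambda_{\max}<1$, then there exists an open subset $\emptyset\ne V\Subset\mathcal{O}$ such that the dual action of $H$ on the orbit $\mathcal{O}$ is $V$-microlocally admissible in direction $(1,0,\ldots,0)^T\in S^{d-1}\cap\mathcal{O}$.
   Context: For a closed subgroup $H<\mathrm{GL}(d,\mathbb{R})$ let $G=\mathbb{R}^d\rtimes H$ with product $(x,h)(y,g)=(x+hy,hg)$ and quasi-regular representation $[\pi(x,h)f](y)=|\det h|^{-1/2}f(h^{-1}(y-x))$ on $L^2(\mathbb{R}^d)$. $H$ is irreducibly admissible if $\pi$ is an irreducible square-integrable representation; equivalently, the dual action $(\xi,h)\mapsto h^T\xi$ has a single open orbit $\mathcal{O}$, of full measure, with compact stabilizers. Let $T(d,\mathbb{R})$ be the group of upper triangular real $d\times d$ matrices with ones on the diagonal. An irreducibly admissible $H$ is a generalized shearlet dilation group if there are closed subgroups $S,D<H$ such that: (i) $S$ is a connected abelian Lie subgroup of $T(d,\mathbb{R})$; (ii) $D=\{\exp(rY):r\in\mathbb{R}\}$ with $Y$ a diagonal matrix; (iii) every $h\in H$ can be written uniquely as $h=\pm ds$ with $d\in D$, $s\in S$. $D$ is called the scaling subgroup and $Y$ its infinitesimal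 generator. For such $H$ one has $\mathcal{O}=\mathbb{R}^\times\times\mathbb{R}^{d-1}$. $V\Subset\mathcal{O}$ means that the closure of $V$ inside $\mathcal{O}$ is compact. $S^{d-1}\subset\mathbb{R}^d$ is the unit sphere; a $\xi$-neighborhood (for $\xi\in S^{d-1}$) is a relatively open $W\subset S^{d-1}$ containing $\xi$. For $W\subset S^{d-1}$ open and $R>0$: $C(W)=\{r\xi':\xi'\in W,\ r>0\}$, $C(W,R)=C(W)\setminus\overline{B_R}(0)$, with $\overline{B_R}(0)$ the closed Euclidean ball. For nonempty open $W\subset S^{d-1}\cap\mathcal{O}$, $\emptyset\neq V\Subset\mathcal{O}$, $R>0$, with $h^{-T}=(h^{-1})^T$: $K_o(W,V,R)=\{h\in H:h^{-T}V\cap C(W,R)\neq\emptyset\}$. $\|h\|$ is the operator norm with respect to the Euclidean norm, and $dh$ is the left Haar measure of $H$. Microlocal admissibility. For $\xi\in\mathcal{O}\cap S^{d-1}$ and $\emptyset\ne V\Subset\mathcal{O}$, the dual action is $V$-microlocally admissible in direction $\xi$ if there exist a $\xi$-neighborhood $W_0\subset S^{d-1}\cap\mathcal{O}$ and $R_0>0$ such that: (1) there exist $\alpha_1>0$ and $C>0$ with $\|h^{-1}\|\le C\|h\|^{-\alpha_1}$ for all $h\in K_o(W_0,V,R_0)$; (2) there exists $\alpha_2>0$ with $\int_{K_o(W_0,V,R_0)}\|h\|^{\alpha_2}\,dh<\infty$. *)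

theory Defs
  imports "HOL-Analysis.Analysis" "HOL-Algebra.Group"
begin

section \<open>Matrix groups\<close>

definition GL :: "(real^'n^'n) monoid" where
  "GL = \<lparr>carrier = {A. invertible A}, mult = (**), one = mat 1\<rparr>"

text \<open>Closedness is relative to the group, not to the space of all matrices.\<close>

definition closed_subgroup_GL :: "(real^'n^'n) set \<Rightarrow> bool" where
  "closed_subgroup_GL H \<longleftrightarrow> subgroup H GL \<and> closedin (top_of_set (carrier GL)) H"

definition op_norm :: "real^'n^'n \<Rightarrow> real" where
  "op_norm A = onorm ((*v) A)"

definition matrix_power :: "real^'n^'n \<Rightarrow> nat \<Rightarrow> real^'n^'n" where
  "matrix_power A k = (((**) A) ^^ k) (mat 1)"

text \<open>The library's \<open>exp\<close> is unavailable here: the multiplication \<open>(*)\<close> of the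
  vector types is componentwise.\<close>

definition matrix_exp :: "real^'n^'n \<Rightarrow> real^'n^'n" where
  "matrix_exp A = (\<Sum>k. (1 / fact k) *\<^sub>R matrix_power A k)"

definition diag_matrix :: "('n \<Rightarrow> real) \<Rightarrow> real^'n^'n" where
  "diag_matrix lam = (\<chi> i j. if i = j then lam i else 0)"

definition unipotent_upper :: "(real^'n::{finite,wellorder}^'n::_) set" where
  "unipotent_upper = {A. (\<forall>i. A $ i $ i = 1) \<and> (\<forall>i j. j < i \<longrightarrow> A $ i $ j = 0)}"


section \<open>Left Haar measures\<close>

text \<open>For the second countable, locally compact groups considered below, every Borel measure
  finite on compact sets is regular, so the measures described here are
  exactly the left Haar measures; they are unique up to a positive factor.\<close>

definition left_haar_measure :: "'a::topological_space monoid \<Rightarrow> 'a measure \<Rightarrow> bool" where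
  "left_haar_measure G \<mu> \<longleftrightarrow>
     sets \<mu> = sets (restrict_space borel (carrier G)) \<and>
     emeasure \<mu> (carrier G) \<noteq> 0 \<and>
     (\<forall>K. compact K \<and> K \<subseteq> carrier G \<and> K \<in> sets \<mu> \<longrightarrow> emeasure \<mu> K < \<infinity>) \<and>
     (\<forall>g\<in>carrier G. \<forall>A\<in>sets \<mu>. emeasure \<mu> ((\<lambda>a. g \<otimes>\<^bsub>G\<^esub> a) ` A) = emeasure \<mu> A)"

abbreviation matrix_group :: "(real^'n^'n) set \<Rightarrow> (real^'n^'n) monoid" where
  "matrix_group H \<equiv> GL\<lparr>carrier := H\<rparr>"


section \<open>The quasi-regular representation\<close>

definition semidirect :: "(real^'n^'n) set \<Rightarrow> ((real^'n) \<times> (real^'n^'n)) monoid" where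
  "semidirect H = \<lparr>carrier = UNIV \<times> H,
     mult = (\<lambda>(x, h) (y, g). (x + h *v y, h ** g)),
     one = (0, mat 1)\<rparr>"

text \<open>Elements of the Hilbert space are represented by Borel functions;
  functions that agree almost everywhere represent the same element.\<close>

definition L2 :: "(real^'n \<Rightarrow> complex) set" where
  "L2 = {f. f \<in> borel_measurable lborel \<and> integrable lborel (\<lambda>y. (cmod (f y))\<^sup>2)}"

definition L2_inner :: "(real^'n \<Rightarrow> complex) \<Rightarrow> (real^'n \<Rightarrow> complex) \<Rightarrow> complex" where
  "L2_inner f g = (LINT y|lborel. f y * cnj (g y))"

definition null_functions :: "(real^'n \<Rightarrow> complex) set" where
  "null_functions = {f \<in> L2. AE y in lborel. f y = 0}"

text \<open>Applied to constant sequences, the last clause says that the subspace is saturated under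
  almost everywhere equality.\<close>

definition closed_L2_subspace :: "(real^'n \<Rightarrow> complex) set \<Rightarrow> bool" where
  "closed_L2_subspace M \<longleftrightarrow>
     M \<subseteq> L2 \<and> (\<lambda>y. 0) \<in> M \<and>
     (\<forall>f\<in>M. \<forall>g\<in>M. (\<lambda>y. f y + g y) \<in> M) \<and>
     (\<forall>c. \<forall>f\<in>M. (\<lambda>y. c * f y) \<in> M) \<and>
     (\<forall>u f. (\<forall>n::nat. u n \<in> M) \<and> f \<in> L2 \<and>
        (\<lambda>n. LINT y|lborel. (cmod (u n y - f y))\<^sup>2) \<longlonglongrightarrow> 0 \<longrightarrow> f \<in> M)"

definition quasi_regular ::
  "(real^'n) \<times> (real^'n^'n) \<Rightarrow> (real^'n \<Rightarrow> complex) \<Rightarrow> (real^'n \<Rightarrow> complex)" where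
  "quasi_regular = (\<lambda>(x, h) f y.
     complex_of_real (\<bar>det h\<bar> powr (-1/2)) * f (matrix_inv h *v (y - x)))"

definition quasi_regular_irreducible :: "(real^'n^'n) set \<Rightarrow> bool" where
  "quasi_regular_irreducible H \<longleftrightarrow>
     (\<forall>M. closed_L2_subspace M \<and>
        (\<forall>g\<in>carrier (semidirect H). \<forall>f\<in>M. quasi_regular g f \<in> M)
        \<longrightarrow> M = null_functions \<or> M = L2)"

definition quasi_regular_square_integrable :: "(real^'n^'n) set \<Rightarrow> bool" where
  "quasi_regular_square_integrable H \<longleftrightarrow>
     (\<exists>\<nu> \<psi>. left_haar_measure (semidirect H) \<nu> \<and> \<psi> \<in> L2 - null_functions \<and>
        (\<integral>\<^sup>+ g. ennreal ((cmod (L2_inner \<psi> (quasi_regular g \<psi>)))\<^sup>2) \<partial>\<nu>) < \<infinity>)"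

definition irreducibly_admissible :: "(real^'n^'n) set \<Rightarrow> bool" where
  "irreducibly_admissible H \<longleftrightarrow> closed_subgroup_GL H \<and>
     quasi_regular_irreducible H \<and> quasi_regular_square_integrable H"


section \<open>Generalized shearlet dilation groups\<close>

text \<open>\<open>Y\<close> is the infinitesimal generator of the scaling subgroup \<open>D\<close>. By Cartan's theorem a
  closed subgroup of \<open>H\<close> is automatically a Lie subgroup.\<close>

definition generalized_shearlet_dilation_group ::
  "(real^'n::{finite,wellorder}^'n::_) set \<Rightarrow> (real^'n::_^'n::_) set \<Rightarrow> (real^'n::_^'n::_) set
   \<Rightarrow> real^'n::_^'n::_ \<Rightarrow> bool"
where
  "generalized_shearlet_dilation_group H S D Y \<longleftrightarrow>
     irreducibly_admissible H \<and>
     S \<subseteq> H \<and> subgroup S GL \<and> closedin (top_of_set H) S \<and>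
     D \<subseteq> H \<and> subgroup D GL \<and> closedin (top_of_set H) D \<and>
     S \<subseteq> unipotent_upper \<and> connected S \<and> (\<forall>s\<in>S. \<forall>t\<in>S. s ** t = t ** s) \<and>
     (\<forall>i j. i \<noteq> j \<longrightarrow> Y $ i $ j = 0) \<and> D = range (\<lambda>r::real. matrix_exp (r *\<^sub>R Y)) \<and>
     (\<forall>h\<in>H. \<exists>!p. case p of (\<epsilon>::real, d, s) \<Rightarrow>
        \<epsilon> \<in> {1, -1} \<and> d \<in> D \<and> s \<in> S \<and> h = \<epsilon> *\<^sub>R (d ** s))"


section \<open>Dual action and microlocal admissibility\<close>

definition dual_orbit :: "(real^'n^'n) set \<Rightarrow> real^'n \<Rightarrow> (real^'n) set" where
  "dual_orbit H \<xi> = {transpose h *v \<xi> | h. h \<in> H}"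

definition open_dual_orbit :: "(real^'n^'n) set \<Rightarrow> (real^'n) set" where
  "open_dual_orbit H = (THE U. open U \<and> (\<exists>\<xi>. U = dual_orbit H \<xi>))"

definition compactly_inside :: "(real^'n) set \<Rightarrow> (real^'n) set \<Rightarrow> bool" where
  "compactly_inside V U \<longleftrightarrow> V \<subseteq> U \<and> compact (U \<inter> closure V)"

definition direction_cone :: "(real^'n) set \<Rightarrow> (real^'n) set" where
  "direction_cone W = {r *\<^sub>R w | r w. w \<in> W \<and> r > 0}"

definition truncated_cone :: "(real^'n) set \<Rightarrow> real \<Rightarrow> (real^'n) set" where
  "truncated_cone W R = direction_cone W - cball 0 R"

definition K_outer ::
  "(real^'n^'n) set \<Rightarrow> (real^'n) set \<Rightarrow> (real^'n) set \<Rightarrow> real \<Rightarrow> (real^'n^'n) set" where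
  "K_outer H W V R =
     {h \<in> H. ((\<lambda>v. transpose (matrix_inv h) *v v) ` V) \<inter> truncated_cone W R \<noteq> {}}"

definition microlocally_admissible ::
  "(real^'n^'n) set \<Rightarrow> (real^'n^'n) measure \<Rightarrow> (real^'n) set \<Rightarrow> real^'n \<Rightarrow> bool" where
  "microlocally_admissible H \<mu> V \<xi> \<longleftrightarrow>
     (\<exists>W\<^sub>0 R\<^sub>0. openin (top_of_set (sphere 0 1)) W\<^sub>0 \<and> \<xi> \<in> W\<^sub>0 \<and>
        W\<^sub>0 \<subseteq> sphere 0 1 \<inter> open_dual_orbit H \<and> R\<^sub>0 > 0 \<and>
        (\<exists>\<alpha>\<^sub>1>0. \<exists>C>0. \<forall>h\<in>K_outer H W\<^sub>0 V R\<^sub>0.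
            op_norm (matrix_inv h) \<le> C * op_norm h powr (- \<alpha>\<^sub>1)) \<and>
        (\<exists>\<alpha>\<^sub>2>0. (\<integral>\<^sup>+ h\<in>K_outer H W\<^sub>0 V R\<^sub>0. ennreal (op_norm h powr \<alpha>\<^sub>2) \<partial>\<mu>) < \<infinity>))"

definition first_index :: "'n::{finite,wellorder}" where
  "first_index = Min UNIV"

end

theory Submission
  imports Defs "HOL-Probability.Sinc_Integral"
begin

text \<open>Write \<open>\<iota>\<close> for the first index, so that \<open>lam \<iota> = 1\<close> and \<open>0 < lam i < 1\<close> for all other \<open>i\<close>. There are two
  things to prove: the open orbit is \<open>{\<xi>. \<xi> $ \<iota> \<noteq> 0}\<close>, and the group elements that carry a ball around
  the first axis far out in a narrow cone around that axis satisfy the two estimates.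

  \<^bold>\<open>The orbit.\<close> The transpose of \<open>h\<close> carries the first axis to the first row of \<open>h\<close>, and the first row of
  \<open>\<plusminus> exp (r Y) s\<close> is \<open>\<plusminus> exp r\<close> times the first row of \<open>s\<close>. So one has to know that the first rows of
  the elements of \<open>S\<close> exhaust all vectors with first coordinate one, and that \<open>-1\<close> lies in the group.
  Both follow from irreducibility in the form \<open>irreducible_imp_no_disjoint_open_invariant\<close>: frequency
  space has no two disjoint nonempty open sets one of which is invariant, since functions with
  frequencies in one set are orthogonal to all translates and dilates of functions with frequencies in
  the other. For \<open>-1\<close> the two sets are half spaces. For the rows, consider the first column \<open>j\<close> in which the
  row entry is not free once the entries to its left are chosen. The rows, cut off after column \<open>j\<close>,
  then form the graph of a function, and the set of points above the graph and the set of points below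
  it are invariant (\<open>graph_shear_group\<close>).

  Dilations do here the work of Lie theory: \<open>D\<close> normalizes \<open>S\<close>, and conjugation by \<open>exp (r Y)\<close> multiplies the entry
  \<open>s $ \<iota> $ j\<close> by \<open>exp (r (1 - lam j))\<close>. As \<open>lam j < 1\<close>, this dilates the first row. Hence a nonzero value of
  such an entry produces all real values, and a bound for the graph function near zero improves to
  continuity. Commutativity makes every entry of \<open>s\<close> to the right of the
  diagonal a linear function of the first row.

  \<^bold>\<open>The estimates.\<close> The dilations contract first rows while they push frequencies into the cone.
  Therefore every \<open>h\<close> in the relevant set has the form \<open>u exp (r Y)\<close> with \<open>r < 0\<close> and \<open>u\<close> in a fixed bounded part
  of \<open>S\<close> (\<open>outer_decomposition\<close>). With \<open>l = Min lam\<close> this gives \<open>op_norm h \<le> b exp (r l)\<close> and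
  \<open>op_norm (matrix_inv h) \<le> b exp (- r)\<close>, which is the first estimate with exponent \<open>1 / l\<close>. For the second
  one, let \<open>K\<close> be a compact neighbourhood of the identity. The compact set \<open>K exp (- Y)\<close> is covered by \<open>N\<close>
  left translates of \<open>K\<close>, so that left invariance bounds the measure of \<open>K exp (- k Y)\<close> by \<open>N ^ k\<close> times that
  of \<open>K\<close>. These sets cover the relevant elements, \<open>op_norm\<close> decays on them like \<open>exp (- k l)\<close>, and a high power of it
  beats the growth \<open>N ^ k\<close>.\<close>

section \<open>Band-limited functions on the line\<close>

text \<open>All test functions below are products of functions of one coordinate, so that every Fourier integral
  reduces to one on the line.\<close>

lemma prod_components_lborel:
  fixes f :: "'n::finite \<Rightarrow> real \<Rightarrow> complex"
  assumes f: "\<And>k. integrable lborel (f k)"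
  shows "integrable lborel (\<lambda>y::real^'n. \<Prod>k\<in>UNIV. f k (y $ k))" (is ?I)
    and "integral\<^sup>L lborel (\<lambda>y::real^'n. \<Prod>k\<in>UNIV. f k (y $ k)) = (\<Prod>k\<in>UNIV. integral\<^sup>L lborel (f k))" (is ?E)
proof -
  let ?ax = "\<lambda>k::'n. axis k (1::real)"
  interpret product_sigma_finite "\<lambda>_::real^'n. lborel :: real measure" ..
  have inj: "inj ?ax" by (auto simp: inj_on_def axis_eq_axis)
  have Basis: "(Basis :: (real^'n) set) = range ?ax" by (auto simp: Basis_vec_def)
  define g where "g b = f (inv_into UNIV ?ax b)" for b
  have g_axis: "g (?ax k) = f k" for k unfolding g_def by (simp only: inv_into_f_f[OF inj UNIV_I])
  have g: "integrable lborel (g b)" for b by (simp add: g_def f)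
  have f_meas[measurable]: "f k \<in> borel_measurable borel" for k
    using f[of k] by (simp add: integrable_iff_bounded)
  have reindex: "(\<Prod>k\<in>UNIV. F (?ax k)) = (\<Prod>b\<in>Basis. F b)" for F :: "real^'n \<Rightarrow> complex"
    unfolding Basis by (simp add: prod.reindex[OF inj])
  have T: "(\<lambda>x. \<Sum>b\<in>Basis. x b *\<^sub>R b) \<in> measurable (\<Pi>\<^sub>M b\<in>Basis. lborel) (borel :: (real^'n) measure)"
    by measurable
  have comp: "(\<Prod>k\<in>UNIV. f k ((\<Sum>b\<in>Basis. x b *\<^sub>R b) $ k)) = (\<Prod>b\<in>Basis. g b (x b))"
    for x :: "real^'n \<Rightarrow> real"
  proof -
    have "(\<Sum>b\<in>Basis. x b *\<^sub>R b) $ k = x (?ax k)" for k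
    proof -
      have "(\<Sum>b\<in>Basis. x b *\<^sub>R b) \<bullet> ?ax k = x (?ax k)"
        by (rule inner_sum_left_Basis) (auto simp: Basis)
      then show ?thesis by (simp add: inner_axis)
    qed
    then show ?thesis by (simp add: reindex[symmetric] g_axis)
  qed
  have meas: "(\<lambda>y::real^'n. \<Prod>k\<in>UNIV. f k (y $ k)) \<in> borel_measurable borel" by measurable
  show ?I
    unfolding lborel_eq[where 'a="real^'n"] by (subst integrable_distr_eq[OF T meas], simp only: comp,
      rule product_integrable_prod, simp_all add: g)
  show ?E
    unfolding lborel_eq[where 'a="real^'n"] by (subst integral_distr[OF T meas], simp only: comp,
      subst product_integral_prod) (simp_all add: g reindex[symmetric] g_axis)
qed

lemma integrable_quadratic_decay:
  fixes f :: "real \<Rightarrow> 'a::{banach, second_countable_topology}"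
  assumes [measurable]: "f \<in> borel_measurable borel"
    and bd: "\<And>x. norm (f x) \<le> A" and dec: "\<And>x. norm (f x) * x\<^sup>2 \<le> A"
  shows "integrable lborel f"
proof (rule Bochner_Integration.integrable_bound)
  have "integrable lborel (\<lambda>x::real. inverse (1 + x\<^sup>2))"
    using integrable_inverse_1_plus_square by (simp add: set_integrable_def)
  then show "integrable lborel (\<lambda>x::real. 2 * A * inverse (1 + x\<^sup>2))" by simp
  have "norm (f x) \<le> 2 * A * inverse (1 + x\<^sup>2)" for x
  proof -
    have "norm (f x) * (1 + x\<^sup>2) \<le> 2 * A" using bd[of x] dec[of x] by (simp add: algebra_simps)
    moreover have "1 + x\<^sup>2 > 0" by (simp add: add_pos_nonneg)
    ultimately show ?thesis by (simp add: field_simps)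
  qed
  then show "AE x in lborel. norm (f x) \<le> norm (2 * A * inverse (1 + x\<^sup>2))"
    by (intro AE_I2) (metis abs_ge_self order_trans real_norm_def)
qed simp

text \<open>Substituting \<open>c y\<close> for \<open>y\<close> shows that the integral is a multiple of \<open>\<bar>c\<bar>\<close>. The constant factor need not be
  computed: a combination of such integrals vanishes as soon as the absolute values cancel.\<close>

lemma one_minus_cos_integral:
  fixes c :: real
  shows "integrable lborel (\<lambda>y::real. (1 - cos (c * y)) / y\<^sup>2)"
    and "(LINT y|lborel. (1 - cos (c * y)) / y\<^sup>2) = \<bar>c\<bar> * (LINT y|lborel. (1 - cos y) / y\<^sup>2)"
proof -
  have base: "integrable lborel (\<lambda>y::real. (1 - cos y) / y\<^sup>2)"
  proof (rule integrable_quadratic_decay[where A=2])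
    fix y :: real
    have "1 - cos y = 2 * (sin (y / 2))\<^sup>2" using cos_double_sin[of "y / 2"] by simp
    also have "\<dots> \<le> 2 * (y / 2)\<^sup>2"
      using abs_sin_x_le_abs_x[of "y / 2"] by (simp only: abs_le_square_iff)
    finally have "1 - cos y \<le> y\<^sup>2 / 2" by (simp add: power2_eq_square)
    then have "1 - cos y \<le> 2 * y\<^sup>2" using zero_le_power2[of y] by linarith
    then show "norm ((1 - cos y) / y\<^sup>2) \<le> 2" by (cases "y = 0") (simp_all add: divide_le_eq)
    show "norm ((1 - cos y) / y\<^sup>2) * y\<^sup>2 \<le> 2" using cos_ge_minus_one[of y] by simp
  qed simp
  show "integrable lborel (\<lambda>y::real. (1 - cos (c * y)) / y\<^sup>2)"
  proof (cases "c = 0")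
    case False
    have "integrable lborel (\<lambda>y::real. c\<^sup>2 * ((1 - cos (0 + c * y)) / (0 + c * y)\<^sup>2))"
      by (intro integrable_mult_right lborel_integrable_real_affine[OF base] False)
    also have "(\<lambda>y::real. c\<^sup>2 * ((1 - cos (0 + c * y)) / (0 + c * y)\<^sup>2)) = (\<lambda>y. (1 - cos (c * y)) / y\<^sup>2)"
      using False by (auto simp: power_mult_distrib)
    finally show ?thesis .
  qed simp
  show "(LINT y|lborel. (1 - cos (c * y)) / y\<^sup>2) = \<bar>c\<bar> * (LINT y|lborel. (1 - cos y) / y\<^sup>2)"
  proof (cases "c = 0")
    case False
    have "(LINT y|lborel. (1 - cos y) / y\<^sup>2) = \<bar>c\<bar> * (LINT y|lborel. (1 - cos (c * y)) / (c * y)\<^sup>2)"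
      using lborel_integral_real_affine[OF False, of "\<lambda>y. (1 - cos y) / y\<^sup>2" 0] by simp
    also have "(\<lambda>y. (1 - cos (c * y)) / (c * y)\<^sup>2) = (\<lambda>y. ((1 - cos (c * y)) / y\<^sup>2) / c\<^sup>2)"
      by (auto simp: power_mult_distrib)
    finally have eq: "(LINT y|lborel. (1 - cos y) / y\<^sup>2) = \<bar>c\<bar> * ((LINT y|lborel. (1 - cos (c * y)) / y\<^sup>2) / c\<^sup>2)"
      by (simp only: integral_divide_zero)
    have gen: "j = \<bar>c\<bar> * i" if "i = \<bar>c\<bar> * (j / c\<^sup>2)" for i j :: real
      using that False by (simp add: power2_eq_square abs_if split: if_splits)
    show ?thesis by (rule gen[OF eq])
  qed simp
qed

text \<open>The Fejer kernel, up to normalization. At \<open>y = 0\<close> the convention for division gives the value \<open>0\<close> instead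
  of \<open>\<epsilon>\<^sup>2\<close>, which changes no integral.\<close>

definition fejer :: "real \<Rightarrow> real \<Rightarrow> real" where
  "fejer \<epsilon> y = (sin (\<epsilon> * y) / y)\<^sup>2"

lemma fejer_bounds:
  assumes "\<epsilon> > 0"
  shows "0 \<le> fejer \<epsilon> y" "fejer \<epsilon> y \<le> \<epsilon>\<^sup>2" "fejer \<epsilon> y * y\<^sup>2 \<le> 1"
proof -
  have "\<bar>sin (\<epsilon> * y)\<bar> \<le> \<epsilon> * \<bar>y\<bar>" using abs_sin_x_le_abs_x[of "\<epsilon> * y"] assms by (simp add: abs_mult)
  then have "\<bar>sin (\<epsilon> * y) / y\<bar> \<le> \<epsilon>" using assms by (cases "y = 0") (auto simp: field_simps)
  then show "fejer \<epsilon> y \<le> \<epsilon>\<^sup>2" unfolding fejer_def by (metis abs_ge_zero power2_abs power_mono)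
  show "fejer \<epsilon> y * y\<^sup>2 \<le> 1"
    unfolding fejer_def by (cases "y = 0") (auto simp: power_divide power_le_one_iff abs_square_le_1)
qed (simp add: fejer_def)

lemma fejer_measurable[measurable]: "fejer \<epsilon> \<in> borel_measurable borel"
  unfolding fejer_def by measurable

lemma fejer_integrable:
  assumes "\<epsilon> > 0"
  shows "integrable lborel (\<lambda>y. fejer \<epsilon> y *\<^sub>R cis (\<xi> * y))"
  using fejer_bounds[OF assms]
  by (intro integrable_quadratic_decay[where A="max 1 (\<epsilon>\<^sup>2)"]) (auto simp: le_max_iff_disj cis_conv_exp)

text \<open>The Fourier transform of the Fejer kernel is a tent supported in \<open>{-2 * \<epsilon>..2 * \<epsilon>}\<close>. By
  \<open>4 sin\<^sup>2 a cos b = 2 cos b - cos (b + 2 a) - cos (b - 2 a)\<close> its value at \<open>\<xi>\<close> is a multiple of the second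
  difference of the absolute value, which vanishes where the absolute value is linear.\<close>

lemma fejer_transform_outside:
  assumes e: "\<epsilon> > 0" and far: "\<bar>\<xi>\<bar> \<ge> 2 * \<epsilon>"
  shows "(LINT y|lborel. fejer \<epsilon> y *\<^sub>R cis (\<xi> * y)) = 0"
proof -
  let ?J = "LINT y|lborel. (1 - cos y) / (y::real)\<^sup>2"
  let ?h = "\<lambda>c y. (1 - cos (c * y)) / (y::real)\<^sup>2"
  note int = fejer_integrable[OF e, of \<xi>]
  have "Re (LINT y|lborel. fejer \<epsilon> y *\<^sub>R cis (\<xi> * y)) = (LINT y|lborel. fejer \<epsilon> y * cos (\<xi> * y))"
    using integral_Re[OF int] by simp
  also have "\<dots> = (LINT y|lborel. - (1/2) * ?h \<xi> y + (1/4) * ?h (\<xi> + 2*\<epsilon>) y + (1/4) * ?h (\<xi> - 2*\<epsilon>) y)"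
  proof (intro Bochner_Integration.integral_cong refl)
    fix y :: real
    have gen: "s * c = - (1/2) * (1 - c) + (1/4) * (1 - p) + (1/4) * (1 - q)"
      if "p + q = 2 * c * d" "d = 1 - 2 * s" for s c p q d :: real
    proof -
      have "q = 2 * c * (1 - 2 * s) - p" using that by simp
      then show ?thesis by (simp add: algebra_simps diff_divide_distrib)
    qed
    have "cos ((\<xi> + 2*\<epsilon>) * y) + cos ((\<xi> - 2*\<epsilon>) * y) = 2 * cos (\<xi> * y) * cos (2 * (\<epsilon> * y))"
      by (simp add: distrib_right left_diff_distrib cos_add cos_diff mult.assoc)
    from gen[OF this cos_double_sin]
    have "(sin (\<epsilon> * y))\<^sup>2 * cos (\<xi> * y)
      = - (1/2) * (1 - cos (\<xi> * y)) + (1/4) * (1 - cos ((\<xi> + 2*\<epsilon>) * y)) + (1/4) * (1 - cos ((\<xi> - 2*\<epsilon>) * y))" .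
    then have "(sin (\<epsilon> * y))\<^sup>2 * cos (\<xi> * y) / y\<^sup>2
      = - (1/2) * ?h \<xi> y + (1/4) * ?h (\<xi> + 2*\<epsilon>) y + (1/4) * ?h (\<xi> - 2*\<epsilon>) y"
      by (simp only: add_divide_distrib times_divide_eq_right)
    then show "fejer \<epsilon> y * cos (\<xi> * y)
      = - (1/2) * ?h \<xi> y + (1/4) * ?h (\<xi> + 2*\<epsilon>) y + (1/4) * ?h (\<xi> - 2*\<epsilon>) y"
      by (simp add: fejer_def power_divide)
  qed
  also have "\<dots> = (- \<bar>\<xi>\<bar> / 2 + \<bar>\<xi> + 2*\<epsilon>\<bar> / 4 + \<bar>\<xi> - 2*\<epsilon>\<bar> / 4) * ?J"
  proof -
    have h: "has_bochner_integral lborel (?h c) (\<bar>c\<bar> * ?J)" for c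
      using one_minus_cos_integral[of c] by (simp add: has_bochner_integral_iff)
    have "has_bochner_integral lborel (\<lambda>y. - (1/2) * ?h \<xi> y + (1/4) * ?h (\<xi> + 2*\<epsilon>) y + (1/4) * ?h (\<xi> - 2*\<epsilon>) y)
      (- (1/2) * (\<bar>\<xi>\<bar> * ?J) + (1/4) * (\<bar>\<xi> + 2*\<epsilon>\<bar> * ?J) + (1/4) * (\<bar>\<xi> - 2*\<epsilon>\<bar> * ?J))"
      by (intro has_bochner_integral_add has_bochner_integral_mult_right h)
    from has_bochner_integral_integral_eq[OF this]
    show ?thesis by (simp only:) (simp add: algebra_simps)
  qed
  also have "- \<bar>\<xi>\<bar> / 2 + \<bar>\<xi> + 2*\<epsilon>\<bar> / 4 + \<bar>\<xi> - 2*\<epsilon>\<bar> / 4 = 0" 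
  proof -
    have "\<bar>\<xi> + 2*\<epsilon>\<bar> + \<bar>\<xi> - 2*\<epsilon>\<bar> = 2 * \<bar>\<xi>\<bar>" using far e by arith
    moreover have "- w / 2 + u / 4 + v / 4 = 0" if "u + v = 2 * w" for u v w :: real
      using that by (simp add: field_simps)
    ultimately show ?thesis by blast
  qed
  finally have re: "Re (LINT y|lborel. fejer \<epsilon> y *\<^sub>R cis (\<xi> * y)) = 0" by simp
  have "Im (LINT y|lborel. fejer \<epsilon> y *\<^sub>R cis (\<xi> * y)) = (LINT y|lborel. fejer \<epsilon> y * sin (\<xi> * y))"
    using integral_Im[OF int] by simp
  moreover have "(LINT y|lborel. fejer \<epsilon> y * sin (\<xi> * y)) = - (LINT y|lborel. fejer \<epsilon> y * sin (\<xi> * y))"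
    using lborel_integral_real_affine[of "-1" "\<lambda>y. fejer \<epsilon> y * sin (\<xi> * y)" 0]
    by (simp add: fejer_def)
  ultimately have "Im (LINT y|lborel. fejer \<epsilon> y *\<^sub>R cis (\<xi> * y)) = 0" by linarith
  with re show ?thesis by (simp add: complex_eq_iff)
qed

text \<open>The inverse Fourier transform of the indicator function of an interval; it is square integrable but
  not integrable.\<close>

definition box_wave :: "real \<Rightarrow> real \<Rightarrow> real \<Rightarrow> complex" where
  "box_wave \<epsilon> b z = (LINT x|lborel. indicator {b - \<epsilon>..b + \<epsilon>} x *\<^sub>R cis (x * z))"

lemma cis_measurable[measurable]: "cis \<in> borel_measurable borel"
  by (intro borel_measurable_continuous_onI continuous_intros)

lemma interval_wave_integrable:
  "integrable lborel (\<lambda>x. indicator {b - \<epsilon>..b + \<epsilon>} x *\<^sub>R cis (x * z))"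
  using borel_integrable_atLeastAtMost'[of "b - \<epsilon>" "b + \<epsilon>" "\<lambda>x. cis (x * z)"]
  by (simp add: set_integrable_def continuous_intros)

lemma box_wave_measurable[measurable]: "box_wave \<epsilon> b \<in> borel_measurable borel"
  unfolding box_wave_def by measurable

text \<open>The frequency centre \<open>b\<close> only contributes a phase, so the square modulus is the kernel whose integrability
  is already known.\<close>

lemma box_wave_norm:
  assumes "\<epsilon> > 0" "z \<noteq> 0"
  shows "(cmod (box_wave \<epsilon> b z))\<^sup>2 = 4 * fejer \<epsilon> z"
proof -
  have "((\<lambda>x. cis (x * z)) has_integral (cis ((b+\<epsilon>) * z) / (\<i> * z) - cis ((b-\<epsilon>) * z) / (\<i> * z))) {b-\<epsilon>..b+\<epsilon>}"
  proof (rule fundamental_theorem_of_calculus)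
    fix x assume "x \<in> {b-\<epsilon>..b+\<epsilon>}"
    have "((\<lambda>w. exp (\<i> * (w * z)) / (\<i> * z)) has_field_derivative exp (\<i> * (of_real x * z))) (at (of_real x))"
      using assms(2) by (auto intro!: derivative_eq_intros simp: field_simps)
    from has_vector_derivative_real_field[OF this]
    show "((\<lambda>x. cis (x * z) / (\<i> * z)) has_vector_derivative cis (x * z)) (at x within {b-\<epsilon>..b+\<epsilon>})"
      by (simp add: cis_conv_exp has_vector_derivative_at_within)
  qed (use assms in simp)
  moreover have "((\<lambda>x. cis (x * z)) has_integral (box_wave \<epsilon> b z)) {b-\<epsilon>..b+\<epsilon>}"
    using set_borel_integral_eq_integral[of "{b-\<epsilon>..b+\<epsilon>}" "\<lambda>x. cis (x * z)"] interval_wave_integrable[of b \<epsilon> z]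
    by (simp add: set_integrable_def set_lebesgue_integral_def box_wave_def integrable_integral)
  ultimately have "box_wave \<epsilon> b z = (cis ((b+\<epsilon>) * z) - cis ((b-\<epsilon>) * z)) / (\<i> * z)"
    by (simp add: has_integral_unique diff_divide_distrib)
  also have "cis ((b+\<epsilon>) * z) - cis ((b-\<epsilon>) * z) = cis (b * z) * (2 * \<i> * sin (\<epsilon> * z))"
    by (simp add: complex_eq_iff algebra_simps cos_add cos_diff sin_add sin_diff)
  finally have "cmod (box_wave \<epsilon> b z) = 2 * \<bar>sin (\<epsilon> * z) / z\<bar>"
    by (simp add: norm_divide norm_mult)
  then show ?thesis by (simp only: fejer_def power_mult_distrib power2_abs) simp
qed

lemma box_wave_square_integrable:
  assumes "\<epsilon> > 0"
  shows "integrable lborel (\<lambda>z. (cmod (box_wave \<epsilon> b z))\<^sup>2)"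
proof (subst integrable_cong_AE)
  show "AE z in lborel. (cmod (box_wave \<epsilon> b z))\<^sup>2 = 4 * fejer \<epsilon> z"
    using AE_lborel_singleton[of 0] by eventually_elim (rule box_wave_norm[OF assms])
  show "integrable lborel (\<lambda>z. 4 * fejer \<epsilon> z)"
    using integrable_norm[OF fejer_integrable[OF assms, of 0]] fejer_bounds(1)[OF assms] by simp
qed measurable

section \<open>Matrix groups and linear changes of variables\<close>

lemma matrix_inverse:
  fixes A :: "real^'n^'n"
  assumes "invertible A"
  shows matrix_inv_right: "A ** matrix_inv A = mat 1" and matrix_inv_left: "matrix_inv A ** A = mat 1"
proof -
  have "A ** matrix_inv A = mat 1 \<and> matrix_inv A ** A = mat 1"
    unfolding matrix_inv_def using assms[unfolded invertible_def] by (rule someI_ex)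
  then show "A ** matrix_inv A = mat 1" "matrix_inv A ** A = mat 1" by simp_all
qed

lemma matrix_inv_unique:
  fixes A :: "real^'n^'n"
  assumes "A ** B = mat 1" "B ** A = mat 1"
  shows "matrix_inv A = B"
proof -
  have "invertible A" using assms by (auto simp: invertible_def)
  then have "matrix_inv A = matrix_inv A ** (A ** B)" by (simp add: assms)
  also have "\<dots> = B" by (simp add: matrix_mul_assoc matrix_inv_left \<open>invertible A\<close>)
  finally show ?thesis .
qed

lemma invertible_matrix_inv: "invertible (A :: real^'n^'n) \<Longrightarrow> invertible (matrix_inv A)"
  unfolding invertible_def[of "matrix_inv A"] using matrix_inv_left matrix_inv_right by blast

lemma group_GL: "group (GL :: (real^'n^'n) monoid)"
proof (rule groupI)
  fix A :: "real^'n^'n" assume A: "A \<in> carrier GL"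
  then show "\<exists>B\<in>carrier GL. B \<otimes>\<^bsub>GL\<^esub> A = \<one>\<^bsub>GL\<^esub>"
    unfolding GL_def invertible_def by auto
qed (auto simp: GL_def matrix_mul_assoc invertible_mult invertible_def[of "mat 1"] intro!: exI[of _ "mat 1"])

lemma inv_GL: "invertible (A :: real^'n^'n) \<Longrightarrow> inv\<^bsub>GL\<^esub> A = matrix_inv A"
  by (rule group.inv_equality[OF group_GL]) (simp_all add: GL_def matrix_inv_left invertible_matrix_inv)

lemma subgroup_GL:
  assumes "subgroup H (GL :: (real^'n^'n) monoid)"
  shows "mat 1 \<in> H" "\<And>g h. g \<in> H \<Longrightarrow> h \<in> H \<Longrightarrow> g ** h \<in> H"
    "\<And>h. h \<in> H \<Longrightarrow> matrix_inv h \<in> H" "\<And>h. h \<in> H \<Longrightarrow> invertible h"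
proof -
  show inv: "\<And>h. h \<in> H \<Longrightarrow> invertible h" using subgroup.subset[OF assms] by (auto simp: GL_def)
  show "mat 1 \<in> H" using subgroup.one_closed[OF assms] by (simp add: GL_def)
  show "\<And>g h. g \<in> H \<Longrightarrow> h \<in> H \<Longrightarrow> g ** h \<in> H" using subgroup.m_closed[OF assms] by (simp add: GL_def)
  show "\<And>h. h \<in> H \<Longrightarrow> matrix_inv h \<in> H" using subgroup.m_inv_closed[OF assms] inv inv_GL by metis
qed

text \<open>Both measures agree on boxes, by the determinant formula for the volume of a linear image.\<close>

lemma lborel_affine_matrix:
  fixes A :: "real^'n::{finite,wellorder}^'n::_" and b :: "real^'n::_"
  assumes "invertible A"
  shows "lborel = density (distr lborel borel (\<lambda>y. A *v y + b)) (\<lambda>_. ennreal \<bar>det A\<bar>)"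
proof (rule lborel_eqI)
  let ?T = "\<lambda>y. A *v y + b" and ?L = "(*v) (matrix_inv A)"
  have T[measurable]: "?T \<in> borel_measurable borel"
    by (intro borel_measurable_continuous_onI continuous_intros
        bounded_linear.continuous_on[OF matrix_vector_mul_bounded_linear])
  have inv: "A ** matrix_inv A = mat 1" "matrix_inv A ** A = mat 1"
    using assms by (simp_all add: matrix_inv_right matrix_inv_left)
  have det: "\<bar>det A\<bar> * \<bar>det (matrix_inv A)\<bar> = 1"
    using arg_cong[OF inv(1), of det] by (simp add: det_mul abs_mult[symmetric])
  fix l u :: "real^'n::_"
  assume le: "\<And>b. b \<in> Basis \<Longrightarrow> l \<bullet> b \<le> u \<bullet> b"
  have pre: "?T -` box l u = ?L ` (box (l - b) (u - b))"
  proof (intro Set.set_eqI iffI)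
    fix y assume "y \<in> ?T -` box l u"
    then have "A *v y \<in> box (l - b) (u - b)" by (auto simp: mem_box algebra_simps)
    moreover have "?L (A *v y) = y" by (simp add: matrix_vector_mul_assoc inv)
    ultimately show "y \<in> ?L ` (box (l - b) (u - b))" by (metis imageI)
  next
    fix y assume "y \<in> ?L ` (box (l - b) (u - b))"
    then obtain x where x: "x \<in> box (l - b) (u - b)" "y = ?L x" by auto
    then have "A *v y = x" by (simp add: matrix_vector_mul_assoc inv)
    with x show "y \<in> ?T -` box l u" by (auto simp: mem_box algebra_simps)
  qed
  have lm: "box (l - b) (u - b) \<in> lmeasurable" by simp
  have lin: "linear ?L" by simp
  have im: "?L ` (box (l - b) (u - b)) \<in> lmeasurable"
    using measurable_linear_image[OF lin lm] .
  have "emeasure lborel (?T -` box l u) = emeasure lebesgue (?L ` (box (l - b) (u - b)))"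
    using measurable_sets_borel[OF T, of "box l u"] by (simp add: pre[symmetric])
  also have "\<dots> = ennreal (\<bar>det (matrix_inv A)\<bar> * measure lebesgue (box (l - b) (u - b)))"
    using measure_linear_image[OF lin lm] emeasure_eq_measure2[OF im] by simp
  also have "measure lebesgue (box (l - b) (u - b)) = (\<Prod>c\<in>Basis. (u - l) \<bullet> c)"
    using le by (simp add: measure_lborel_box_eq algebra_simps)
  finally have "emeasure lborel (?T -` box l u) = ennreal (\<bar>det (matrix_inv A)\<bar> * (\<Prod>c\<in>Basis. (u - l) \<bullet> c))" .
  then show "emeasure (density (distr lborel borel ?T) (\<lambda>_. ennreal \<bar>det A\<bar>)) (box l u)
      = ennreal (\<Prod>c\<in>Basis. (u - l) \<bullet> c)"
    using det by (simp add: emeasure_density_const emeasure_distr ennreal_mult'[symmetric] mult.assoc[symmetric])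
qed simp

lemma integral_affine_matrix:
  fixes A :: "real^'n::{finite,wellorder}^'n::_" and f :: "real^'n::_ \<Rightarrow> 'b::{banach,second_countable_topology}"
  assumes "invertible A" and [measurable]: "f \<in> borel_measurable borel"
  shows "integrable lborel f \<longleftrightarrow> integrable lborel (\<lambda>y. f (A *v y + b))" (is ?I)
    and "integral\<^sup>L lborel f = \<bar>det A\<bar> *\<^sub>R integral\<^sup>L lborel (\<lambda>y. f (A *v y + b))" (is ?E)
proof -
  have [measurable]: "(\<lambda>y. A *v y + b) \<in> borel_measurable borel"
    by (intro borel_measurable_continuous_onI continuous_intros
        bounded_linear.continuous_on[OF matrix_vector_mul_bounded_linear])
  have "det A \<noteq> 0" using assms(1) by (simp add: invertible_det_nz)
  have dens_iff: "integrable lborel (\<lambda>y. \<bar>det A\<bar> *\<^sub>R f (A *v y + b)) \<longleftrightarrow> integrable lborel (\<lambda>y. f (A *v y + b))"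
  proof
    assume int: "integrable lborel (\<lambda>y. \<bar>det A\<bar> *\<^sub>R f (A *v y + b))"
    have "integrable lborel (\<lambda>y. inverse \<bar>det A\<bar> *\<^sub>R \<bar>det A\<bar> *\<^sub>R f (A *v y + b))"
      by (rule integrable_scaleR_right) (rule int)
    then show "integrable lborel (\<lambda>y. f (A *v y + b))" using \<open>det A \<noteq> 0\<close> by simp
  qed (rule integrable_scaleR_right)
  show ?I
    by (subst lborel_affine_matrix[OF assms(1), of b]) (simp add: integrable_density integrable_distr_eq dens_iff)
  show ?E
    by (subst lborel_affine_matrix[OF assms(1), of b]) (simp add: integral_density integral_distr)
qed

lemma cnj_measurable[measurable]: "cnj \<in> borel_measurable borel"
  by (intro borel_measurable_continuous_onI continuous_intros)

section \<open>Square integrable functions and the quasi-regular representation\<close>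

lemma L2_product_integrable:
  assumes "f \<in> L2" "g \<in> L2"
  shows "integrable lborel (\<lambda>y. f y * cnj (g y))"
proof (rule Bochner_Integration.integrable_bound)
  have [measurable]: "f \<in> borel_measurable borel" "g \<in> borel_measurable borel"
    using assms by (auto simp: L2_def)
  show "integrable lborel (\<lambda>y. (cmod (f y))\<^sup>2 + (cmod (g y))\<^sup>2)" using assms by (auto simp: L2_def)
  have "cmod (f y) * cmod (g y) \<le> (cmod (f y))\<^sup>2 + (cmod (g y))\<^sup>2" for y
  proof -
    have "0 \<le> cmod (f y) * cmod (g y)" by simp
    moreover have "2 * (cmod (f y) * cmod (g y)) \<le> (cmod (f y))\<^sup>2 + (cmod (g y))\<^sup>2"
      using sum_squares_bound[of "cmod (f y)" "cmod (g y)"] by (simp only: mult.assoc)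
    ultimately show ?thesis by linarith
  qed
  then show "AE y in lborel. norm (f y * cnj (g y)) \<le> norm ((cmod (f y))\<^sup>2 + (cmod (g y))\<^sup>2)"
    by (intro AE_I2) (simp add: norm_mult)
  show "(\<lambda>y. f y * cnj (g y)) \<in> borel_measurable lborel" by measurable
qed

lemma L2_add:
  assumes "f \<in> L2" "g \<in> L2"
  shows "(\<lambda>y. f y + g y) \<in> L2"
proof -
  have [measurable]: "f \<in> borel_measurable borel" "g \<in> borel_measurable borel"
    using assms by (auto simp: L2_def)
  have "integrable lborel (\<lambda>y. (cmod (f y + g y))\<^sup>2)"
  proof (rule Bochner_Integration.integrable_bound)
    show "integrable lborel (\<lambda>y. 2 * (cmod (f y))\<^sup>2 + 2 * (cmod (g y))\<^sup>2)"
      using assms by (auto simp: L2_def)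
    have "(cmod (f y + g y))\<^sup>2 \<le> 2 * (cmod (f y))\<^sup>2 + 2 * (cmod (g y))\<^sup>2" for y
    proof -
      have "(cmod (f y + g y))\<^sup>2 \<le> (cmod (f y) + cmod (g y))\<^sup>2"
        by (intro power_mono norm_triangle_ineq) simp
      then show ?thesis using sum_squares_bound[of "cmod (f y)" "cmod (g y)"] by (simp add: power2_sum)
    qed
    then show "AE y in lborel. norm ((cmod (f y + g y))\<^sup>2) \<le> norm (2 * (cmod (f y))\<^sup>2 + 2 * (cmod (g y))\<^sup>2)"
      by (intro AE_I2) simp
  qed measurable
  then show ?thesis by (simp add: L2_def)
qed

lemma L2_cmult: "f \<in> L2 \<Longrightarrow> (\<lambda>y. c * f y) \<in> L2"
  by (auto simp: L2_def norm_mult power_mult_distrib)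

text \<open>A Cauchy-Schwarz estimate in the weighted form \<open>a b \<le> a\<^sup>2 / t + t b\<^sup>2\<close>; the weight \<open>t\<close> below is chosen so that the
  second term stays smaller than the supposed value of the inner product.\<close>

lemma L2_inner_limit:
  assumes u: "\<And>n. u n \<in> L2" and f: "f \<in> L2" and g: "g \<in> L2"
    and lim: "(\<lambda>n. LINT y|lborel. (cmod (u n y - f y))\<^sup>2) \<longlonglongrightarrow> 0"
    and zero: "\<And>n. L2_inner (u n) g = 0"
  shows "L2_inner f g = 0"
proof (rule ccontr)
  assume nz: "L2_inner f g \<noteq> 0"
  let ?G = "LINT y|lborel. (cmod (g y))\<^sup>2" and ?D = "\<lambda>n. LINT y|lborel. (cmod (u n y - f y))\<^sup>2"
  define c where "c = cmod (L2_inner f g)"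
  have c: "c > 0" using nz by (simp add: c_def)
  have G: "?G \<ge> 0" by simp
  define t where "t = c / (?G + 1)"
  have t: "t > 0" using c G by (simp add: t_def add_nonneg_pos)
  have est: "c \<le> ?D n / t + t * ?G" for n
  proof -
    have d: "(\<lambda>y. u n y - f y) \<in> L2"
      using L2_add[OF u[of n] L2_cmult[OF f, of "-1"]] by simp
    have "- L2_inner f g = L2_inner (\<lambda>y. u n y - f y) g"
      using zero[of n] L2_product_integrable[OF u[of n] g] L2_product_integrable[OF f g]
      by (simp add: L2_inner_def left_diff_distrib)
    then have "c = cmod (L2_inner (\<lambda>y. u n y - f y) g)" unfolding c_def by (metis norm_minus_cancel)
    also have "\<dots> \<le> (LINT y|lborel. cmod ((u n y - f y) * cnj (g y)))"
      unfolding L2_inner_def by (rule integral_norm_bound)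
    also have "\<dots> \<le> (LINT y|lborel. (cmod (u n y - f y))\<^sup>2 / t + t * (cmod (g y))\<^sup>2)"
    proof (rule integral_mono)
      show "integrable lborel (\<lambda>y. cmod ((u n y - f y) * cnj (g y)))"
        using L2_product_integrable[OF d g] by (rule integrable_norm)
      show "integrable lborel (\<lambda>y. (cmod (u n y - f y))\<^sup>2 / t + t * (cmod (g y))\<^sup>2)"
        using d g by (auto simp: L2_def)
      fix y
      let ?a = "cmod (u n y - f y)" and ?b = "cmod (g y)"
      have "0 \<le> (?a - t * ?b)\<^sup>2 + ?a * t * ?b" using t by simp
      then have "t * (?a * ?b) \<le> ?a\<^sup>2 + t\<^sup>2 * ?b\<^sup>2" by (simp add: power2_eq_square algebra_simps)
      then have "?a * ?b \<le> ?a\<^sup>2 / t + t * ?b\<^sup>2" using t by (simp add: field_simps power2_eq_square)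
      then show "cmod ((u n y - f y) * cnj (g y)) \<le> ?a\<^sup>2 / t + t * ?b\<^sup>2" by (simp add: norm_mult)
    qed
    also have "\<dots> = ?D n / t + t * ?G"
      using d g by (subst Bochner_Integration.integral_add) (auto simp: L2_def)
    finally show ?thesis .
  qed
  have "(\<lambda>n. ?D n / t + t * ?G) \<longlonglongrightarrow> 0 / t + t * ?G"
    by (intro tendsto_intros lim) (use t in simp)
  then have "c \<le> 0 / t + t * ?G" using est by (intro LIMSEQ_le_const) auto
  also have "\<dots> < c"
  proof -
    have "c * ?G < c * (?G + 1)" using c by simp
    then show ?thesis using G by (simp only: t_def times_divide_eq_left) (simp add: divide_less_eq add_nonneg_pos)
  qed
  finally show False by simp
qed

lemma quasi_regular_L2:
  fixes f :: "real^'n::{finite,wellorder} \<Rightarrow> complex"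
  assumes "invertible h" "f \<in> L2"
  shows "quasi_regular (x, h) f \<in> L2"
proof -
  let ?k = "matrix_inv h"
  have inv: "invertible ?k" using assms(1) by (rule invertible_matrix_inv)
  have [measurable]: "f \<in> borel_measurable borel" using assms by (auto simp: L2_def)
  have eq: "?k *v (y - x) = ?k *v y + - (?k *v x)" for y by (simp add: matrix_vector_mult_diff_distrib)
  have [measurable]: "(\<lambda>y. ?k *v (y - x)) \<in> borel_measurable borel"
    by (intro borel_measurable_continuous_onI continuous_intros
        bounded_linear.continuous_on[OF matrix_vector_mul_bounded_linear])
  have "integrable lborel (\<lambda>y. (cmod (f (?k *v y + - (?k *v x))))\<^sup>2)"
    using integral_affine_matrix(1)[OF inv, of "\<lambda>y. (cmod (f y))\<^sup>2" "- (?k *v x)"] assms(2) by (simp add: L2_def)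
  then have "(\<lambda>y. f (?k *v (y - x))) \<in> L2"
    unfolding L2_def mem_Collect_eq by (intro conjI) (measurable, simp only: eq)
  from L2_cmult[OF this] show ?thesis by (simp add: quasi_regular_def)
qed

text \<open>The representation is unitary, so an operator can be moved to the other argument of the inner product.
  The determinant factors of both sides are collected in \<open>c / c'\<close>.\<close>

lemma quasi_regular_move:
  fixes f1 :: "real^'n::{finite,wellorder} \<Rightarrow> complex"
  assumes g: "invertible g" and h: "invertible h" and f: "f \<in> L2" and f1: "f1 \<in> L2"
    and zero: "L2_inner f (quasi_regular (matrix_inv g *v (x - w), matrix_inv g ** h) f1) = 0"
  shows "L2_inner (quasi_regular (w, g) f) (quasi_regular (x, h) f1) = 0"
proof -
  let ?F = "\<lambda>y. quasi_regular (w, g) f y * cnj (quasi_regular (x, h) f1 y)"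
  have [measurable]: "?F \<in> borel_measurable borel"
    using L2_product_integrable[OF quasi_regular_L2[OF g f] quasi_regular_L2[OF h f1]] by auto
  have gi: "matrix_inv g ** g = mat 1" "g ** matrix_inv g = mat 1"
    using g by (simp_all add: matrix_inv_left matrix_inv_right)
  have hi: "matrix_inv h ** h = mat 1" "h ** matrix_inv h = mat 1"
    using h by (simp_all add: matrix_inv_left matrix_inv_right)
  have inv_gh: "matrix_inv (matrix_inv g ** h) = matrix_inv h ** g"
  proof (rule matrix_inv_unique)
    have "matrix_inv g ** h ** (matrix_inv h ** g) = matrix_inv g ** (h ** matrix_inv h) ** g"
      by (simp add: matrix_mul_assoc)
    then show "matrix_inv g ** h ** (matrix_inv h ** g) = mat 1" by (simp add: hi gi)
    have "matrix_inv h ** g ** (matrix_inv g ** h) = matrix_inv h ** (g ** matrix_inv g) ** h"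
      by (simp add: matrix_mul_assoc)
    then show "matrix_inv h ** g ** (matrix_inv g ** h) = mat 1" by (simp add: hi gi)
  qed
  define c where "c = complex_of_real (\<bar>det g\<bar> powr (-1/2)) * complex_of_real (\<bar>det h\<bar> powr (-1/2))"
  define c' where "c' = complex_of_real (\<bar>det (matrix_inv g ** h)\<bar> powr (-1/2))"
  have "det (matrix_inv g ** h) \<noteq> 0" using hi gi inv_gh
    by (metis det_I det_mul g h invertible_def invertible_det_nz invertible_mult mult_zero_left zero_neq_one)
  then have c': "c' \<noteq> 0" by (simp add: c'_def)
  have pt: "?F (g *v z + w) = c / c' * (f z * cnj (quasi_regular (matrix_inv g *v (x - w), matrix_inv g ** h) f1 z))" for z
  proof -
    have 1: "matrix_inv g *v ((g *v z + w) - w) = z" by (simp add: matrix_vector_mul_assoc gi)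
    have "matrix_inv (matrix_inv g ** h) *v (z - matrix_inv g *v (x - w))
        = matrix_inv h *v (g *v z - (g ** matrix_inv g) *v (x - w))"
      by (simp add: inv_gh matrix_vector_mul_assoc[symmetric] matrix_vector_mult_diff_distrib)
    also have "\<dots> = matrix_inv h *v ((g *v z + w) - x)" by (simp add: gi algebra_simps)
    finally show ?thesis using c' 1 unfolding quasi_regular_def c_def c'_def by (simp add: field_simps)
  qed
  have "L2_inner (quasi_regular (w, g) f) (quasi_regular (x, h) f1)
      = \<bar>det g\<bar> *\<^sub>R (LINT z|lborel. ?F (g *v z + w))"
    unfolding L2_inner_def by (rule integral_affine_matrix(2)[OF g]) measurable
  also have "(LINT z|lborel. ?F (g *v z + w)) = c / c' * L2_inner f (quasi_regular (matrix_inv g *v (x - w), matrix_inv g ** h) f1)"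
    unfolding pt L2_inner_def by simp
  finally show ?thesis using zero by simp
qed

section \<open>Irreducibility excludes disjoint open invariant sets\<close>

text \<open>A function with frequencies in the cube of side \<open>4 * \<epsilon>\<close> around \<open>a\<close>. It is integrable, which allows the
  exchange of integrals in \<open>waves_orthogonal\<close>.\<close>

definition fejer_wave :: "real \<Rightarrow> real^'n \<Rightarrow> real^'n \<Rightarrow> complex" where
  "fejer_wave \<epsilon> a y = (\<Prod>k\<in>UNIV. fejer \<epsilon> (y $ k) *\<^sub>R cis (a $ k * y $ k))"

text \<open>A function with frequencies in the cube of side \<open>2 * \<epsilon>\<close> around \<open>b\<close>, given as an explicit superposition of
  plane waves (\<open>cube_wave_eq_integral\<close>).\<close>

definition cube_wave :: "real \<Rightarrow> real^'n \<Rightarrow> real^'n \<Rightarrow> complex" where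
  "cube_wave \<epsilon> b z = (\<Prod>k\<in>UNIV. box_wave \<epsilon> (b $ k) (z $ k))"

lemma fejer_wave_measurable[measurable]: "fejer_wave \<epsilon> a \<in> borel_measurable borel"
  unfolding fejer_wave_def by measurable

lemma cube_wave_measurable[measurable]: "cube_wave \<epsilon> b \<in> borel_measurable borel"
  unfolding cube_wave_def by measurable

lemma fejer_wave_integrable:
  assumes "\<epsilon> > 0"
  shows "integrable lborel (fejer_wave \<epsilon> a)"
  unfolding fejer_wave_def[abs_def] by (intro prod_components_lborel(1) fejer_integrable assms)

lemma fejer_wave_L2:
  assumes "\<epsilon> > 0"
  shows "fejer_wave \<epsilon> (a :: real^'n) \<in> L2"
proof -
  have "integrable lborel (\<lambda>y. (cmod (fejer_wave \<epsilon> a y))\<^sup>2)"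
  proof (rule Bochner_Integration.integrable_bound)
    show "integrable lborel (\<lambda>y. (\<epsilon>\<^sup>2) ^ CARD('n) * cmod (fejer_wave \<epsilon> a y))"
      using integrable_norm[OF fejer_wave_integrable[OF assms, of a]] by simp
    have bd: "cmod (fejer_wave \<epsilon> a y) \<le> (\<epsilon>\<^sup>2) ^ CARD('n)" for y
    proof -
      have "cmod (fejer_wave \<epsilon> a y) = (\<Prod>k\<in>UNIV. fejer \<epsilon> (y $ k))"
        using fejer_bounds(1)[OF assms] by (simp add: fejer_wave_def prod_norm[symmetric])
      also have "\<dots> \<le> (\<Prod>k\<in>(UNIV::'n set). \<epsilon>\<^sup>2)"
        using fejer_bounds[OF assms] by (intro prod_mono) auto
      finally show ?thesis by simp
    qed
    have "(cmod (fejer_wave \<epsilon> a y))\<^sup>2 \<le> (\<epsilon>\<^sup>2) ^ CARD('n) * cmod (fejer_wave \<epsilon> a y)" for y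
      using mult_right_mono[OF bd[of y], of "cmod (fejer_wave \<epsilon> a y)"] by (simp add: power2_eq_square)
    then show "AE y in lborel. norm ((cmod (fejer_wave \<epsilon> a y))\<^sup>2)
        \<le> norm ((\<epsilon>\<^sup>2) ^ CARD('n) * cmod (fejer_wave \<epsilon> a y))"
      by (intro AE_I2) simp
  qed measurable
  then show ?thesis by (simp add: L2_def)
qed

lemma cube_wave_L2:
  assumes "\<epsilon> > 0"
  shows "cube_wave \<epsilon> b \<in> L2"
proof -
  have "integrable lborel (\<lambda>x. complex_of_real ((cmod (box_wave \<epsilon> (b $ k) x))\<^sup>2))" for k
    by (intro integrable_of_real box_wave_square_integrable assms)
  then have "integrable lborel (\<lambda>y. \<Prod>k\<in>UNIV. complex_of_real ((cmod (box_wave \<epsilon> (b $ k) (y $ k)))\<^sup>2))"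
    by (rule prod_components_lborel(1))
  also have "(\<lambda>y. \<Prod>k\<in>UNIV. complex_of_real ((cmod (box_wave \<epsilon> (b $ k) (y $ k)))\<^sup>2))
      = (\<lambda>y. complex_of_real ((cmod (cube_wave \<epsilon> b y))\<^sup>2))"
    by (simp add: cube_wave_def prod_norm[symmetric] prod_power_distrib)
  finally have "integrable lborel (\<lambda>y. Re (complex_of_real ((cmod (cube_wave \<epsilon> b y))\<^sup>2)))"
    by (rule integrable_Re)
  then show ?thesis by (simp add: L2_def)
qed

text \<open>Neither function has a zero in a small open box at the origin.\<close>

lemma waves_not_null:
  fixes a b :: "real^'n"
  assumes "\<epsilon> > 0"
  shows "fejer_wave \<epsilon> a \<notin> null_functions" "cube_wave \<epsilon> b \<notin> null_functions"
proof -
  let ?B = "box 0 (\<chi> i. 1 / \<epsilon>) :: (real^'n) set"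
  have comp: "0 < y $ k \<and> y $ k < 1 / \<epsilon>" if "y \<in> ?B" for y k
    using that by (simp add: mem_box_cart)
  have fejer_nz: "fejer \<epsilon> (y $ k) > 0" if "y \<in> ?B" for y k
  proof -
    have "0 < \<epsilon> * y $ k" "\<epsilon> * y $ k < 1" using comp[OF that, of k] assms by (auto simp: field_simps)
    then have "sin (\<epsilon> * y $ k) > 0" using pi_gt3 by (intro sin_gt_zero) auto
    then show ?thesis using comp[OF that, of k] by (simp add: fejer_def)
  qed
  have pos: "emeasure lborel ?B \<noteq> 0"
  proof -
    have "(\<Prod>b\<in>Basis. ((\<chi> i. 1 / \<epsilon>) - 0 :: real^'n) \<bullet> b) > 0"
      using assms by (intro prod_pos) (auto simp: Basis_vec_def inner_axis)
    moreover have "\<forall>b\<in>Basis. (0 :: real^'n) \<bullet> b \<le> (\<chi> i. 1 / \<epsilon>) \<bullet> b"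
      using assms by (auto simp: Basis_vec_def inner_axis)
    ultimately show ?thesis by (auto simp: emeasure_lborel_box_eq ennreal_eq_0_iff not_le)
  qed
  have key: "f \<notin> null_functions" if nz: "\<And>y. y \<in> ?B \<Longrightarrow> f y \<noteq> 0" for f
  proof
    assume "f \<in> null_functions"
    then have "AE y in lborel. f y = 0" by (simp add: null_functions_def)
    then have "AE y in lborel. y \<notin> ?B" by (rule AE_mp) (use nz in \<open>auto intro!: AE_I2\<close>)
    then have "emeasure lborel ?B = 0" by (subst (asm) AE_iff_measurable[of ?B]) auto
    with pos show False by simp
  qed
  show "fejer_wave \<epsilon> a \<notin> null_functions"
    using fejer_nz by (intro key) (auto simp: fejer_wave_def cis_neq_zero less_le)
  show "cube_wave \<epsilon> b \<notin> null_functions"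
  proof (rule key)
    fix y assume y: "y \<in> ?B"
    have "box_wave \<epsilon> (b $ k) (y $ k) \<noteq> 0" for k
    proof -
      have "(cmod (box_wave \<epsilon> (b $ k) (y $ k)))\<^sup>2 = 4 * fejer \<epsilon> (y $ k)"
        using comp[OF y, of k] by (intro box_wave_norm assms) simp
      then show ?thesis using fejer_nz[OF y, of k] by auto
    qed
    then show "cube_wave \<epsilon> b y \<noteq> 0" by (simp add: cube_wave_def)
  qed
qed

lemma cube_wave_eq_integral:
  fixes b z :: "real^'n"
  assumes "\<epsilon> > 0"
  defines "Q \<equiv> cbox (b - (\<chi> i. \<epsilon>)) (b + (\<chi> i. \<epsilon>))"
  shows "cube_wave \<epsilon> b z = (LINT \<xi>|lborel. indicator Q \<xi> *\<^sub>R cis (\<xi> \<bullet> z))"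
proof -
  have "cube_wave \<epsilon> b z = (LINT \<xi>|lborel. (\<Prod>k\<in>UNIV. indicator {b $ k - \<epsilon>..b $ k + \<epsilon>} (\<xi> $ k) *\<^sub>R cis (\<xi> $ k * z $ k)))"
    unfolding cube_wave_def box_wave_def by (rule prod_components_lborel(2)[symmetric]) (rule interval_wave_integrable)
  also have "(\<lambda>\<xi>. \<Prod>k\<in>UNIV. indicator {b $ k - \<epsilon>..b $ k + \<epsilon>} (\<xi> $ k) *\<^sub>R cis (\<xi> $ k * z $ k))
      = (\<lambda>\<xi>. indicator Q \<xi> *\<^sub>R cis (\<xi> \<bullet> z))"
  proof
    fix \<xi> :: "real^'n"
    have "(\<Prod>k\<in>UNIV. cis (\<xi> $ k * z $ k)) = cis (\<xi> \<bullet> z)"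
      by (simp add: inner_vec_def cis_conv_exp exp_sum[symmetric] sum_distrib_left)
    moreover have "(\<Prod>k\<in>UNIV. indicator {b $ k - \<epsilon>..b $ k + \<epsilon>} (\<xi> $ k)) = (indicator Q \<xi> :: real)"
      by (auto simp: indicator_def Q_def mem_box_cart intro!: prod_zero)
    ultimately show "(\<Prod>k\<in>UNIV. indicator {b $ k - \<epsilon>..b $ k + \<epsilon>} (\<xi> $ k) *\<^sub>R cis (\<xi> $ k * z $ k))
      = indicator Q \<xi> *\<^sub>R cis (\<xi> \<bullet> z)"
      by (simp add: scaleR_conv_of_real prod.distrib of_real_prod[symmetric] del: of_real_prod)
  qed
  finally show ?thesis .
qed

lemma fejer_wave_transform:
  fixes a \<eta> :: "real^'n"
  assumes "\<epsilon> > 0" and far: "\<bar>a $ k - \<eta> $ k\<bar> \<ge> 2 * \<epsilon>"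
  shows "(LINT y|lborel. fejer_wave \<epsilon> a y * cis (- (\<eta> \<bullet> y))) = 0"
proof -
  have eq: "fejer_wave \<epsilon> a y * cis (- (\<eta> \<bullet> y)) = (\<Prod>k\<in>UNIV. fejer \<epsilon> (y $ k) *\<^sub>R cis ((a $ k - \<eta> $ k) * y $ k))" for y
  proof -
    have "cis (- (\<eta> \<bullet> y)) = (\<Prod>k\<in>UNIV. cis (- (\<eta> $ k * y $ k)))"
      by (simp add: inner_vec_def cis_conv_exp exp_sum[symmetric] sum_distrib_left sum_negf)
    then show ?thesis
      by (simp add: fejer_wave_def prod.distrib[symmetric] cis_mult algebra_simps)
  qed
  have "(LINT y|lborel. fejer_wave \<epsilon> a y * cis (- (\<eta> \<bullet> y)))
      = (\<Prod>k\<in>UNIV. LINT x|lborel. fejer \<epsilon> x *\<^sub>R cis ((a $ k - \<eta> $ k) * x))"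
    unfolding eq by (rule prod_components_lborel(2)) (rule fejer_integrable[OF assms(1)])
  also have "\<dots> = 0"
    using fejer_transform_outside[OF assms] by (intro prod_zero) auto
  finally show ?thesis .
qed

text \<open>Writing the second function as a superposition of plane waves and exchanging the integrals turns the
  inner product into an average of values of the Fourier transform of the first one, at the frequencies
  \<open>transpose N *v \<xi>\<close>. All of them lie outside the cube around \<open>a\<close>.\<close>

lemma waves_orthogonal:
  fixes a b x :: "real^'n" and N :: "real^'n^'n"
  assumes e: "\<epsilon> > 0"
    and far: "\<And>\<xi>. \<xi> \<in> cbox (b - (\<chi> i. \<epsilon>)) (b + (\<chi> i. \<epsilon>)) \<Longrightarrow> \<exists>k. \<bar>a $ k - (transpose N *v \<xi>) $ k\<bar> \<ge> 2 * \<epsilon>"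
  shows "(LINT y|lborel. fejer_wave \<epsilon> a y * cnj (cube_wave \<epsilon> b (N *v (y - x)))) = 0"
proof -
  let ?Q = "cbox (b - (\<chi> i. \<epsilon>)) (b + (\<chi> i. \<epsilon>))"
  interpret lborel_pair: pair_sigma_finite "lborel :: (real^'n) measure" "lborel :: (real^'n) measure" ..
  define F where "F y \<xi> = indicator ?Q \<xi> *\<^sub>R (fejer_wave \<epsilon> a y * cis (- (\<xi> \<bullet> (N *v (y - x)))))" for y \<xi>
  have Q_int: "integrable lborel (indicator ?Q :: real^'n \<Rightarrow> real)"
    by (intro integrable_real_indicator emeasure_bounded_finite) auto
  have cnj_eq: "cnj (indicator ?Q \<xi> *\<^sub>R cis (\<xi> \<bullet> z)) = indicator ?Q \<xi> *\<^sub>R cis (- (\<xi> \<bullet> z))" for \<xi> z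
    by (simp add: cis_cnj scaleR_conv_of_real)
  have inner: "fejer_wave \<epsilon> a y * cnj (cube_wave \<epsilon> b (N *v (y - x))) = (LINT \<xi>|lborel. F y \<xi>)" for y
  proof -
    have "cnj (cube_wave \<epsilon> b (N *v (y - x))) = (LINT \<xi>|lborel. indicator ?Q \<xi> *\<^sub>R cis (- (\<xi> \<bullet> (N *v (y - x)))))"
      unfolding cube_wave_eq_integral[OF e] cnj_eq[symmetric] by (rule Bochner_Integration.integral_cnj[symmetric])
    then show ?thesis unfolding F_def by (simp add: mult_scaleR_right[symmetric] del: mult_scaleR_right)
  qed
  have [measurable]: "(\<lambda>p :: (real^'n) \<times> (real^'n). snd p \<bullet> (N *v (fst p - x))) \<in> borel_measurable (borel \<Otimes>\<^sub>M borel)"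
    unfolding borel_prod by (intro borel_measurable_continuous_onI continuous_intros
        bounded_linear.continuous_on[OF matrix_vector_mul_bounded_linear])
  have F_meas: "case_prod F \<in> borel_measurable (lborel \<Otimes>\<^sub>M lborel)"
    unfolding F_def case_prod_beta by measurable
  have normF: "norm (F y \<xi>) = indicator ?Q \<xi> * cmod (fejer_wave \<epsilon> a y)" for y \<xi>
    by (simp add: F_def norm_mult)
  have "integrable (lborel \<Otimes>\<^sub>M lborel) (case_prod F)"
  proof (rule lborel_pair.Fubini_integrable[OF F_meas])
    show "integrable lborel (\<lambda>y. LINT \<xi>|lborel. norm (case_prod F (y, \<xi>)))"
      using integrable_norm[OF fejer_wave_integrable[OF e, of a]] by (simp add: normF)
    have "integrable lborel (\<lambda>\<xi>. case_prod F (y, \<xi>))" for y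
    proof (rule Bochner_Integration.integrable_bound)
      show "integrable lborel (\<lambda>\<xi>. indicator ?Q \<xi> * cmod (fejer_wave \<epsilon> a y))"
        by (intro integrable_mult_left Q_int)
      show "(\<lambda>\<xi>. case_prod F (y, \<xi>)) \<in> borel_measurable lborel" using F_meas by measurable
    qed (simp add: normF)
    then show "AE y in lborel. integrable lborel (\<lambda>\<xi>. case_prod F (y, \<xi>))" by simp
  qed
  then have "(LINT y|lborel. LINT \<xi>|lborel. F y \<xi>) = (LINT \<xi>|lborel. LINT y|lborel. F y \<xi>)"
    by (rule lborel_pair.Fubini_integral[symmetric])
  also have "\<dots> = (LINT \<xi>|(lborel :: (real^'n) measure). 0)"
  proof (intro Bochner_Integration.integral_cong refl)
    fix \<xi> :: "real^'n"
    show "(LINT y|lborel. F y \<xi>) = 0"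
    proof (cases "\<xi> \<in> ?Q")
      case True
      then obtain k where k: "\<bar>a $ k - (transpose N *v \<xi>) $ k\<bar> \<ge> 2 * \<epsilon>" using far by blast
      have "\<xi> \<bullet> (N *v (y - x)) = (transpose N *v \<xi>) \<bullet> y - \<xi> \<bullet> (N *v x)" for y
        by (simp add: matrix_vector_mult_diff_distrib inner_diff_right dot_lmul_matrix[symmetric])
      then have "F y \<xi> = cis (\<xi> \<bullet> (N *v x)) * (fejer_wave \<epsilon> a y * cis (- ((transpose N *v \<xi>) \<bullet> y)))" for y
        using True by (simp add: F_def cis_mult mult.left_commute)
      then show ?thesis using fejer_wave_transform[OF e k] by simp
    qed (simp add: F_def)
  qed
  finally show ?thesis unfolding inner by simp
qed

text \<open>Choose \<open>f0\<close> with frequencies in \<open>A\<close> and \<open>f1\<close> with frequencies in \<open>B\<close>. The operators of the representation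
  move the frequencies of \<open>f1\<close> within the invariant set \<open>B\<close>, so \<open>f0\<close> is orthogonal to the whole orbit of \<open>f1\<close>.
  The orthogonal complement \<open>M\<close> of that orbit is a closed invariant subspace which contains \<open>f0\<close> but
  not \<open>f1\<close>.\<close>

theorem irreducible_imp_no_disjoint_open_invariant:
  fixes H :: "(real^'n::{finite,wellorder}^'n::_) set"
  assumes irr: "quasi_regular_irreducible H" and sub: "subgroup H GL"
    and A: "open A" "A \<noteq> {}" and B: "open B" "B \<noteq> {}" and disj: "A \<inter> B = {}"
    and inv: "\<And>h \<xi>. h \<in> H \<Longrightarrow> \<xi> \<in> B \<Longrightarrow> transpose h *v \<xi> \<in> B"
  shows False
proof -
  note H = subgroup_GL[OF sub]
  obtain a where a: "a \<in> A" using A by auto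
  obtain b where b: "b \<in> B" using B by auto
  obtain r where r: "r > 0" "ball a r \<subseteq> A" using A a open_contains_ball by blast
  obtain s where s: "s > 0" "ball b s \<subseteq> B" using B b open_contains_ball by blast
  \<comment> \<open>small enough for cubes with half side \<open>2 * \<epsilon>\<close> to fit into the balls of radius \<open>r\<close> and \<open>s\<close>\<close>
  define \<epsilon> where "\<epsilon> = min r s / (4 * real CARD('n))"
  have e: "\<epsilon> > 0" using r s by (simp add: \<epsilon>_def)
  have small: "norm v < min r s" if "\<And>k. \<bar>v $ k\<bar> \<le> 2 * \<epsilon>" for v :: "real^'n::_"
  proof -
    have "norm v \<le> (\<Sum>k\<in>UNIV. \<bar>v $ k\<bar>)" by (rule norm_le_l1_cart)
    also have "\<dots> \<le> (\<Sum>k\<in>(UNIV::'n set). 2 * \<epsilon>)" by (intro sum_mono that)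
    also have "\<dots> = min r s / 2" by (simp add: \<epsilon>_def)
    finally show ?thesis using r s by simp
  qed
  define f0 where "f0 = fejer_wave \<epsilon> a"
  define f1 where "f1 = cube_wave \<epsilon> b"
  define M where "M = {f \<in> L2. \<forall>x. \<forall>h\<in>H. L2_inner f (quasi_regular (x, h) f1) = 0}"
  have f0: "f0 \<in> L2" "f0 \<notin> null_functions" and f1: "f1 \<in> L2" "f1 \<notin> null_functions"
    unfolding f0_def f1_def using e by (simp_all add: fejer_wave_L2 cube_wave_L2 waves_not_null)
  have qf1: "quasi_regular (x, h) f1 \<in> L2" if "h \<in> H" for x h
    using quasi_regular_L2[OF H(4)[OF that] f1(1)] .
  have closed: "closed_L2_subspace M"
    unfolding closed_L2_subspace_def
  proof (intro conjI ballI allI impI)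
    show "M \<subseteq> L2" by (auto simp: M_def)
    show "(\<lambda>y. 0) \<in> M" by (simp add: M_def L2_def L2_inner_def)
  next
    fix f g assume fg: "f \<in> M" "g \<in> M"
    have "L2_inner (\<lambda>y. f y + g y) (quasi_regular (x, h) f1) = 0" if "h \<in> H" for x h
    proof -
      have "L2_inner (\<lambda>y. f y + g y) (quasi_regular (x, h) f1)
          = L2_inner f (quasi_regular (x, h) f1) + L2_inner g (quasi_regular (x, h) f1)"
        using L2_product_integrable[OF _ qf1[OF that]] fg by (simp add: L2_inner_def M_def distrib_right)
      then show ?thesis using fg that by (simp add: M_def)
    qed
    then show "(\<lambda>y. f y + g y) \<in> M" using fg L2_add by (auto simp: M_def)
  next
    fix c f assume f: "f \<in> M"
    have "L2_inner (\<lambda>y. c * f y) g = c * L2_inner f g" for g by (simp add: L2_inner_def mult.assoc)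
    then show "(\<lambda>y. c * f y) \<in> M" using f L2_cmult by (auto simp: M_def)
  next
    fix u f
    assume u: "(\<forall>n. u n \<in> M) \<and> f \<in> L2 \<and> (\<lambda>n. LINT y|lborel. (cmod (u n y - f y))\<^sup>2) \<longlonglongrightarrow> 0"
    have "L2_inner f (quasi_regular (x, h) f1) = 0" if "h \<in> H" for x h
      using u that by (intro L2_inner_limit[of u f]) (auto simp: M_def qf1)
    then show "f \<in> M" using u by (simp add: M_def)
  qed
  have invar: "quasi_regular g f \<in> M" if g: "g \<in> carrier (semidirect H)" and f: "f \<in> M" for g f
  proof -
    obtain w k where wk: "g = (w, k)" "k \<in> H" using g by (auto simp: semidirect_def)
    have "L2_inner (quasi_regular (w, k) f) (quasi_regular (x, h) f1) = 0" if "h \<in> H" for x h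
      using f wk that H f1 by (intro quasi_regular_move) (auto simp: M_def)
    then show ?thesis using f wk quasi_regular_L2[OF H(4)[OF wk(2)]] by (simp add: M_def)
  qed
  have f0_M: "f0 \<in> M"
  proof -
    have "L2_inner f0 (quasi_regular (x, h) f1) = 0" if h: "h \<in> H" for x h
    proof -
      have "(LINT y|lborel. f0 y * cnj (f1 (matrix_inv h *v (y - x)))) = 0"
        unfolding f0_def f1_def
      proof (rule waves_orthogonal[OF e])
        fix \<xi> assume "\<xi> \<in> cbox (b - (\<chi> i. \<epsilon>)) (b + (\<chi> i. \<epsilon>))"
        then have "\<bar>(\<xi> - b) $ k\<bar> \<le> 2 * \<epsilon>" for k
        proof -
          have "b $ k - \<epsilon> \<le> \<xi> $ k" "\<xi> $ k \<le> b $ k + \<epsilon>"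
            using \<open>\<xi> \<in> _\<close> by (simp_all add: mem_box_cart)
          then show ?thesis using e by (simp add: abs_le_iff)
        qed
        then have "norm (\<xi> - b) < s" using small[of "\<xi> - b"] by simp
        then have "\<xi> \<in> B" using s by (auto simp: dist_norm norm_minus_commute)
        then have "transpose (matrix_inv h) *v \<xi> \<in> B" using inv H(3)[OF h] by blast
        then have "transpose (matrix_inv h) *v \<xi> \<notin> ball a r" using disj r by blast
        then have "\<not> norm (a - transpose (matrix_inv h) *v \<xi>) < min r s" by (simp add: dist_norm)
        then show "\<exists>k. \<bar>a $ k - (transpose (matrix_inv h) *v \<xi>) $ k\<bar> \<ge> 2 * \<epsilon>"
          using small[of "a - transpose (matrix_inv h) *v \<xi>"] by (metis linear vector_minus_component)
      qed
      moreover have "L2_inner f0 (quasi_regular (x, h) f1)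
        = (LINT y|lborel. complex_of_real (\<bar>det h\<bar> powr (-1/2)) * (f0 y * cnj (f1 (matrix_inv h *v (y - x)))))"
        by (simp add: L2_inner_def quasi_regular_def mult.left_commute)
      ultimately show ?thesis by simp
    qed
    then show ?thesis using f0 by (simp add: M_def)
  qed
  have "f1 \<notin> M"
  proof
    assume "f1 \<in> M"
    then have "L2_inner f1 (quasi_regular (0, mat 1) f1) = 0" using H(1) by (simp add: M_def)
    moreover have "quasi_regular (0, mat 1) f1 = f1"
    proof -
      have "matrix_inv (mat 1 :: real^'n::_^'n::_) = mat 1" by (rule matrix_inv_unique) simp_all
      then show ?thesis by (simp add: quasi_regular_def)
    qed
    ultimately have "(LINT y|lborel. complex_of_real ((cmod (f1 y))\<^sup>2)) = 0"
      by (simp add: L2_inner_def complex_norm_square del: of_real_power)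
    then have "(LINT y|lborel. (cmod (f1 y))\<^sup>2) = 0"
      by (metis integral_complex_of_real of_real_eq_0_iff)
    then have "AE y in lborel. (cmod (f1 y))\<^sup>2 = 0"
      using f1(1) by (subst (asm) integral_nonneg_eq_0_iff_AE) (auto simp: L2_def)
    then show False using f1 by (simp add: null_functions_def)
  qed
  then have "M \<noteq> L2" using f1 by blast
  moreover have "M \<noteq> null_functions" using f0_M f0 by blast
  ultimately show False using irr closed invar unfolding quasi_regular_irreducible_def by blast
qed

section \<open>Commutative groups of shears that are normalized by dilations\<close>

lemma first_index_le: "first_index \<le> (i :: 'n::{finite,wellorder})"
  unfolding first_index_def by (rule Min_le) auto

lemma first_index_less: "i \<noteq> first_index \<longleftrightarrow> first_index < (i :: 'n::{finite,wellorder})"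
  using first_index_le[of i] by auto

text \<open>Conjugation of \<open>s\<close> by \<open>exp (r Y)\<close>, where \<open>Y\<close> is the diagonal matrix with entries \<open>lam\<close>; see
  \<open>scale_conj_eq\<close> below. In this form it needs no matrix products.\<close>

definition scale_conj :: "('n \<Rightarrow> real) \<Rightarrow> real \<Rightarrow> real^'n^'n \<Rightarrow> real^'n^'n" where
  "scale_conj lam r s = (\<chi> i j. exp (r * (lam i - lam j)) * s $ i $ j)"

locale shear_group =
  fixes S :: "(real^'n::{finite,wellorder}^'n::_) set" and lam :: "'n \<Rightarrow> real"
  assumes one_in: "mat 1 \<in> S"
    and mult_in: "s \<in> S \<Longrightarrow> t \<in> S \<Longrightarrow> s ** t \<in> S"
    and inv_in: "s \<in> S \<Longrightarrow> \<exists>t\<in>S. s ** t = mat 1 \<and> t ** s = mat 1"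
    and unip: "S \<subseteq> unipotent_upper"
    and comm: "s \<in> S \<Longrightarrow> t \<in> S \<Longrightarrow> s ** t = t ** s"
    and scale_in: "s \<in> S \<Longrightarrow> scale_conj lam r s \<in> S"
    and lam_first: "lam first_index = 1"
    and lam_less: "i \<noteq> first_index \<Longrightarrow> lam i < 1"
begin

abbreviation \<iota> :: 'n where "\<iota> \<equiv> first_index"

text \<open>The first row takes all prescribed values in the columns strictly between \<open>\<iota>\<close> and \<open>j\<close>.\<close>

definition hits_below :: "'n \<Rightarrow> bool" where
  "hits_below j \<longleftrightarrow> (\<forall>t. \<exists>s\<in>S. \<forall>k\<in>{\<iota><..<j}. s $ \<iota> $ k = t k)"

lemma diag_entry: "s \<in> S \<Longrightarrow> s $ i $ i = 1" and lower_entry: "s \<in> S \<Longrightarrow> j < i \<Longrightarrow> s $ i $ j = 0"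
  using unip by (auto simp: unipotent_upper_def)

lemma scale_row: "scale_conj lam r s $ \<iota> $ k = exp (r * (1 - lam k)) * s $ \<iota> $ k"
  by (simp add: scale_conj_def lam_first)

text \<open>A column of a unipotent matrix ends with its diagonal entry. Splitting off the first and the last term
  is what makes recursion along the columns possible.\<close>

lemma mult_row:
  assumes t: "t \<in> S" and k: "k \<noteq> \<iota>"
  shows "(\<Sum>l\<in>UNIV. x l * t $ l $ k) = x \<iota> * t $ \<iota> $ k + x k + (\<Sum>l\<in>{\<iota><..<k}. x l * t $ l $ k)"
proof -
  have k': "\<iota> < k" using k first_index_less by blast
  have "(\<Sum>l\<in>UNIV. x l * t $ l $ k) = (\<Sum>l\<in>insert \<iota> (insert k {\<iota><..<k}). x l * t $ l $ k)"
  proof (rule sum.mono_neutral_right)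
    show "\<forall>l\<in>UNIV - insert \<iota> (insert k {\<iota><..<k}). x l * t $ l $ k = 0"
    proof
      fix l assume "l \<in> UNIV - insert \<iota> (insert k {\<iota><..<k})"
      then have "k < l" using first_index_less[of l] by auto
      then show "x l * t $ l $ k = 0" using lower_entry[OF t] by simp
    qed
  qed auto
  also have "\<dots> = x \<iota> * t $ \<iota> $ k + x k + (\<Sum>l\<in>{\<iota><..<k}. x l * t $ l $ k)"
    using k k' diag_entry[OF t, of k] by simp
  finally show ?thesis .
qed

lemma prod_row:
  assumes "s \<in> S" "t \<in> S" "k \<noteq> \<iota>"
  shows "(s ** t) $ \<iota> $ k = t $ \<iota> $ k + s $ \<iota> $ k + (\<Sum>l\<in>{\<iota><..<k}. s $ \<iota> $ l * t $ l $ k)"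
  using mult_row[OF assms(2,3), of "\<lambda>l. s $ \<iota> $ l"] diag_entry[OF assms(1), of \<iota>]
  by (simp add: matrix_matrix_mult_def)

lemma hits_below_mono: "hits_below j \<Longrightarrow> k \<le> j \<Longrightarrow> hits_below k"
  unfolding hits_below_def by (meson greaterThanLessThan_iff less_le_trans)

text \<open>Take \<open>\<sigma>\<close> in \<open>S\<close> whose first row is the sum of the first and the \<open>i\<close>-th unit vector, up to column \<open>k\<close>. The first row
  of \<open>\<sigma> ** s\<close> then exhibits row \<open>i\<close> of \<open>s\<close>, while the first row of \<open>s ** \<sigma>\<close> is linear in the first row of \<open>s\<close>.\<close>

lemma entries_linear_in_row:
  assumes hits: "hits_below k" and i: "\<iota> < i" "i < k"
  obtains c where "\<And>s. s \<in> S \<Longrightarrow> s $ i $ k = (\<Sum>l\<in>{\<iota><..<k}. s $ \<iota> $ l * c l)"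
proof -
  obtain \<sigma> where \<sigma>: "\<sigma> \<in> S" "\<And>l. l \<in> {\<iota><..<k} \<Longrightarrow> \<sigma> $ \<iota> $ l = (if l = i then 1 else 0)"
    using hits[unfolded hits_below_def, rule_format, of "\<lambda>l. if l = i then 1 else 0"] by blast
  have "s $ i $ k = (\<Sum>l\<in>{\<iota><..<k}. s $ \<iota> $ l * \<sigma> $ l $ k)" if s: "s \<in> S" for s
  proof -
    have k: "k \<noteq> \<iota>" using i by auto
    have "(\<sigma> ** s) $ \<iota> $ k = (s ** \<sigma>) $ \<iota> $ k" using comm[OF \<sigma>(1) s] by simp
    then have "(\<Sum>l\<in>{\<iota><..<k}. \<sigma> $ \<iota> $ l * s $ l $ k) = (\<Sum>l\<in>{\<iota><..<k}. s $ \<iota> $ l * \<sigma> $ l $ k)"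
      using prod_row[OF \<sigma>(1) s k] prod_row[OF s \<sigma>(1) k] by simp
    moreover have "(\<Sum>l\<in>{\<iota><..<k}. \<sigma> $ \<iota> $ l * s $ l $ k) = (\<Sum>l\<in>{\<iota><..<k}. if l = i then s $ l $ k else 0)"
      using \<sigma>(2) by (intro sum.cong) auto
    ultimately show ?thesis using i by (simp add: sum.delta')
  qed
  then show thesis by (rule that)
qed

lemma entries_bounded_by_row:
  assumes hits: "hits_below k" and i: "\<iota> < i" "i < k"
  obtains c where "c \<ge> 0"
    "\<And>s B. s \<in> S \<Longrightarrow> (\<And>l. l \<in> {\<iota><..<k} \<Longrightarrow> \<bar>s $ \<iota> $ l\<bar> \<le> B) \<Longrightarrow> \<bar>s $ i $ k\<bar> \<le> B * c"
proof -
  obtain d where d: "\<And>s. s \<in> S \<Longrightarrow> s $ i $ k = (\<Sum>l\<in>{\<iota><..<k}. s $ \<iota> $ l * d l)"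
    using entries_linear_in_row[OF assms] by blast
  have "\<bar>s $ i $ k\<bar> \<le> B * (\<Sum>l\<in>{\<iota><..<k}. \<bar>d l\<bar>)"
    if "s \<in> S" "\<And>l. l \<in> {\<iota><..<k} \<Longrightarrow> \<bar>s $ \<iota> $ l\<bar> \<le> B" for s B
  proof -
    have "\<bar>s $ i $ k\<bar> \<le> (\<Sum>l\<in>{\<iota><..<k}. \<bar>s $ \<iota> $ l * d l\<bar>)" unfolding d[OF that(1)] by (rule sum_abs)
    also have "\<dots> \<le> (\<Sum>l\<in>{\<iota><..<k}. B * \<bar>d l\<bar>)"
      using that(2) by (intro sum_mono) (simp add: abs_mult mult_right_mono)
    finally show ?thesis by (simp add: sum_distrib_left)
  qed
  then show thesis by (intro that[of "\<Sum>l\<in>{\<iota><..<k}. \<bar>d l\<bar>"]) (auto intro: sum_nonneg)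
qed

text \<open>The element \<open>n\<close> moves column \<open>j\<close> without touching the columns before it. Conjugation by dilations
  multiplies its entry there by any positive number, and the inverse of \<open>n\<close> supplies the other sign, so the
  entry in column \<open>j\<close> can be corrected to any value.\<close>

lemma extend_hits:
  assumes hits: "hits_below j" and j: "j \<noteq> \<iota>"
    and n: "n \<in> S" "\<And>k. k \<in> {\<iota><..<j} \<Longrightarrow> n $ \<iota> $ k = 0" "n $ \<iota> $ j \<noteq> 0"
  shows "\<exists>s\<in>S. \<forall>k\<in>{\<iota><..j}. s $ \<iota> $ k = t k"
proof -
  have dilate: "\<exists>m\<in>S. (\<forall>k\<in>{\<iota><..<j}. m $ \<iota> $ k = 0) \<and> m $ \<iota> $ j = x"
    if p: "p \<in> S" "\<And>k. k \<in> {\<iota><..<j} \<Longrightarrow> p $ \<iota> $ k = 0" and pos: "x / p $ \<iota> $ j > 0" for p x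
  proof -
    let ?r = "ln (x / p $ \<iota> $ j) / (1 - lam j)"
    have "?r * (1 - lam j) = ln (x / p $ \<iota> $ j)" using lam_less[OF j] by simp
    then have "scale_conj lam ?r p $ \<iota> $ j = x" using pos by (auto simp: scale_row)
    then show ?thesis using scale_in[OF p(1)] p(2) by (intro bexI[of _ "scale_conj lam ?r p"]) (auto simp: scale_row)
  qed
  obtain n' where n': "n' \<in> S" "n ** n' = mat 1" using inv_in[OF n(1)] by blast
  have n'_row: "n' $ \<iota> $ k = - n $ \<iota> $ k" if "\<iota> < k" "k \<le> j" for k
  proof -
    have "(\<Sum>l\<in>{\<iota><..<k}. n $ \<iota> $ l * n' $ l $ k) = 0" using that n(2) by (intro sum.neutral) auto
    moreover have "k \<noteq> \<iota>" "\<iota> \<noteq> k" using that by auto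
    ultimately show ?thesis using prod_row[OF n(1) n'(1), of k] by (simp add: n'(2) mat_def)
  qed
  have all: "\<exists>m\<in>S. (\<forall>k\<in>{\<iota><..<j}. m $ \<iota> $ k = 0) \<and> m $ \<iota> $ j = x" for x
  proof (cases "x = 0")
    case True
    then show ?thesis using one_in j by (intro bexI[of _ "mat 1"]) (auto simp: mat_def)
  next
    case False
    have n'j: "n' $ \<iota> $ j = - n $ \<iota> $ j" using n'_row[of j] j first_index_less[of j] by simp
    have "x / n $ \<iota> $ j > 0 \<or> x / n' $ \<iota> $ j > 0"
    proof -
      have "x / n $ \<iota> $ j \<noteq> 0" using False n(3) by simp
      then have "x / n $ \<iota> $ j > 0 \<or> - (x / n $ \<iota> $ j) > 0" by linarith
      then show ?thesis by (simp add: n'j)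
    qed
    then consider "x / n $ \<iota> $ j > 0" | "x / n' $ \<iota> $ j > 0" by blast
    then show ?thesis
    proof cases
      case 1
      then show ?thesis using dilate[OF n(1,2)] by blast
    next
      case 2
      then show ?thesis using n'_row n(2) by (intro dilate[OF n'(1)]) auto
    qed
  qed
  obtain s where s: "s \<in> S" "\<forall>k\<in>{\<iota><..<j}. s $ \<iota> $ k = t k" using hits by (auto simp: hits_below_def)
  obtain m where m: "m \<in> S" "\<forall>k\<in>{\<iota><..<j}. m $ \<iota> $ k = 0" "m $ \<iota> $ j = t j - s $ \<iota> $ j"
    using all by blast
  have "(m ** s) $ \<iota> $ k = t k" if k: "k \<in> {\<iota><..j}" for k
  proof -
    have "(\<Sum>l\<in>{\<iota><..<k}. m $ \<iota> $ l * s $ l $ k) = 0" using k m(2) by (intro sum.neutral) auto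
    then have "(m ** s) $ \<iota> $ k = s $ \<iota> $ k + m $ \<iota> $ k" using prod_row[OF m(1) s(1), of k] k by auto
    then show ?thesis using k m s by (cases "k = j") auto
  qed
  then show ?thesis using mult_in[OF m(1) s(1)] by blast
qed

end

text \<open>The situation that irreducibility will rule out: an element whose first row vanishes strictly between
  \<open>\<iota>\<close> and \<open>j\<close> also has a zero in column \<open>j\<close>.\<close>

locale graph_shear_group = shear_group S lam
  for S :: "(real^'n::{finite,wellorder}^'n::_) set" and lam :: "'n \<Rightarrow> real" +
  fixes j :: 'n
  assumes hits: "hits_below j" and j: "j \<noteq> first_index"
    and kernel: "n \<in> S \<Longrightarrow> (\<And>k. k \<in> {first_index<..<j} \<Longrightarrow> n $ first_index $ k = 0) \<Longrightarrow> n $ first_index $ j = 0"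
begin

lemma j_less: "\<iota> < j" using j first_index_less by blast

text \<open>The quotient of two elements with equal rows before column \<open>j\<close> lies in the kernel, so their entries in
  column \<open>j\<close> agree as well. Thus the first rows form the graph of a function.\<close>

lemma entry_determined:
  assumes s: "s \<in> S" and t: "t \<in> S" and eq: "\<And>k. k \<in> {\<iota><..<j} \<Longrightarrow> s $ \<iota> $ k = t $ \<iota> $ k"
  shows "s $ \<iota> $ j = t $ \<iota> $ j"
proof -
  obtain s' where s': "s' \<in> S" "s' ** s = mat 1" using inv_in[OF s] by blast
  define n where "n = t ** s'"
  have n: "n \<in> S" using mult_in t s' by (simp add: n_def)
  have ns: "n ** s = t" by (simp add: n_def matrix_mul_assoc[symmetric] s')
  have zero: "k \<in> {\<iota><..<j} \<longrightarrow> n $ \<iota> $ k = 0" for k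
  proof (induction k rule: less_induct)
    case (less k)
    show ?case
    proof
      assume k: "k \<in> {\<iota><..<j}"
      then have "(\<Sum>l\<in>{\<iota><..<k}. n $ \<iota> $ l * s $ l $ k) = 0" using less.IH by (intro sum.neutral) auto
      then show "n $ \<iota> $ k = 0" using prod_row[OF n s, of k] k eq[OF k] by (auto simp: ns)
    qed
  qed
  then have "n $ \<iota> $ j = 0" using kernel[OF n] by blast
  moreover have "(\<Sum>l\<in>{\<iota><..<j}. n $ \<iota> $ l * s $ l $ j) = 0" using zero by (intro sum.neutral) auto
  ultimately show ?thesis using prod_row[OF n s j] by (simp add: ns)
qed

text \<open>The function whose graph is formed by the first rows.\<close>

definition last_coord :: "real^'n::_ \<Rightarrow> real" where
  "last_coord x = (THE y. \<exists>s\<in>S. (\<forall>k\<in>{\<iota><..<j}. s $ \<iota> $ k = x $ k) \<and> s $ \<iota> $ j = y)"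

lemma last_coord_eq:
  assumes "s \<in> S" "\<And>k. k \<in> {\<iota><..<j} \<Longrightarrow> s $ \<iota> $ k = x $ k"
  shows "last_coord x = s $ \<iota> $ j"
  unfolding last_coord_def
proof (rule the_equality)
  show "\<exists>s'\<in>S. (\<forall>k\<in>{\<iota><..<j}. s' $ \<iota> $ k = x $ k) \<and> s' $ \<iota> $ j = s $ \<iota> $ j" using assms by blast
  fix y assume "\<exists>s\<in>S. (\<forall>k\<in>{\<iota><..<j}. s $ \<iota> $ k = x $ k) \<and> s $ \<iota> $ j = y"
  then obtain s' where "s' \<in> S" "\<forall>k\<in>{\<iota><..<j}. s' $ \<iota> $ k = x $ k" "s' $ \<iota> $ j = y" by blast
  then show "y = s $ \<iota> $ j" using entry_determined[of s' s] assms by simp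
qed

text \<open>All multiples of a unit vector by at most \<open>B\<close> are obtained from two elements, with row entry \<open>B\<close> and \<open>- B\<close>, by
  contracting conjugations, and these do not increase the entry in column \<open>j\<close>.\<close>

lemma elementary_bounded:
  assumes m: "m \<in> {\<iota><..<j}" and B: "B > 0"
  obtains C where "\<And>x. \<bar>x\<bar> \<le> B \<Longrightarrow> \<exists>\<tau>\<in>S. (\<forall>k\<in>{\<iota><..<j}. \<tau> $ \<iota> $ k = (if k = m then x else 0)) \<and> \<bar>\<tau> $ \<iota> $ j\<bar> \<le> C"
proof -
  have "\<exists>\<tau>\<in>S. \<forall>k\<in>{\<iota><..<j}. \<tau> $ \<iota> $ k = (if k = m then y else 0)" for y :: real
    using hits[unfolded hits_below_def, rule_format, of "\<lambda>k. if k = m then y else 0"] .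
  then obtain T where T: "\<And>y. T y \<in> S" "\<And>y k. k \<in> {\<iota><..<j} \<Longrightarrow> T y $ \<iota> $ k = (if k = m then y else 0)"
    by metis
  let ?C = "\<bar>T B $ \<iota> $ j\<bar> + \<bar>T (- B) $ \<iota> $ j\<bar>"
  have "\<exists>\<tau>\<in>S. (\<forall>k\<in>{\<iota><..<j}. \<tau> $ \<iota> $ k = (if k = m then x else 0)) \<and> \<bar>\<tau> $ \<iota> $ j\<bar> \<le> ?C"
    if x: "\<bar>x\<bar> \<le> B" for x
  proof (cases "x = 0")
    case True
    then show ?thesis using one_in j by (intro bexI[of _ "mat 1"]) (auto simp: mat_def)
  next
    case False
    define b where "b = (if x > 0 then B else - B)"
    define r where "r = ln (x / b) / (1 - lam m)"
    have lm: "1 - lam m > 0" and lj: "1 - lam j > 0" using lam_less[of m] lam_less[OF j] m by auto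
    have q: "0 < x / b" "x / b \<le> 1" "b \<noteq> 0" using x False B by (auto simp: b_def field_simps zero_less_divide_iff)
    then have "r \<le> 0" using lm by (simp add: r_def divide_nonpos_pos)
    then have "exp (r * (1 - lam j)) \<le> 1" using lj by (simp add: mult_nonpos_nonneg)
    then have "\<bar>scale_conj lam r (T b) $ \<iota> $ j\<bar> \<le> \<bar>T b $ \<iota> $ j\<bar>"
      by (simp add: scale_row abs_mult mult_left_le_one_le)
    also have "\<dots> \<le> ?C" by (simp add: b_def)
    finally have "\<bar>scale_conj lam r (T b) $ \<iota> $ j\<bar> \<le> ?C" .
    moreover have "r * (1 - lam m) = ln (x / b)" using lm by (simp add: r_def)
    then have "exp (r * (1 - lam m)) * b = x" using q by simp
    then have "\<forall>k\<in>{\<iota><..<j}. scale_conj lam r (T b) $ \<iota> $ k = (if k = m then x else 0)"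
      by (simp add: scale_row T(2))
    ultimately show ?thesis using scale_in[OF T(1)] by blast
  qed
  then show thesis by (rule that)
qed

text \<open>The graph function is bounded on bounded sets. The columns are cleared one after the other: multiplying
  by an element of \<open>elementary_bounded\<close> removes the entry in column \<open>m\<close>, and since all other entries are
  linear in the first row, the remaining row stays bounded and column \<open>j\<close> changes by a bounded amount. The
  induction is on the number of columns that are not cleared yet; at the end the kernel condition
  applies.\<close>

lemma last_entry_bounded_aux:
  "B > 0 \<Longrightarrow> \<exists>C. \<forall>s\<in>S. (\<forall>k\<in>{\<iota><..<j}. k < m \<longrightarrow> s $ \<iota> $ k = 0) \<and> (\<forall>k\<in>{\<iota><..<j}. \<bar>s $ \<iota> $ k\<bar> \<le> B) \<longrightarrow> \<bar>s $ \<iota> $ j\<bar> \<le> C"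
proof (induction "card {m..<j}" arbitrary: m B rule: less_induct)
  case less
  show ?case
  proof (cases "m < j")
    case False
    then have "\<forall>s\<in>S. (\<forall>k\<in>{\<iota><..<j}. k < m \<longrightarrow> s $ \<iota> $ k = 0) \<longrightarrow> s $ \<iota> $ j = 0"
      using kernel by fastforce
    then show ?thesis by (intro exI[of _ 0]) auto
  next
    case True
    \<comment> \<open>the column after \<open>m\<close>\<close>
    define m' where "m' = (LEAST x. m < x)"
    have m': "m < m'" "k < m' \<Longrightarrow> k \<le> m" for k
      unfolding m'_def using True LeastI[of "\<lambda>x. m < x" j] not_less_Least[of k "\<lambda>x. m < x"] by auto
    have "card {m'..<j} < card {m..<j}" 
    proof (rule psubset_card_mono)
      have "m \<in> {m..<j}" "m \<notin> {m'..<j}" "{m'..<j} \<subseteq> {m..<j}" using m'(1) True by auto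
      then show "{m'..<j} \<subset> {m..<j}" by blast
    qed simp
    note IH = less.hyps[OF this]
    show ?thesis
    proof (cases "m = \<iota>")
      case True
      obtain C where "\<forall>s\<in>S. (\<forall>k\<in>{\<iota><..<j}. k < m' \<longrightarrow> s $ \<iota> $ k = 0) \<and> (\<forall>k\<in>{\<iota><..<j}. \<bar>s $ \<iota> $ k\<bar> \<le> B) \<longrightarrow> \<bar>s $ \<iota> $ j\<bar> \<le> C"
        using IH[OF less.prems] by blast
      moreover have "\<forall>k\<in>{\<iota><..<j}. \<not> k < m'" using m'(2) True by force
      ultimately show ?thesis by (intro exI[of _ C]) simp
    next
      case False
      then have m: "m \<in> {\<iota><..<j}" using True first_index_less[of m] by simp
      obtain C1 where C1: "\<And>x. \<bar>x\<bar> \<le> B \<Longrightarrow> \<exists>\<tau>\<in>S. (\<forall>k\<in>{\<iota><..<j}. \<tau> $ \<iota> $ k = (if k = m then x else 0)) \<and> \<bar>\<tau> $ \<iota> $ j\<bar> \<le> C1"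
        using elementary_bounded[OF m less.prems] by blast
      \<comment> \<open>row \<open>m\<close> is what multiplication by \<open>\<tau>\<close> adds to the first row\<close>
      have "\<exists>c\<ge>0. \<forall>s\<in>S. (\<forall>l\<in>{\<iota><..<j}. \<bar>s $ \<iota> $ l\<bar> \<le> B) \<longrightarrow> \<bar>s $ m $ k\<bar> \<le> B * c" if k: "m < k" "k \<le> j" for k
      proof -
        obtain c where "c \<ge> 0"
          "\<And>s B. s \<in> S \<Longrightarrow> (\<And>l. l \<in> {\<iota><..<k} \<Longrightarrow> \<bar>s $ \<iota> $ l\<bar> \<le> B) \<Longrightarrow> \<bar>s $ m $ k\<bar> \<le> B * c"
          using entries_bounded_by_row[OF hits_below_mono[OF hits k(2)], of m] m k by auto
        moreover have "{\<iota><..<k} \<subseteq> {\<iota><..<j}" using k by auto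
        ultimately show ?thesis by (intro exI[of _ c]) blast
      qed
      then obtain c where c: "\<And>k. m < k \<Longrightarrow> k \<le> j \<Longrightarrow> c k \<ge> 0"
        "\<And>k s. m < k \<Longrightarrow> k \<le> j \<Longrightarrow> s \<in> S \<Longrightarrow> (\<forall>l\<in>{\<iota><..<j}. \<bar>s $ \<iota> $ l\<bar> \<le> B) \<Longrightarrow> \<bar>s $ m $ k\<bar> \<le> B * c k"
        by metis
      define D where "D = (\<Sum>k\<in>{m<..j}. c k)"
      have cD: "c k \<le> D" if "m < k" "k \<le> j" for k
        unfolding D_def using that c(1) by (intro member_le_sum) auto
      have D0: "D \<ge> 0" unfolding D_def using c(1) by (intro sum_nonneg) auto
      have Bpos: "B > 0" by fact
      obtain C2 where C2: "\<And>s. s \<in> S \<Longrightarrow> (\<forall>k\<in>{\<iota><..<j}. k < m' \<longrightarrow> s $ \<iota> $ k = 0) \<Longrightarrow>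
          (\<forall>k\<in>{\<iota><..<j}. \<bar>s $ \<iota> $ k\<bar> \<le> B + B * (B * D)) \<Longrightarrow> \<bar>s $ \<iota> $ j\<bar> \<le> C2"
        using IH[of "B + B * (B * D)"] Bpos D0 by (auto simp: add_pos_nonneg)
      have "\<bar>s $ \<iota> $ j\<bar> \<le> C2 + C1 + B * (B * D)"
        if s: "s \<in> S" and z: "\<forall>k\<in>{\<iota><..<j}. k < m \<longrightarrow> s $ \<iota> $ k = 0" and b: "\<forall>k\<in>{\<iota><..<j}. \<bar>s $ \<iota> $ k\<bar> \<le> B" for s
      proof -
        define x where "x = - s $ \<iota> $ m"
        have xB: "\<bar>x\<bar> \<le> B" using b m by (simp add: x_def)
        then obtain \<tau> where \<tau>: "\<tau> \<in> S" "\<forall>k\<in>{\<iota><..<j}. \<tau> $ \<iota> $ k = (if k = m then x else 0)" "\<bar>\<tau> $ \<iota> $ j\<bar> \<le> C1"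
          using C1 by blast
        have xs: "\<bar>x * s $ m $ k\<bar> \<le> B * (B * D)" if k: "m < k" "k \<le> j" for k
        proof -
          have "\<bar>s $ m $ k\<bar> \<le> B * c k" by (rule c(2)[OF k s b])
          also have "\<dots> \<le> B * D" using cD[OF k] Bpos by simp
          finally show ?thesis unfolding abs_mult using xB Bpos by (intro mult_mono) auto
        qed
        have row: "(\<tau> ** s) $ \<iota> $ k = s $ \<iota> $ k + \<tau> $ \<iota> $ k + (if m < k then x * s $ m $ k else 0)"
          if k: "k \<in> {\<iota><..j}" for k
        proof -
          have "(\<Sum>l\<in>{\<iota><..<k}. \<tau> $ \<iota> $ l * s $ l $ k) = (\<Sum>l\<in>{\<iota><..<k}. if l = m then x * s $ l $ k else 0)"
            using \<tau>(2) k by (intro sum.cong) auto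
          then show ?thesis using prod_row[OF \<tau>(1) s, of k] k m by (auto simp: sum.delta')
        qed
        have "\<bar>(\<tau> ** s) $ \<iota> $ j\<bar> \<le> C2"
        proof (rule C2[OF mult_in[OF \<tau>(1) s]])
          show "\<forall>k\<in>{\<iota><..<j}. k < m' \<longrightarrow> (\<tau> ** s) $ \<iota> $ k = 0"
          proof (intro ballI impI)
            fix k assume k: "k \<in> {\<iota><..<j}" "k < m'"
            then have "k \<le> m" using m'(2) by blast
            then show "(\<tau> ** s) $ \<iota> $ k = 0" using row[of k] k \<tau>(2) z by (cases "k = m") (auto simp: x_def)
          qed
          show "\<forall>k\<in>{\<iota><..<j}. \<bar>(\<tau> ** s) $ \<iota> $ k\<bar> \<le> B + B * (B * D)"
          proof
            fix k assume k: "k \<in> {\<iota><..<j}"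
            show "\<bar>(\<tau> ** s) $ \<iota> $ k\<bar> \<le> B + B * (B * D)"
            proof (cases "m < k")
              case True
              then have "(\<tau> ** s) $ \<iota> $ k = s $ \<iota> $ k + x * s $ m $ k" using row[of k] k \<tau>(2) by auto
              then show ?thesis using xs[OF True] k b abs_triangle_ineq[of "s $ \<iota> $ k" "x * s $ m $ k"] by force
            next
              case False
              have "0 \<le> B * (B * D)" using Bpos D0 by simp
              moreover have "\<bar>(\<tau> ** s) $ \<iota> $ k\<bar> \<le> B"
                using row[of k] k \<tau>(2) b False Bpos by (cases "k = m") (auto simp: x_def)
              ultimately show ?thesis by linarith
            qed
          qed
        qed
        moreover have "(\<tau> ** s) $ \<iota> $ j = s $ \<iota> $ j + \<tau> $ \<iota> $ j + x * s $ m $ j" using row[of j] j_less m by auto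
        moreover have "\<bar>x * s $ m $ j\<bar> \<le> B * (B * D)" using xs[of j] m by auto
        ultimately show ?thesis using \<tau>(3) by linarith
      qed
      then show ?thesis by blast
    qed
  qed
qed

text \<open>Expanding a tiny row to a row of size one multiplies its entry in column \<open>j\<close> by a large factor, but the
  product is still bounded.\<close>

lemma last_entry_small:
  assumes e: "e > 0"
  obtains d where "d > 0" "\<And>s. s \<in> S \<Longrightarrow> (\<And>k. k \<in> {\<iota><..<j} \<Longrightarrow> \<bar>s $ \<iota> $ k\<bar> \<le> d) \<Longrightarrow> \<bar>s $ \<iota> $ j\<bar> \<le> e"
proof -
  obtain C where C: "\<And>s. s \<in> S \<Longrightarrow> (\<forall>k\<in>{\<iota><..<j}. \<bar>s $ \<iota> $ k\<bar> \<le> 1) \<Longrightarrow> \<bar>s $ \<iota> $ j\<bar> \<le> C"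
  proof -
    have "\<not> k < \<iota>" for k using first_index_le[of k] by simp
    then show thesis using last_entry_bounded_aux[OF zero_less_one, of \<iota>] that by auto
  qed
  define K where "K = \<bar>C\<bar> + e"
  have K: "K > 0" "K \<ge> e" "C \<le> K" using e by (auto simp: K_def)
  define r where "r = ln (K / e) / (1 - lam j)"
  have lj: "1 - lam j > 0" using lam_less[OF j] by simp
  have r: "r \<ge> 0" "exp (r * (1 - lam j)) = K / e" using K e lj by (simp_all add: r_def)
  define M where "M = (\<Sum>k\<in>UNIV. \<bar>1 - lam k\<bar>)"
  have M: "1 - lam k \<le> M" for k
    using member_le_sum[of k UNIV "\<lambda>k. \<bar>1 - lam k\<bar>"] by (simp add: M_def)
  have "\<bar>s $ \<iota> $ j\<bar> \<le> e" if s: "s \<in> S" and small: "\<And>k. k \<in> {\<iota><..<j} \<Longrightarrow> \<bar>s $ \<iota> $ k\<bar> \<le> exp (- r * M)" for s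
  proof -
    have "\<bar>scale_conj lam r s $ \<iota> $ j\<bar> \<le> C"
    proof (rule C[OF scale_in[OF s]], rule ballI)
      fix k assume k: "k \<in> {\<iota><..<j}"
      have "\<bar>scale_conj lam r s $ \<iota> $ k\<bar> \<le> exp (r * (1 - lam k)) * exp (- r * M)"
        using small[OF k] by (simp add: scale_row abs_mult)
      also have "\<dots> = exp (r * ((1 - lam k) - M))" by (simp add: exp_add[symmetric] algebra_simps)
      also have "\<dots> \<le> 1" using r(1) M[of k] by (simp add: mult_nonneg_nonpos)
      finally show "\<bar>scale_conj lam r s $ \<iota> $ k\<bar> \<le> 1" .
    qed
    then have "K / e * \<bar>s $ \<iota> $ j\<bar> \<le> K" using K e by (simp add: scale_row r(2) abs_mult)
    then show ?thesis using K e by (simp add: field_simps)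
  qed
  then show thesis by (intro that[of "exp (- r * M)"]) auto
qed

text \<open>Right multiplication by \<open>s0\<close> transports continuity at the origin to any other point: with \<open>s0\<close>
  over \<open>x0\<close> and \<open>s\<close> over \<open>x\<close>, the first row of \<open>n = s ** \<rho>\<close>, where \<open>\<rho>\<close> is the inverse of \<open>s0\<close>, depends continuously on
  \<open>x\<close> and vanishes at \<open>x0\<close>, and \<open>s = n ** s0\<close>.\<close>

lemma last_coord_isCont: "isCont last_coord x0"
proof -
  obtain s0 where s0: "s0 \<in> S" "\<And>k. k \<in> {\<iota><..<j} \<Longrightarrow> s0 $ \<iota> $ k = x0 $ k"
    using hits[unfolded hits_below_def, rule_format, of "\<lambda>k. x0 $ k"] by blast
  obtain \<rho> where \<rho>: "\<rho> \<in> S" "s0 ** \<rho> = mat 1" "\<rho> ** s0 = mat 1" using inv_in[OF s0(1)] by blast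
  define N where "N x k = \<rho> $ \<iota> $ k + x $ k + (\<Sum>l\<in>{\<iota><..<k}. x $ l * \<rho> $ l $ k)" for x :: "real^'n::_" and k
  have N_row: "(s ** \<rho>) $ \<iota> $ k = N x k"
    if "s \<in> S" "\<And>k. k \<in> {\<iota><..<j} \<Longrightarrow> s $ \<iota> $ k = x $ k" "k \<in> {\<iota><..<j}" for s x k
  proof -
    have "(\<Sum>l\<in>{\<iota><..<k}. s $ \<iota> $ l * \<rho> $ l $ k) = (\<Sum>l\<in>{\<iota><..<k}. x $ l * \<rho> $ l $ k)"
      using that by (intro sum.cong) auto
    then show ?thesis using prod_row[OF that(1) \<rho>(1), of k] that by (auto simp: N_def)
  qed
  have N_cont: "isCont (\<lambda>x. N x k) x0" for k unfolding N_def by (intro continuous_intros)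
  have N0: "N x0 k = 0" if "k \<in> {\<iota><..<j}" for k
  proof -
    have "\<iota> \<noteq> k" using that by auto
    then show ?thesis using N_row[OF s0 that] by (simp add: \<rho> mat_def)
  qed
  define L where "L x = (\<Sum>l\<in>{\<iota><..<j}. N x l * s0 $ l $ j)" for x
  have L_lim: "(L \<longlongrightarrow> 0) (at x0)"
  proof -
    have "isCont L x0" unfolding L_def by (intro continuous_intros N_cont)
    moreover have "L x0 = 0" using N0 by (simp add: L_def)
    ultimately show ?thesis by (simp add: isCont_def)
  qed
  have rem: "((\<lambda>x. last_coord x - last_coord x0 - L x) \<longlongrightarrow> 0) (at x0)"
  proof (rule tendstoI)
    fix e :: real assume e: "e > 0"
    obtain d where d: "d > 0" "\<And>s. s \<in> S \<Longrightarrow> (\<And>k. k \<in> {\<iota><..<j} \<Longrightarrow> \<bar>s $ \<iota> $ k\<bar> \<le> d) \<Longrightarrow> \<bar>s $ \<iota> $ j\<bar> \<le> e / 2"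
      using last_entry_small[of "e / 2"] e by auto
    have "\<forall>\<^sub>F x in at x0. \<forall>k\<in>{\<iota><..<j}. \<bar>N x k\<bar> < d"
    proof (rule eventually_ball_finite)
      show "\<forall>k\<in>{\<iota><..<j}. \<forall>\<^sub>F x in at x0. \<bar>N x k\<bar> < d"
      proof
        fix k assume k: "k \<in> {\<iota><..<j}"
        have "((\<lambda>x. N x k) \<longlongrightarrow> 0) (at x0)" using N_cont[of k] N0[OF k] by (simp add: isCont_def)
        from tendstoD[OF this d(1)] show "\<forall>\<^sub>F x in at x0. \<bar>N x k\<bar> < d" by (simp add: dist_real_def)
      qed
    qed simp
    then show "\<forall>\<^sub>F x in at x0. dist (last_coord x - last_coord x0 - L x) 0 < e"
    proof eventually_elim
      fix x assume x: "\<forall>k\<in>{\<iota><..<j}. \<bar>N x k\<bar> < d"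
      obtain s where s: "s \<in> S" "\<And>k. k \<in> {\<iota><..<j} \<Longrightarrow> s $ \<iota> $ k = x $ k"
        using hits[unfolded hits_below_def, rule_format, of "\<lambda>k. x $ k"] by blast
      define n where "n = s ** \<rho>"
      have n: "n \<in> S" using mult_in s \<rho> by (simp add: n_def)
      have nN: "n $ \<iota> $ k = N x k" if "k \<in> {\<iota><..<j}" for k using N_row[OF s that] by (simp add: n_def)
      have ns: "n ** s0 = s" by (simp add: n_def matrix_mul_assoc[symmetric] \<rho>)
      have "s $ \<iota> $ j = s0 $ \<iota> $ j + n $ \<iota> $ j + (\<Sum>l\<in>{\<iota><..<j}. n $ \<iota> $ l * s0 $ l $ j)"
        using prod_row[OF n s0(1) j] by (simp add: ns)
      also have "(\<Sum>l\<in>{\<iota><..<j}. n $ \<iota> $ l * s0 $ l $ j) = L x" unfolding L_def using nN by (intro sum.cong) auto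
      finally have "last_coord x - last_coord x0 - L x = n $ \<iota> $ j" using last_coord_eq[OF s] last_coord_eq[OF s0] by simp
      moreover have "\<bar>n $ \<iota> $ j\<bar> \<le> e / 2" using x by (intro d(2)[OF n]) (auto simp: nN less_imp_le)
      ultimately show "dist (last_coord x - last_coord x0 - L x) 0 < e" using e by (simp add: dist_real_def)
    qed
  qed
  have "((\<lambda>x. (last_coord x - last_coord x0 - L x) + last_coord x0 + L x) \<longlongrightarrow> 0 + last_coord x0 + 0) (at x0)"
    by (intro tendsto_intros rem L_lim)
  then show ?thesis by (simp add: isCont_def)
qed

text \<open>The signed height of \<open>\<xi>\<close> above the graph, measured after normalizing the first coordinate to one.\<close>

definition height :: "real^'n::_ \<Rightarrow> real" where
  "height \<xi> = \<xi> $ j / \<xi> $ \<iota> - last_coord ((1 / \<xi> $ \<iota>) *\<^sub>R \<xi>)"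

lemma height_eq:
  assumes "\<xi> $ \<iota> \<noteq> 0" "s \<in> S" "\<And>k. k \<in> {\<iota><..<j} \<Longrightarrow> \<xi> $ k = \<xi> $ \<iota> * s $ \<iota> $ k"
  shows "height \<xi> = \<xi> $ j / \<xi> $ \<iota> - s $ \<iota> $ j"
  unfolding height_def using assms by (subst last_coord_eq[of s]) auto

lemma row_rep:
  assumes "\<xi> $ \<iota> \<noteq> 0"
  obtains s where "s \<in> S" "\<And>k. k \<in> {\<iota><..<j} \<Longrightarrow> \<xi> $ k = \<xi> $ \<iota> * s $ \<iota> $ k"
proof -
  obtain s where "s \<in> S" "\<forall>k\<in>{\<iota><..<j}. s $ \<iota> $ k = \<xi> $ k / \<xi> $ \<iota>"
    using hits[unfolded hits_below_def, rule_format, of "\<lambda>k. \<xi> $ k / \<xi> $ \<iota>"] by blast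
  then show thesis using assms by (intro that[of s]) auto
qed

lemma height_shear:
  assumes xi: "\<xi> $ \<iota> \<noteq> 0" and t: "t \<in> S"
  shows "(transpose t *v \<xi>) $ \<iota> = \<xi> $ \<iota>" "height (transpose t *v \<xi>) = height \<xi>"
proof -
  obtain s where s: "s \<in> S" "\<And>k. k \<in> {\<iota><..<j} \<Longrightarrow> \<xi> $ k = \<xi> $ \<iota> * s $ \<iota> $ k" using row_rep[OF xi] by blast
  define w where "w = transpose t *v \<xi>"
  have comp: "w $ k = (\<Sum>l\<in>UNIV. \<xi> $ l * t $ l $ k)" for k
    unfolding w_def by (simp add: matrix_vector_mult_def transpose_def mult.commute del: transpose_matrix_vector)
  have "(\<Sum>l\<in>UNIV. \<xi> $ l * t $ l $ \<iota>) = (\<Sum>l\<in>{\<iota>}. \<xi> $ l * t $ l $ \<iota>)"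
    using lower_entry[OF t] first_index_less by (intro sum.mono_neutral_right) auto
  then have 1: "w $ \<iota> = \<xi> $ \<iota>" using diag_entry[OF t] by (simp add: comp)
  then show "(transpose t *v \<xi>) $ \<iota> = \<xi> $ \<iota>" by (simp only: w_def)
  have row: "w $ k = \<xi> $ \<iota> * ((s ** t) $ \<iota> $ k - s $ \<iota> $ k) + \<xi> $ k" if k: "k \<in> {\<iota><..j}" for k
  proof -
    have "(\<Sum>l\<in>{\<iota><..<k}. \<xi> $ l * t $ l $ k) = \<xi> $ \<iota> * (\<Sum>l\<in>{\<iota><..<k}. s $ \<iota> $ l * t $ l $ k)"
      unfolding sum_distrib_left using s k by (intro sum.cong) auto
    moreover have "k \<noteq> \<iota>" using k by auto
    ultimately show ?thesis
      using mult_row[OF t, of k "\<lambda>l. \<xi> $ l"] prod_row[OF s(1) t, of k]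
      by (simp add: comp algebra_simps)
  qed
  have "height w = w $ j / w $ \<iota> - (s ** t) $ \<iota> $ j"
  proof (rule height_eq)
    show "w $ \<iota> \<noteq> 0" using xi by (simp add: 1)
    show "s ** t \<in> S" using mult_in s t by blast
    show "w $ k = w $ \<iota> * (s ** t) $ \<iota> $ k" if k: "k \<in> {\<iota><..<j}" for k
      using row[of k] s(2)[OF k] k by (simp add: 1 algebra_simps less_imp_le)
  qed
  also have "\<dots> = \<xi> $ j / \<xi> $ \<iota> - s $ \<iota> $ j" using row[of j] j_less xi by (simp add: 1 field_simps)
  also have "\<dots> = height \<xi>" using height_eq[OF xi s] by simp
  finally show "height (transpose t *v \<xi>) = height \<xi>" by (simp only: w_def)
qed

text \<open>The graph is invariant under the dilations, so heights are only multiplied by a positive factor and keep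
  their sign.\<close>

lemma height_scale:
  fixes r :: real
  assumes xi: "\<xi> $ \<iota> \<noteq> 0"
  defines "\<xi>' \<equiv> \<chi> k. exp (r * lam k) * \<xi> $ k"
  shows "\<xi>' $ \<iota> \<noteq> 0" "height \<xi>' = exp (- r * (1 - lam j)) * height \<xi>"
proof -
  obtain s where s: "s \<in> S" "\<And>k. k \<in> {\<iota><..<j} \<Longrightarrow> \<xi> $ k = \<xi> $ \<iota> * s $ \<iota> $ k" using row_rep[OF xi] by blast
  show nz: "\<xi>' $ \<iota> \<noteq> 0" using xi by (simp add: \<xi>'_def)
  have e: "exp (r * lam k) = exp r * exp (- r * (1 - lam k))" for k
    by (simp add: exp_add[symmetric] algebra_simps)
  have "height \<xi>' = \<xi>' $ j / \<xi>' $ \<iota> - scale_conj lam (- r) s $ \<iota> $ j"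
    using s nz by (intro height_eq scale_in) (auto simp: \<xi>'_def scale_row e lam_first)
  also have "\<dots> = exp (- r * (1 - lam j)) * (\<xi> $ j / \<xi> $ \<iota> - s $ \<iota> $ j)"
    by (simp add: \<xi>'_def scale_row e[of j] lam_first right_diff_distrib)
  also have "\<dots> = exp (- r * (1 - lam j)) * height \<xi>" using height_eq[OF xi s] by simp
  finally show "height \<xi>' = exp (- r * (1 - lam j)) * height \<xi>" .
qed

lemma height_uminus: "height (- \<xi>) = height \<xi>"
  by (simp add: height_def)

lemma height_continuous: "continuous_on {\<xi>. \<xi> $ \<iota> \<noteq> 0} height"
proof -
  have "continuous_on UNIV last_coord" using last_coord_isCont by (simp add: continuous_at_imp_continuous_on)
  then have "continuous_on {\<xi>. \<xi> $ \<iota> \<noteq> 0} (\<lambda>\<xi>. last_coord ((1 / \<xi> $ \<iota>) *\<^sub>R \<xi>))"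
    by (rule continuous_on_compose2) (auto intro!: continuous_intros)
  then show ?thesis unfolding height_def[abs_def] by (intro continuous_intros) auto
qed

lemma open_nonzero_first: "open {\<xi> :: real^'n::_. \<xi> $ \<iota> \<noteq> 0}"
  by (intro open_Collect_neq continuous_intros)

lemma height_sets:
  defines "A \<equiv> {\<xi>. \<xi> $ \<iota> \<noteq> 0 \<and> height \<xi> > 0}" and "B \<equiv> {\<xi>. \<xi> $ \<iota> \<noteq> 0 \<and> height \<xi> < 0}"
  shows "open A" "open B" "A \<noteq> {}" "B \<noteq> {}" "A \<inter> B = {}"
proof -
  have "open ({\<xi>. \<xi> $ \<iota> \<noteq> 0} \<inter> height -` {0<..})" "open ({\<xi>. \<xi> $ \<iota> \<noteq> 0} \<inter> height -` {..<0})"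
    by (rule continuous_open_preimage[OF height_continuous open_nonzero_first]; simp)+
  then show "open A" "open B" by (simp_all add: A_def B_def vimage_def Collect_conj_eq[symmetric] Int_def)
  have h: "height (axis \<iota> 1 + axis j c) = c" for c
    using one_in j by (subst height_eq[of _ "mat 1"]) (auto simp: axis_def mat_def)
  have "axis \<iota> 1 + axis j 1 \<in> A" "axis \<iota> 1 + axis j (-1) \<in> B"
    unfolding A_def B_def using j by (auto simp: h) (auto simp: axis_def)
  then show "A \<noteq> {}" "B \<noteq> {}" by auto
  show "A \<inter> B = {}" by (auto simp: A_def B_def)
qed

end

context shear_group
begin

text \<open>Induction on the columns: either column \<open>j\<close> can be reached by \<open>extend_hits\<close>, or \<open>S\<close> is a graph over the columns
  before \<open>j\<close> and the points above and below it form two disjoint open invariant sets.\<close>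

lemma row_surjective:
  assumes no_invariant: "\<And>A B. \<lbrakk>open A; open B; A \<noteq> {}; B \<noteq> {}; A \<inter> B = {};
      \<And>s \<xi>. s \<in> S \<Longrightarrow> \<xi> \<in> B \<Longrightarrow> transpose s *v \<xi> \<in> B;
      \<And>r \<xi>. \<xi> \<in> B \<Longrightarrow> (\<chi> k. exp (r * lam k) * \<xi> $ k) \<in> B;
      \<And>\<xi>. \<xi> \<in> B \<Longrightarrow> - \<xi> \<in> B\<rbrakk> \<Longrightarrow> False"
  shows "\<exists>s\<in>S. \<forall>k. k \<noteq> \<iota> \<longrightarrow> s $ \<iota> $ k = t k"
proof -
  have "\<forall>t. \<exists>s\<in>S. \<forall>k\<in>{\<iota><..j}. s $ \<iota> $ k = t k" for j
  proof (induction j rule: less_induct)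
    case (less j)
    have hits: "hits_below j"
      unfolding hits_below_def
    proof
      fix t
      show "\<exists>s\<in>S. \<forall>k\<in>{\<iota><..<j}. s $ \<iota> $ k = t k"
      proof (cases "{\<iota><..<j} = {}")
        case True
        then show ?thesis using one_in by auto
      next
        case False
        define m where "m = Max {\<iota><..<j}"
        have "m \<in> {\<iota><..<j}" unfolding m_def by (rule Max_in) (use False in auto)
        then obtain s where "s \<in> S" "\<forall>k\<in>{\<iota><..m}. s $ \<iota> $ k = t k" using less.IH[of m] by auto
        moreover have "k \<le> m" if "k \<in> {\<iota><..<j}" for k unfolding m_def using that by (intro Max_ge) auto
        ultimately show ?thesis by (intro bexI[of _ s]) auto
      qed
    qed
    show ?case
    proof (cases "j = \<iota>")
      case True
      then show ?thesis using one_in by auto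
    next
      case j: False
      show ?thesis
      proof (cases "\<exists>n\<in>S. (\<forall>k\<in>{\<iota><..<j}. n $ \<iota> $ k = 0) \<and> n $ \<iota> $ j \<noteq> 0")
        case True
        then show ?thesis using extend_hits[OF hits j] by blast
      next
        case False
        interpret G: graph_shear_group S lam j
          using hits j False by unfold_locales blast+
        show ?thesis
        proof (rule FalseE, rule no_invariant[OF G.height_sets])
          fix s \<xi> assume "s \<in> S" "\<xi> \<in> {\<xi>. \<xi> $ \<iota> \<noteq> 0 \<and> G.height \<xi> < 0}"
          then show "transpose s *v \<xi> \<in> {\<xi>. \<xi> $ \<iota> \<noteq> 0 \<and> G.height \<xi> < 0}"
            using G.height_shear[of \<xi> s] by (simp del: transpose_matrix_vector)
        next
          fix r \<xi> assume "\<xi> \<in> {\<xi>. \<xi> $ \<iota> \<noteq> 0 \<and> G.height \<xi> < 0}"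
          then show "(\<chi> k. exp (r * lam k) * \<xi> $ k) \<in> {\<xi>. \<xi> $ \<iota> \<noteq> 0 \<and> G.height \<xi> < 0}"
            using G.height_scale[of \<xi> r] by (simp add: mult_pos_neg)
        next
          fix \<xi> assume "\<xi> \<in> {\<xi>. \<xi> $ \<iota> \<noteq> 0 \<and> G.height \<xi> < 0}"
          then show "- \<xi> \<in> {\<xi>. \<xi> $ \<iota> \<noteq> 0 \<and> G.height \<xi> < 0}" by (simp add: G.height_uminus)
        qed
      qed
    qed
  qed
  from this[of "Max UNIV"] obtain s where s: "s \<in> S" "\<forall>k\<in>{\<iota><..Max UNIV}. s $ \<iota> $ k = t k" by blast
  have "k \<in> {\<iota><..Max UNIV}" if "k \<noteq> \<iota>" for k using that first_index_less[of k] by simp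
  then show ?thesis using s by blast
qed

end

section \<open>Groups of shears with all first rows\<close>

locale full_shear_group = shear_group S lam
  for S :: "(real^'n::{finite,wellorder}^'n::_) set" and lam :: "'n \<Rightarrow> real" +
  assumes row_onto: "\<exists>s\<in>S. \<forall>k. k \<noteq> first_index \<longrightarrow> s $ first_index $ k = t k"
begin

lemma hits_all: "hits_below k"
  unfolding hits_below_def
proof
  fix t
  obtain s where "s \<in> S" "\<forall>k. k \<noteq> \<iota> \<longrightarrow> s $ \<iota> $ k = t k" using row_onto by blast
  then show "\<exists>s\<in>S. \<forall>k\<in>{\<iota><..<k}. s $ \<iota> $ k = t k" by (intro bexI[of _ s]) auto
qed

lemma bounded_row_bounded_entries:
  assumes B: "B \<ge> 1"
  obtains C where "\<And>s i k. s \<in> S \<Longrightarrow> (\<And>k. k \<noteq> \<iota> \<Longrightarrow> \<bar>s $ \<iota> $ k\<bar> \<le> B) \<Longrightarrow> \<bar>s $ i $ k\<bar> \<le> C"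
proof -
  have "\<exists>C. \<forall>s\<in>S. (\<forall>k. k \<noteq> \<iota> \<longrightarrow> \<bar>s $ \<iota> $ k\<bar> \<le> B) \<longrightarrow> \<bar>s $ i $ k\<bar> \<le> C" for i k
  proof (cases "\<iota> < i \<and> i < k")
    case True
    then obtain c where "\<And>s B. s \<in> S \<Longrightarrow> (\<And>l. l \<in> {\<iota><..<k} \<Longrightarrow> \<bar>s $ \<iota> $ l\<bar> \<le> B) \<Longrightarrow> \<bar>s $ i $ k\<bar> \<le> B * c"
      using entries_bounded_by_row[OF hits_all, of i k] by blast
    then show ?thesis by (intro exI[of _ "B * c"]) force
  next
    case False
    then consider "i = \<iota>" "k \<noteq> \<iota>" | "k = i" | "k < i" using first_index_less[of i] by fastforce
    then show ?thesis
    proof cases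
      case 1
      then show ?thesis by blast
    next
      case 2
      then show ?thesis using diag_entry by (intro exI[of _ 1]) simp
    next
      case 3
      then show ?thesis using lower_entry by (intro exI[of _ 0]) simp
    qed
  qed
  then obtain C where C: "\<And>i k s. s \<in> S \<Longrightarrow> \<forall>k. k \<noteq> \<iota> \<longrightarrow> \<bar>s $ \<iota> $ k\<bar> \<le> B \<Longrightarrow> \<bar>s $ i $ k\<bar> \<le> C i k"
    by metis
  have "\<bar>s $ i $ k\<bar> \<le> (\<Sum>p\<in>UNIV. \<bar>case p of (i, k) \<Rightarrow> C i k\<bar>)"
    if "s \<in> S" "\<And>k. k \<noteq> \<iota> \<Longrightarrow> \<bar>s $ \<iota> $ k\<bar> \<le> B" for s i k
  proof -
    have "\<bar>s $ i $ k\<bar> \<le> C i k" using C that by blast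
    also have "\<dots> \<le> \<bar>case (i, k) of (i, k) \<Rightarrow> C i k\<bar>" by simp
    also have "\<dots> \<le> (\<Sum>p\<in>UNIV. \<bar>case p of (i, k) \<Rightarrow> C i k\<bar>)" by (rule member_le_sum) auto
    finally show ?thesis .
  qed
  then show thesis by (rule that)
qed

text \<open>The first row of the inverse is computed from that of \<open>s\<close> by a recursion along the columns, with bounds
  depending only on the column.\<close>

lemma bounded_row_bounded_inverse:
  assumes B: "B \<ge> 1"
  obtains C where "\<And>s t i k. s \<in> S \<Longrightarrow> t \<in> S \<Longrightarrow> t ** s = mat 1 \<Longrightarrow> (\<And>k. k \<noteq> \<iota> \<Longrightarrow> \<bar>s $ \<iota> $ k\<bar> \<le> B) \<Longrightarrow> \<bar>t $ i $ k\<bar> \<le> C"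
proof -
  obtain C where C: "\<And>s i k. s \<in> S \<Longrightarrow> (\<And>k. k \<noteq> \<iota> \<Longrightarrow> \<bar>s $ \<iota> $ k\<bar> \<le> B) \<Longrightarrow> \<bar>s $ i $ k\<bar> \<le> C"
    using bounded_row_bounded_entries[OF B] by blast
  have "\<exists>D. k \<noteq> \<iota> \<longrightarrow> (\<forall>s\<in>S. \<forall>t\<in>S. t ** s = mat 1 \<longrightarrow> (\<forall>k. k \<noteq> \<iota> \<longrightarrow> \<bar>s $ \<iota> $ k\<bar> \<le> B) \<longrightarrow> \<bar>t $ \<iota> $ k\<bar> \<le> D)" for k
  proof (induction k rule: less_induct)
    case (less k)
    then obtain D where D: "\<And>l s t. l < k \<Longrightarrow> l \<noteq> \<iota> \<Longrightarrow> s \<in> S \<Longrightarrow> t \<in> S \<Longrightarrow> t ** s = mat 1 \<Longrightarrow>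
        \<forall>k. k \<noteq> \<iota> \<longrightarrow> \<bar>s $ \<iota> $ k\<bar> \<le> B \<Longrightarrow> \<bar>t $ \<iota> $ l\<bar> \<le> D l"
      by metis
    have "\<bar>t $ \<iota> $ k\<bar> \<le> B + (\<Sum>l\<in>{\<iota><..<k}. D l * C)"
      if k: "k \<noteq> \<iota>" and st: "s \<in> S" "t \<in> S" "t ** s = mat 1" and b: "\<forall>k. k \<noteq> \<iota> \<longrightarrow> \<bar>s $ \<iota> $ k\<bar> \<le> B" for s t
    proof -
      have "t $ \<iota> $ k = - s $ \<iota> $ k - (\<Sum>l\<in>{\<iota><..<k}. t $ \<iota> $ l * s $ l $ k)"
        using prod_row[OF st(2,1) k] k by (simp add: st(3) mat_def)
      then have "\<bar>t $ \<iota> $ k\<bar> \<le> \<bar>s $ \<iota> $ k\<bar> + \<bar>\<Sum>l\<in>{\<iota><..<k}. t $ \<iota> $ l * s $ l $ k\<bar>" by linarith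
      also have "\<dots> \<le> B + (\<Sum>l\<in>{\<iota><..<k}. \<bar>t $ \<iota> $ l * s $ l $ k\<bar>)"
        using b k by (intro add_mono sum_abs) auto
      also have "(\<Sum>l\<in>{\<iota><..<k}. \<bar>t $ \<iota> $ l * s $ l $ k\<bar>) \<le> (\<Sum>l\<in>{\<iota><..<k}. D l * C)"
      proof (rule sum_mono)
        fix l assume l: "l \<in> {\<iota><..<k}"
        have t: "\<bar>t $ \<iota> $ l\<bar> \<le> D l" using D[of l s t] l st b by auto
        have "\<bar>s $ l $ k\<bar> \<le> C" using C[OF st(1)] b by blast
        then show "\<bar>t $ \<iota> $ l * s $ l $ k\<bar> \<le> D l * C" unfolding abs_mult using t by (intro mult_mono) auto
      qed
      finally show ?thesis by simp
    qed
    then show ?case by blast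
  qed
  then obtain D where D: "\<And>k s t. k \<noteq> \<iota> \<Longrightarrow> s \<in> S \<Longrightarrow> t \<in> S \<Longrightarrow> t ** s = mat 1 \<Longrightarrow>
      \<forall>k. k \<noteq> \<iota> \<longrightarrow> \<bar>s $ \<iota> $ k\<bar> \<le> B \<Longrightarrow> \<bar>t $ \<iota> $ k\<bar> \<le> D k"
    by metis
  define M where "M = 1 + (\<Sum>k\<in>UNIV. \<bar>D k\<bar>)"
  have M: "M \<ge> 1" by (simp add: M_def sum_nonneg)
  have DM: "D k \<le> M" for k using member_le_sum[of k UNIV "\<lambda>k. \<bar>D k\<bar>"] by (simp add: M_def)
  obtain C' where C': "\<And>s i k. s \<in> S \<Longrightarrow> (\<And>k. k \<noteq> \<iota> \<Longrightarrow> \<bar>s $ \<iota> $ k\<bar> \<le> M) \<Longrightarrow> \<bar>s $ i $ k\<bar> \<le> C'"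
    using bounded_row_bounded_entries[OF M] by blast
  show thesis
  proof (rule that[of C'])
    fix s t i k assume st: "s \<in> S" "t \<in> S" "t ** s = mat 1" and b: "\<And>k. k \<noteq> \<iota> \<Longrightarrow> \<bar>s $ \<iota> $ k\<bar> \<le> B"
    have "\<bar>t $ \<iota> $ k\<bar> \<le> M" if "k \<noteq> \<iota>" for k
    proof -
      have "\<bar>t $ \<iota> $ k\<bar> \<le> D k" using D[OF that st] b by blast
      then show ?thesis using DM[of k] by linarith
    qed
    then show "\<bar>t $ i $ k\<bar> \<le> C'" by (intro C'[OF st(2)])
  qed
qed

end

section \<open>Diagonal matrices\<close>

abbreviation dilation :: "('n \<Rightarrow> real) \<Rightarrow> real \<Rightarrow> real^'n^'n" where
  "dilation lam r \<equiv> diag_matrix (\<lambda>i. exp (r * lam i))"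

lemma diag_mult_left: "diag_matrix c ** A = (\<chi> i k. c i * A $ i $ k)"
  by (simp add: vec_eq_iff matrix_matrix_mult_def diag_matrix_def if_distrib[of "\<lambda>x. x * _"] cong: if_cong)

lemma diag_mult_right: "A ** diag_matrix c = (\<chi> i k. A $ i $ k * c k)"
  by (simp add: vec_eq_iff matrix_matrix_mult_def diag_matrix_def if_distrib[of "\<lambda>x. _ * x"] cong: if_cong)

lemma diag_mult_vec: "diag_matrix c *v x = (\<chi> i. c i * x $ i)"
  by (simp add: vec_eq_iff matrix_vector_mult_def diag_matrix_def if_distrib[of "\<lambda>x. x * _"] cong: if_cong)

lemma dilation_add: "dilation lam r ** dilation lam s = dilation lam (r + s)"
  by (simp add: diag_mult_left vec_eq_iff) (simp add: diag_matrix_def exp_add[symmetric] distrib_right)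

lemma diag_one: "diag_matrix (\<lambda>i. 1) = mat 1"
  by (simp add: diag_matrix_def mat_def)

lemma dilation_inverse: "dilation lam r ** dilation lam (- r) = mat 1" "dilation lam (- r) ** dilation lam r = mat 1"
  using dilation_add[where lam = lam and r = r and s = "- r"] dilation_add[where lam = lam and r = "- r" and s = r]
  by (simp_all add: diag_one)

lemma scale_conj_eq: "scale_conj lam r s = dilation lam r ** s ** dilation lam (- r)"
  by (simp add: scale_conj_def diag_mult_left diag_mult_right vec_eq_iff exp_add[symmetric] algebra_simps)

lemma matrix_power_diag: "matrix_power (diag_matrix c) k = diag_matrix (\<lambda>i. c i ^ k)"
proof (induction k)
  case 0
  then show ?case by (simp add: matrix_power_def diag_matrix_def mat_def)
next
  case (Suc k)
  have "matrix_power (diag_matrix c) (Suc k) = diag_matrix c ** matrix_power (diag_matrix c) k"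
    by (simp add: matrix_power_def)
  then show ?case by (simp add: Suc diag_mult_left) (simp add: vec_eq_iff diag_matrix_def)
qed

lemma matrix_exp_diag: "matrix_exp (r *\<^sub>R diag_matrix lam) = dilation lam r"
proof -
  have smult: "r *\<^sub>R diag_matrix lam = diag_matrix (\<lambda>i. r * lam i)"
    by (simp add: vec_eq_iff diag_matrix_def)
  have "(\<lambda>k. (1 / fact k) *\<^sub>R matrix_power (r *\<^sub>R diag_matrix lam) k) sums dilation lam r"
    unfolding sums_def
  proof (intro vec_tendstoI)
    fix i j
    have "(\<lambda>k. if i = j then (r * lam i) ^ k /\<^sub>R fact k else 0) sums (if i = j then exp (r * lam i) else 0)"
      using exp_converges[of "r * lam i"] by auto
    then have "(\<lambda>n. \<Sum>k<n. if i = j then (r * lam i) ^ k /\<^sub>R fact k else 0)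
      \<longlonglongrightarrow> (if i = j then exp (r * lam i) else 0)"
      by (simp only: sums_def)
    moreover have "((1 / fact k) *\<^sub>R matrix_power (r *\<^sub>R diag_matrix lam) k) $ i $ j
        = (if i = j then (r * lam i) ^ k /\<^sub>R fact k else 0)" for k
      unfolding smult matrix_power_diag by (simp add: diag_matrix_def divide_inverse)
    ultimately show "(\<lambda>n. (\<Sum>k<n. (1 / fact k) *\<^sub>R matrix_power (r *\<^sub>R diag_matrix lam) k) $ i $ j) \<longlonglongrightarrow> dilation lam r $ i $ j"
      unfolding sum_component by (simp only:) (simp add: diag_matrix_def)
  qed
  then show ?thesis unfolding matrix_exp_def by (rule sums_unique[symmetric])
qed

section \<open>Bounded parts of matrix groups\<close>

definition norm_bounded :: "real \<Rightarrow> real^'n^'n \<Rightarrow> bool" where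
  "norm_bounded b A \<longleftrightarrow> (\<forall>v. norm (A *v v) \<le> b * norm v)"

lemma norm_bounded_mult:
  assumes "norm_bounded a A" "norm_bounded b B" "a \<ge> 0"
  shows "norm_bounded (a * b) (A ** B)"
  unfolding norm_bounded_def
proof
  fix v
  have "norm (A *v (B *v v)) \<le> a * norm (B *v v)" using assms by (simp add: norm_bounded_def)
  also have "\<dots> \<le> a * (b * norm v)" using assms by (intro mult_left_mono) (simp_all add: norm_bounded_def)
  finally show "norm ((A ** B) *v v) \<le> a * b * norm v" by (simp add: matrix_vector_mul_assoc)
qed

lemma norm_bounded_mono: "norm_bounded a A \<Longrightarrow> a \<le> b \<Longrightarrow> norm_bounded b A"
  unfolding norm_bounded_def by (meson mult_right_mono norm_ge_zero order_trans)

lemma norm_bounded_components: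
  fixes A :: "real^'n^'n"
  assumes "\<And>i j. \<bar>A $ i $ j\<bar> \<le> C"
  shows "norm_bounded (real CARD('n) * real CARD('n) * C) A"
  unfolding norm_bounded_def
proof
  fix v
  have "norm (A *v v) \<le> onorm ((*v) A) * norm v" by (rule onorm) simp
  also have "\<dots> \<le> (real CARD('n) * real CARD('n) * C) * norm v"
    by (intro mult_right_mono onorm_le_matrix_component assms) simp
  finally show "norm (A *v v) \<le> real CARD('n) * real CARD('n) * C * norm v" .
qed

lemma norm_bounded_dilation:
  assumes "\<And>i. r * lam i \<le> c"
  shows "norm_bounded (exp c) (dilation lam r)"
  unfolding norm_bounded_def
proof
  fix v :: "real^'a"
  have "norm (dilation lam r *v v) \<le> norm (exp c *\<^sub>R v)"
    using assms by (intro norm_le_componentwise_cart) (simp add: diag_mult_vec abs_mult mult_right_mono)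
  then show "norm (dilation lam r *v v) \<le> exp c * norm v" by simp
qed

lemma op_norm_le: "norm_bounded b A \<Longrightarrow> op_norm A \<le> b"
  unfolding norm_bounded_def op_norm_def by (intro onorm_le) simp

lemma op_norm_pos:
  fixes A :: "real^'n^'n"
  assumes "invertible A"
  shows "op_norm A > 0"
  unfolding op_norm_def
proof (subst onorm_pos_lt)
  show "\<not> (\<forall>x. A *v x = 0)"
  proof
    assume "\<forall>x. A *v x = 0"
    then have "A *v (matrix_inv A *v axis undefined 1) = 0" by blast
    then have "axis undefined (1::real) = (0 :: real^'n)"
      by (simp add: matrix_vector_mul_assoc matrix_inv_right[OF assms])
    then show False by (simp add: axis_eq_0_iff)
  qed
qed simp

lemma continuous_matrix_mult_left [continuous_intros]:
  "continuous_on X f \<Longrightarrow> continuous_on X (\<lambda>x. (A :: real^'n^'n) ** f x)"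
  unfolding matrix_matrix_mult_def by (intro continuous_intros)

lemma continuous_matrix_mult_right [continuous_intros]:
  "continuous_on X f \<Longrightarrow> continuous_on X (\<lambda>x. f x ** (A :: real^'n^'n))"
  unfolding matrix_matrix_mult_def by (intro continuous_intros)

lemma continuous_matrix_vector [continuous_intros]:
  "continuous_on X f \<Longrightarrow> continuous_on X (\<lambda>x. (f x :: real^'n^'n) *v v)"
  unfolding matrix_vector_mult_def by (intro continuous_intros)

text \<open>The elements for which they and their inverses have norm at most \<open>B\<close>. Inverses are avoided in the
  definition so that closedness is visible.\<close>

definition bounded_part :: "(real^'n^'n) set \<Rightarrow> real \<Rightarrow> (real^'n^'n) set" where
  "bounded_part H B = {h \<in> H. \<forall>v. norm (h *v v) \<le> B * norm v \<and> norm v \<le> B * norm (h *v v)}"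

text \<open>The lower bound keeps limits invertible, and therefore a group that is closed relative to the general linear
  group has compact bounded parts.\<close>

lemma compact_bounded_part:
  fixes H :: "(real^'n^'n) set"
  assumes "closedin (top_of_set (carrier GL)) H"
  shows "compact (bounded_part H B)"
proof -
  obtain F where F: "closed F" "H = carrier GL \<inter> F" using assms by (auto simp: closedin_closed)
  define Z where "Z = {h :: real^'n^'n. \<forall>v. norm (h *v v) \<le> B * norm v \<and> norm v \<le> B * norm (h *v v)}"
  have ZGL: "Z \<subseteq> carrier GL"
  proof
    fix h assume h: "h \<in> Z"
    have "inj ((*v) h)"
    proof (rule injI)
      fix x y assume "h *v x = h *v y"
      then have "h *v (x - y) = 0" by (simp add: matrix_vector_mult_diff_distrib)
      moreover have "norm (x - y) \<le> B * norm (h *v (x - y))" using h by (simp add: Z_def)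
      ultimately show "x = y" by simp
    qed
    then show "h \<in> carrier GL"
      by (simp add: GL_def invertible_left_inverse matrix_left_invertible_injective)
  qed
  have "closed Z" unfolding Z_def
    by (intro closed_Collect_all closed_Collect_conj closed_Collect_le continuous_intros)
  moreover have "bounded Z" unfolding bounded_iff
  proof (intro exI ballI)
    fix h assume h: "h \<in> Z"
    have entry: "\<bar>h $ i $ j\<bar> \<le> B" for i j
    proof -
      have "\<bar>h $ i $ j\<bar> = \<bar>(h *v axis j 1) $ i\<bar>" by (simp add: matrix_vector_mult_basis column_def)
      also have "\<dots> \<le> norm (h *v axis j 1)" by (rule component_le_norm_cart)
      also have "\<dots> \<le> B * norm (axis j (1::real))" using h unfolding Z_def by blast
      finally show ?thesis by simp
    qed
    have "norm h \<le> (\<Sum>i\<in>UNIV. norm (h $ i))" unfolding norm_vec_def by (rule L2_set_le_sum) simp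
    also have "\<dots> \<le> (\<Sum>i\<in>(UNIV::'n set). \<Sum>j\<in>(UNIV::'n set). B)"
    proof (rule sum_mono)
      fix i
      have "norm (h $ i) \<le> (\<Sum>j\<in>UNIV. \<bar>h $ i $ j\<bar>)" by (rule norm_le_l1_cart)
      also have "\<dots> \<le> (\<Sum>j\<in>(UNIV::'n set). B)" by (intro sum_mono entry)
      finally show "norm (h $ i) \<le> (\<Sum>j\<in>(UNIV::'n set). B)" .
    qed
    finally show "norm h \<le> (\<Sum>i\<in>(UNIV::'n set). \<Sum>j\<in>(UNIV::'n set). B)" .
  qed
  ultimately have "compact Z" by (simp add: compact_eq_bounded_closed)
  moreover have "bounded_part H B = F \<inter> Z" using ZGL F(2) by (auto simp: bounded_part_def Z_def)
  ultimately show ?thesis using F(1) by (simp add: closed_Int_compact)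
qed

lemma bounded_partI:
  fixes u w :: "real^'n^'n"
  assumes "u \<in> H" "norm_bounded b u" "norm_bounded b w" "w ** u = mat 1" "b \<le> B"
  shows "u \<in> bounded_part H B"
  unfolding bounded_part_def
proof (intro CollectI conjI allI)
  fix v
  have "norm_bounded B u" "norm_bounded B w" using norm_bounded_mono assms by blast+
  then show "norm (u *v v) \<le> B * norm v" by (simp add: norm_bounded_def)
  have "norm (w *v (u *v v)) \<le> B * norm (u *v v)" using \<open>norm_bounded B w\<close> by (simp add: norm_bounded_def)
  then show "norm v \<le> B * norm (u *v v)" by (simp add: matrix_vector_mul_assoc assms(4))
qed (rule assms(1))

text \<open>Matrices with \<open>norm (h *v v - v) \<le> norm v / 2\<close> for all \<open>v\<close> distort lengths by a factor of at most two.\<close>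

lemma bounded_part_neighbourhood:
  fixes H :: "(real^'n^'n) set"
  assumes B: "B \<ge> 2" and h: "h \<in> H"
    and near: "norm (h - mat 1) \<le> 1 / (2 * real CARD('n) * real CARD('n))"
  shows "h \<in> bounded_part H B"
  unfolding bounded_part_def
proof (intro CollectI conjI allI h)
  fix v
  have entry: "\<bar>(h - mat 1) $ i $ j\<bar> \<le> 1 / (2 * real CARD('n) * real CARD('n))" for i j
  proof -
    have "\<bar>(h - mat 1) $ i $ j\<bar> \<le> norm ((h - mat 1) $ i)" by (rule component_le_norm_cart)
    also have "\<dots> \<le> norm (h - mat 1)" by (rule Finite_Cartesian_Product.norm_nth_le)
    finally show ?thesis using near by linarith
  qed
  have "norm_bounded (1/2) (h - mat 1)" using norm_bounded_components[OF entry] by simp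
  then have "norm (h *v v - v) \<le> 1/2 * norm v"
    by (simp add: norm_bounded_def matrix_vector_mult_diff_rdistrib)
  then have 1: "norm (h *v v) \<le> 3/2 * norm v" "norm v \<le> 2 * norm (h *v v)"
    using norm_triangle_ineq2[of "h *v v" v] norm_triangle_ineq2[of v "h *v v"]
    by (simp_all add: norm_minus_commute)
  have "3/2 * norm v \<le> B * norm v" "2 * norm (h *v v) \<le> B * norm (h *v v)"
    using B by (intro mult_right_mono; simp)+
  then show "norm (h *v v) \<le> B * norm v" "norm v \<le> B * norm (h *v v)" using 1 by linarith+
qed

section \<open>Growth of the Haar measure under right translation\<close>

text \<open>A substitute for the modular function. The compact set \<open>K c\<close> is covered by finitely many left translates
  of \<open>K\<close>, because \<open>K\<close> is a neighbourhood of the identity. Multiplication by \<open>x\<close> from the right preserves this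
  covering, and left invariance bounds the measure.\<close>

lemma right_translate_measure:
  fixes H :: "(real^'n^'n) set"
  assumes sub: "subgroup H GL" and cl: "closedin (top_of_set (carrier GL)) H"
    and haar: "left_haar_measure (matrix_group H) \<mu>" and B: "B \<ge> 2" and c: "c \<in> H"
  obtains N :: nat where "N \<ge> 1"
    "\<And>x. x \<in> H \<Longrightarrow> emeasure \<mu> ((\<lambda>h. h ** (c ** x)) ` bounded_part H B)
       \<le> of_nat N * emeasure \<mu> ((\<lambda>h. h ** x) ` bounded_part H B)"
proof -
  note H = subgroup_GL[OF sub]
  let ?K = "bounded_part H B"
  have K: "compact ?K" "?K \<subseteq> H" using compact_bounded_part[OF cl] by (auto simp: bounded_part_def)
  define \<delta> where "\<delta> = 1 / (2 * real CARD('n) * real CARD('n))"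
  have \<delta>: "\<delta> > 0" by (simp add: \<delta>_def)
  define Nb where "Nb x = {y. norm (matrix_inv x ** y - mat 1) < \<delta>}" for x :: "real^'n^'n"
  have Nb_open: "open (Nb x)" for x
    unfolding Nb_def by (intro open_Collect_less continuous_intros)
  let ?Kc = "(\<lambda>h. h ** c) ` ?K"
  have Kc: "compact ?Kc" by (intro compact_continuous_image continuous_intros K)
  have KcH: "?Kc \<subseteq> H" using K H(2) c by auto
  have self_cover: "?Kc \<subseteq> (\<Union>x\<in>?Kc. Nb x)"
  proof
    fix x assume x: "x \<in> ?Kc"
    then have "matrix_inv x ** x = mat 1" using KcH H(4) by (blast intro: matrix_inv_left)
    then have "x \<in> Nb x" using \<delta> by (simp add: Nb_def)
    then show "x \<in> (\<Union>x\<in>?Kc. Nb x)" using x by blast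
  qed
  obtain G where G: "G \<subseteq> ?Kc" "finite G" "?Kc \<subseteq> (\<Union>x\<in>G. Nb x)"
    by (rule compactE_image[OF Kc Nb_open self_cover])
  have GH: "G \<subseteq> H" using G KcH by blast
  have cover: "?Kc \<subseteq> (\<Union>g\<in>G. (\<lambda>h. g ** h) ` ?K)"
  proof
    fix y assume y: "y \<in> ?Kc"
    then obtain g where g: "g \<in> G" "y \<in> Nb g" using G by blast
    let ?h = "matrix_inv g ** y"
    have "g \<in> H" "y \<in> H" using g(1) GH y KcH by blast+
    then have "?h \<in> H" by (intro H(2) H(3))
    then have "?h \<in> ?K" using g(2) by (intro bounded_part_neighbourhood[OF B]) (simp_all add: Nb_def \<delta>_def)
    moreover have "y = g ** ?h"
      using matrix_inv_right[of g] H(4) GH g by (auto simp: matrix_mul_assoc)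
    ultimately show "y \<in> (\<Union>g\<in>G. (\<lambda>h. g ** h) ` ?K)" using g(1) by blast
  qed
  have sets: "A \<in> sets \<mu>" if "compact A" "A \<subseteq> H" for A
  proof -
    have "A \<in> sets borel" using that(1) by (simp add: borel_compact)
    then have "H \<inter> A \<in> sets (restrict_space borel H)" by (auto simp: sets_restrict_space)
    then show ?thesis using haar that(2) by (simp add: left_haar_measure_def Int_absorb1)
  qed
  have inv: "emeasure \<mu> ((\<lambda>h. g ** h) ` A) = emeasure \<mu> A" if "g \<in> H" "A \<in> sets \<mu>" for g A
    using haar that by (simp add: left_haar_measure_def GL_def)
  have "emeasure \<mu> ((\<lambda>h. h ** (c ** x)) ` ?K) \<le> of_nat (Suc (card G)) * emeasure \<mu> ((\<lambda>h. h ** x) ` ?K)"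
    if x: "x \<in> H" for x
  proof -
    let ?Kx = "(\<lambda>h. h ** x) ` ?K"
    have Kx: "compact ?Kx" by (intro compact_continuous_image continuous_intros K)
    have KxH: "?Kx \<subseteq> H" using K H(2) x by auto
    have gKx: "(\<lambda>h. g ** h) ` ?Kx \<in> sets \<mu>" if "g \<in> G" for g
      using that GH KxH H(2) by (intro sets compact_continuous_image continuous_intros Kx) auto
    have "(\<lambda>h. h ** (c ** x)) ` ?K \<subseteq> (\<Union>g\<in>G. (\<lambda>h. g ** h) ` ?Kx)"
    proof
      fix y assume "y \<in> (\<lambda>h. h ** (c ** x)) ` ?K"
      then obtain h where h: "h \<in> ?K" "y = (h ** c) ** x" by (auto simp: matrix_mul_assoc)
      then obtain g k where "g \<in> G" "k \<in> ?K" "h ** c = g ** k" using cover by blast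
      then show "y \<in> (\<Union>g\<in>G. (\<lambda>h. g ** h) ` ?Kx)" using h(2) by (auto simp: matrix_mul_assoc[symmetric])
    qed
    then have "emeasure \<mu> ((\<lambda>h. h ** (c ** x)) ` ?K) \<le> emeasure \<mu> (\<Union>g\<in>G. (\<lambda>h. g ** h) ` ?Kx)"
      using gKx G(2) by (intro emeasure_mono) auto
    also have "\<dots> \<le> (\<Sum>g\<in>G. emeasure \<mu> ((\<lambda>h. g ** h) ` ?Kx))"
      using gKx G(2) by (intro emeasure_subadditive_finite) auto
    also have "\<dots> = (\<Sum>g\<in>G. emeasure \<mu> ?Kx)"
      using GH sets[OF Kx KxH] by (intro sum.cong refl inv) auto
    also have "\<dots> = of_nat (card G) * emeasure \<mu> ?Kx" by simp
    also have "\<dots> \<le> of_nat (Suc (card G)) * emeasure \<mu> ?Kx" by (intro mult_right_mono) auto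
    finally show ?thesis .
  qed
  then show thesis by (intro that[of "Suc (card G)"]) auto
qed

lemma dilated_parts_measure:
  fixes H :: "(real^'n^'n) set"
  assumes sub: "subgroup H GL" and cl: "closedin (top_of_set (carrier GL)) H"
    and haar: "left_haar_measure (matrix_group H) \<mu>" and B: "B \<ge> 2"
    and dil: "\<And>r. dilation lam r \<in> H"
  obtains N :: nat and m :: real where "N \<ge> 1" "m \<ge> 0"
    "\<And>k. (\<lambda>h. h ** dilation lam (- real k)) ` bounded_part H B \<in> sets \<mu>"
    "\<And>k. emeasure \<mu> ((\<lambda>h. h ** dilation lam (- real k)) ` bounded_part H B) \<le> ennreal (real N ^ k * m)"
proof -
  note H = subgroup_GL[OF sub]
  let ?K = "bounded_part H B"
  have K: "compact ?K" "?K \<subseteq> H" using compact_bounded_part[OF cl] by (auto simp: bounded_part_def)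
  have sets: "(\<lambda>h. h ** dilation lam (- real k)) ` ?K \<in> sets \<mu>" for k
  proof -
    have "compact ((\<lambda>h. h ** dilation lam (- real k)) ` ?K)"
      by (intro compact_continuous_image continuous_intros K)
    then have "H \<inter> ((\<lambda>h. h ** dilation lam (- real k)) ` ?K) \<in> sets (restrict_space borel H)"
      by (auto simp: sets_restrict_space borel_compact)
    moreover have "(\<lambda>h. h ** dilation lam (- real k)) ` ?K \<subseteq> H"
      by (rule image_subsetI) (use K H(2) dil in blast)
    ultimately show ?thesis using haar by (simp add: left_haar_measure_def Int_absorb1)
  qed
  have "?K \<in> sets \<mu>" using sets[of 0] by (simp add: diag_one)
  then have fin: "emeasure \<mu> ?K < \<infinity>" using haar K by (simp add: left_haar_measure_def)
  obtain N where N: "N \<ge> 1"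
    "\<And>x. x \<in> H \<Longrightarrow> emeasure \<mu> ((\<lambda>h. h ** (dilation lam (-1) ** x)) ` ?K)
       \<le> of_nat N * emeasure \<mu> ((\<lambda>h. h ** x) ` ?K)"
    using right_translate_measure[OF sub cl haar B dil[of "-1"]] by blast
  have "emeasure \<mu> ((\<lambda>h. h ** dilation lam (- real k)) ` ?K) \<le> of_nat N ^ k * emeasure \<mu> ?K" for k
  proof (induction k)
    case 0
    then show ?case by (simp add: diag_one)
  next
    case (Suc k)
    have eq: "dilation lam (- real (Suc k)) = dilation lam (-1) ** dilation lam (- real k)"
      by (simp only: dilation_add) simp
    have "emeasure \<mu> ((\<lambda>h. h ** dilation lam (- real (Suc k))) ` ?K)
        \<le> of_nat N * emeasure \<mu> ((\<lambda>h. h ** dilation lam (- real k)) ` ?K)"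
      unfolding eq by (rule N(2)[OF dil])
    also have "\<dots> \<le> of_nat N * (of_nat N ^ k * emeasure \<mu> ?K)" by (intro mult_left_mono Suc) simp
    finally show ?case by (simp add: mult.assoc)
  qed
  moreover have "of_nat N ^ k * emeasure \<mu> ?K = ennreal (real N ^ k * measure \<mu> ?K)" for k
    using fin by (simp add: ennreal_mult ennreal_power ennreal_of_nat_eq_real_of_nat emeasure_eq_ennreal_measure)
  ultimately show thesis using N(1) sets by (intro that[of N "measure \<mu> ?K"]) auto
qed

text \<open>On the \<open>k\<close>-th set the integrand is at most \<open>(c exp (- k l)) powr \<alpha>\<close>, and the measure grows at most like \<open>N ^ k\<close>.
  The exponent below makes the product of both decay like \<open>(1 / 2) ^ k\<close>.\<close>

lemma nn_integral_geometric_cover: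
  fixes X :: "'a set" and f :: "'a \<Rightarrow> real"
  assumes sets: "\<And>k::nat. E k \<in> sets \<mu>" and meas: "\<And>k. emeasure \<mu> (E k) \<le> ennreal (real N ^ k * m)"
    and Nm: "N \<ge> 1" "m \<ge> 0"
    and cover: "X \<subseteq> (\<Union>k. E k)"
    and l: "l > 0" and c: "c > 0"
    and f: "\<And>k h. h \<in> E k \<Longrightarrow> 0 \<le> f h \<and> f h \<le> c * exp (- (real k * l))"
  shows "\<exists>\<alpha>>0. (\<integral>\<^sup>+h\<in>X. ennreal (f h powr \<alpha>) \<partial>\<mu>) < \<infinity>"
proof -
  define \<alpha> where "\<alpha> = ln (2 * real N) / l"
  have \<alpha>: "\<alpha> > 0" using Nm l by (simp add: \<alpha>_def)
  define a where "a k = c powr \<alpha> * (1 / (2 * real N)) ^ k" for k :: nat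
  have a: "(c * exp (- (real k * l))) powr \<alpha> = a k" for k
  proof -
    have "exp (- (real k * l)) powr \<alpha> = exp (- (real k * ln (2 * real N)))"
      using l by (simp add: powr_def \<alpha>_def)
    also have "\<dots> = (1 / (2 * real N)) ^ k"
      using Nm by (simp add: exp_minus exp_of_nat_mult power_one_over inverse_eq_divide)
    finally show ?thesis using c by (simp add: powr_mult a_def)
  qed
  have single: "F k \<le> suminf F" for F :: "nat \<Rightarrow> ennreal" and k
    using sum_le_suminf[of F "{k}"] by simp
  have a0: "a k \<ge> 0" for k by (simp add: a_def)
  have "(\<integral>\<^sup>+h\<in>X. ennreal (f h powr \<alpha>) \<partial>\<mu>) \<le> (\<integral>\<^sup>+h. (\<Sum>k. ennreal (a k) * indicator (E k) h) \<partial>\<mu>)"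
  proof (rule nn_integral_mono)
    fix h
    show "ennreal (f h powr \<alpha>) * indicator X h \<le> (\<Sum>k. ennreal (a k) * indicator (E k) h)"
    proof (cases "h \<in> X")
      case True
      then obtain k where k: "h \<in> E k" using cover by blast
      have "f h powr \<alpha> \<le> (c * exp (- (real k * l))) powr \<alpha>" using f[OF k] \<alpha> by (intro powr_mono2) auto
      then have "ennreal (f h powr \<alpha>) * indicator X h \<le> ennreal (a k) * indicator (E k) h"
        using k True by (simp add: a ennreal_leI)
      also have "\<dots> \<le> (\<Sum>k. ennreal (a k) * indicator (E k) h)"
        by (rule single)
      finally show ?thesis .
    qed simp
  qed
  also have "\<dots> = (\<Sum>k. ennreal (a k) * emeasure \<mu> (E k))"
    using sets by (subst nn_integral_suminf) (auto simp: nn_integral_cmult_indicator)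
  also have "\<dots> \<le> (\<Sum>k. ennreal (c powr \<alpha> * m * (1/2) ^ k))"
  proof (rule suminf_le)
    fix k
    have "ennreal (a k) * emeasure \<mu> (E k) \<le> ennreal (a k) * ennreal (real N ^ k * m)"
      by (intro mult_left_mono meas) simp
    also have "\<dots> = ennreal (a k * (real N ^ k * m))" using a0 Nm by (simp add: ennreal_mult)
    also have "a k * (real N ^ k * m) = c powr \<alpha> * m * (1/2) ^ k"
      using Nm by (simp add: a_def power_divide power_mult_distrib)
    finally show "ennreal (a k) * emeasure \<mu> (E k) \<le> ennreal (c powr \<alpha> * m * (1/2) ^ k)" .
  qed auto
  also have "\<dots> < \<infinity>"
  proof -
    have "summable (\<lambda>k. c powr \<alpha> * m * (1/2::real) ^ k)" by (intro summable_mult summable_geometric) simp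
    then have "(\<Sum>k. ennreal (c powr \<alpha> * m * (1/2) ^ k)) \<noteq> \<infinity>"
      unfolding infinity_ennreal_def using Nm by (intro ennreal_suminf_neq_top) auto
    then show ?thesis by (simp add: less_top)
  qed
  finally show ?thesis using \<alpha> by blast
qed

section \<open>The open dual orbit\<close>

lemma transpose_row: "(transpose A *v x) $ k = (\<Sum>l\<in>UNIV. x $ l * A $ l $ k)" for A :: "real^'n^'n"
  by (simp add: matrix_vector_mult_def transpose_def mult.commute del: transpose_matrix_vector)

lemma matrix_uminus_mult: "(- A) ** B = - (A ** B)" for A B :: "real^'n^'n"
  by (simp add: vec_eq_iff matrix_matrix_mult_def sum_negf)

lemma transpose_mult_vec: "transpose (g ** h) *v x = transpose h *v (transpose g *v x)"
  for g h :: "real^'n^'n"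
  by (simp add: matrix_transpose_mul matrix_vector_mul_assoc del: transpose_matrix_vector)

lemma dual_orbit_eq:
  assumes sub: "subgroup H GL" and x: "x \<in> dual_orbit H \<xi>"
  shows "dual_orbit H x = dual_orbit H \<xi>"
proof -
  note H = subgroup_GL[OF sub]
  obtain h where h: "h \<in> H" "x = transpose h *v \<xi>" using x by (auto simp: dual_orbit_def)
  have "\<xi> = transpose (h ** matrix_inv h) *v \<xi>"
    using matrix_inv_right[OF H(4)[OF h(1)]] by (simp add: transpose_mat)
  then have \<xi>: "\<xi> = transpose (matrix_inv h) *v x" by (simp only: h(2) transpose_mult_vec)
  show ?thesis
  proof (intro equalityI subsetI)
    fix y assume "y \<in> dual_orbit H x"
    then obtain g where "g \<in> H" "y = transpose g *v x" by (auto simp: dual_orbit_def)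
    then have "h ** g \<in> H" "y = transpose (h ** g) *v \<xi>" using h H(2) by (simp_all only: transpose_mult_vec)
    then show "y \<in> dual_orbit H \<xi>" by (auto simp only: dual_orbit_def)
  next
    fix y assume "y \<in> dual_orbit H \<xi>"
    then obtain g where g: "g \<in> H" "y = transpose g *v \<xi>" by (auto simp: dual_orbit_def)
    then have "matrix_inv h ** g \<in> H" "y = transpose (matrix_inv h ** g) *v x"
      using h(1) H(2,3) \<xi> by (simp_all only: transpose_mult_vec)
    then show "y \<in> dual_orbit H x" by (auto simp only: dual_orbit_def)
  qed
qed

text \<open>The sign in \<open>decompose\<close> may a priori always be positive; that \<open>-1\<close> belongs to \<open>H\<close> is \<open>minus_one_in\<close>.\<close>

locale shearlet_dilation = shear_group S lam
  for S :: "(real^'n::{finite,wellorder}^'n::_) set" and lam :: "'n \<Rightarrow> real" +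
  fixes H :: "(real^'n::{finite,wellorder}^'n::_) set"
  assumes subgroup: "subgroup H GL"
    and irreducible: "quasi_regular_irreducible H"
    and S_subset: "S \<subseteq> H"
    and dilation_in: "dilation lam r \<in> H"
    and decompose: "h \<in> H \<Longrightarrow> \<exists>\<epsilon>\<in>{1, -1}. \<exists>r. \<exists>s\<in>S. h = \<epsilon> *\<^sub>R (dilation lam r ** s)"
begin

lemmas group = subgroup_GL[OF subgroup]

lemma entries: "(\<epsilon> *\<^sub>R (dilation lam r ** s)) $ i $ k = \<epsilon> * (exp (r * lam i) * s $ i $ k)"
  by (simp add: diag_mult_left)

lemma transpose_first:
  fixes h :: "real^'n::_^'n::_"
  assumes "\<And>l. l \<noteq> \<iota> \<Longrightarrow> h $ l $ \<iota> = 0"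
  shows "(transpose h *v x) $ \<iota> = x $ \<iota> * h $ \<iota> $ \<iota>"
proof -
  have "(\<Sum>l\<in>UNIV. x $ l * h $ l $ \<iota>) = (\<Sum>l\<in>{\<iota>}. x $ l * h $ l $ \<iota>)"
    using assms by (intro sum.mono_neutral_right) auto
  then show ?thesis unfolding transpose_row by simp
qed

lemma first_column:
  assumes "h \<in> H" "l \<noteq> \<iota>"
  shows "h $ l $ \<iota> = 0"
proof -
  obtain \<epsilon> r s where s: "s \<in> S" "h = \<epsilon> *\<^sub>R (dilation lam r ** s)" using decompose[OF assms(1)] by blast
  show ?thesis unfolding s(2) entries using lower_entry[OF s(1), of \<iota> l] assms(2) first_index_less[of l] by simp
qed

text \<open>An element with negative corner entry is \<open>- exp (r Y) s\<close>, and both factors can be cancelled. Without such an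
  element the half space of positive first coordinates would be invariant.\<close>

lemma minus_one_in: "- mat 1 \<in> H"
proof (cases "\<exists>h\<in>H. h $ \<iota> $ \<iota> < 0")
  case True
  then obtain h where h: "h \<in> H" "h $ \<iota> $ \<iota> < 0" by blast
  obtain \<epsilon> r s where s: "\<epsilon> \<in> {1, -1}" "s \<in> S" "h = \<epsilon> *\<^sub>R (dilation lam r ** s)" using decompose[OF h(1)] by blast
  have "\<epsilon> * exp (r * lam \<iota>) < 0" using h(2) unfolding s(3) entries by (simp add: diag_entry[OF s(2)])
  then have "\<epsilon> = -1" using s(1) by auto
  obtain t where t: "t \<in> S" "s ** t = mat 1" using inv_in[OF s(2)] by blast
  have "h ** t = - (dilation lam r ** (s ** t))"
    unfolding s(3) \<open>\<epsilon> = -1\<close> by (simp add: matrix_uminus_mult matrix_mul_assoc)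
  then have "h ** t ** dilation lam (- r) = - (dilation lam r ** dilation lam (- r))"
    by (simp add: t(2) matrix_uminus_mult)
  then have "h ** t ** dilation lam (- r) = - mat 1" by (simp only: dilation_inverse)
  moreover have "h ** t ** dilation lam (- r) \<in> H" using group(2) h(1) t(1) S_subset dilation_in by blast
  ultimately show ?thesis by simp
next
  case False
  have pos: "h $ \<iota> $ \<iota> > 0" if hH: "h \<in> H" for h
  proof -
    obtain \<epsilon> r s where s: "\<epsilon> \<in> {1, -1}" "s \<in> S" "h = \<epsilon> *\<^sub>R (dilation lam r ** s)" using decompose[OF hH] by blast
    have "h $ \<iota> $ \<iota> \<noteq> 0" unfolding s(3) entries using s(1) by (auto simp: diag_entry[OF s(2)])
    then show ?thesis using False hH by (meson linorder_neqE_linordered_idom)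
  qed
  have "False"
  proof (rule irreducible_imp_no_disjoint_open_invariant[OF irreducible subgroup])
    show "open {\<xi> :: real^'n::_. \<xi> $ \<iota> < 0}" "open {\<xi> :: real^'n::_. \<xi> $ \<iota> > 0}"
      by (intro open_Collect_less continuous_intros)+
    have "- axis \<iota> (1::real) \<in> {\<xi>. \<xi> $ \<iota> < 0}" "axis \<iota> (1::real) \<in> {\<xi>. \<xi> $ \<iota> > 0}"
      by (simp_all add: axis_def)
    then show "{\<xi> :: real^'n::_. \<xi> $ \<iota> < 0} \<noteq> {}" "{\<xi> :: real^'n::_. \<xi> $ \<iota> > 0} \<noteq> {}" by blast+
    show "{\<xi> :: real^'n::_. \<xi> $ \<iota> < 0} \<inter> {\<xi>. \<xi> $ \<iota> > 0} = {}" by auto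
    fix h and \<xi> :: "real^'n::_" assume "h \<in> H" "\<xi> \<in> {\<xi>. \<xi> $ \<iota> > 0}"
    then show "transpose h *v \<xi> \<in> {\<xi>. \<xi> $ \<iota> > 0}"
      using transpose_first[OF first_column, of h \<xi>] pos by (simp del: transpose_matrix_vector)
  qed
  then show ?thesis ..
qed

lemma neg_in: "h \<in> H \<Longrightarrow> - h \<in> H"
  using group(2)[OF minus_one_in, of h] by (simp add: matrix_uminus_mult)

end

text \<open>A set that is invariant under transposed shears, dilations and negation is invariant under all transposes
  from \<open>H\<close>, so \<open>row_surjective\<close> meets the obstruction from irreducibility.\<close>

sublocale shearlet_dilation \<subseteq> full_shear_group S lam
proof
  fix t
  show "\<exists>s\<in>S. \<forall>k. k \<noteq> \<iota> \<longrightarrow> s $ \<iota> $ k = t k"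
  proof (rule row_surjective)
    fix A B :: "(real^'n::_) set"
    assume AB: "open A" "open B" "A \<noteq> {}" "B \<noteq> {}" "A \<inter> B = {}"
      and shear: "\<And>s \<xi>. s \<in> S \<Longrightarrow> \<xi> \<in> B \<Longrightarrow> transpose s *v \<xi> \<in> B"
      and scale: "\<And>r \<xi>. \<xi> \<in> B \<Longrightarrow> (\<chi> k. exp (r * lam k) * \<xi> $ k) \<in> B"
      and neg: "\<And>\<xi>. \<xi> \<in> B \<Longrightarrow> - \<xi> \<in> B"
    show False
    proof (rule irreducible_imp_no_disjoint_open_invariant[OF irreducible subgroup AB(1,3,2,4,5)])
      fix h \<xi> assume h: "h \<in> H" and \<xi>: "\<xi> \<in> B"
      obtain \<epsilon> r s where s: "\<epsilon> \<in> {1, -1}" "s \<in> S" "h = \<epsilon> *\<^sub>R (dilation lam r ** s)" using decompose[OF h] by blast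
      have sc: "transpose (dilation lam r) *v \<xi> = (\<chi> k. exp (r * lam k) * \<xi> $ k)"
        by (simp add: vec_eq_iff transpose_row diag_matrix_def if_distrib[of "\<lambda>x. _ * x"] mult.commute
            del: transpose_matrix_vector cong: if_cong)
      have B: "transpose (dilation lam r ** s) *v \<xi> \<in> B"
        unfolding transpose_mult_vec sc by (intro shear s(2) scale \<xi>)
      have "transpose h *v \<xi> = \<epsilon> *\<^sub>R (transpose (dilation lam r ** s) *v \<xi>)"
        by (simp add: s(3) vec_eq_iff transpose_row sum_distrib_left mult.left_commute del: transpose_matrix_vector)
      then show "transpose h *v \<xi> \<in> B" using B neg s(1) by auto
    qed
  qed
qed

context shearlet_dilation
begin

lemma orbit_first_axis: "dual_orbit H (axis \<iota> 1) = {\<xi>. \<xi> $ \<iota> \<noteq> 0}"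
proof (intro equalityI subsetI)
  have row: "(transpose h *v axis \<iota> 1) $ k = h $ \<iota> $ k" for h :: "real^'n::_^'n::_" and k
    by (simp add: transpose_row axis_def if_distrib[of "\<lambda>x. x * _"] del: transpose_matrix_vector cong: if_cong)
  {
    fix \<xi> assume "\<xi> \<in> dual_orbit H (axis \<iota> 1)"
    then obtain h where h: "h \<in> H" "\<xi> = transpose h *v axis \<iota> 1" by (auto simp: dual_orbit_def)
    obtain \<epsilon> r s where s: "\<epsilon> \<in> {1, -1}" "s \<in> S" "h = \<epsilon> *\<^sub>R (dilation lam r ** s)" using decompose[OF h(1)] by blast
    have "h $ \<iota> $ \<iota> \<noteq> 0" unfolding s(3) entries using s(1) by (auto simp: diag_entry[OF s(2)])
    then show "\<xi> \<in> {\<xi>. \<xi> $ \<iota> \<noteq> 0}" unfolding h(2) mem_Collect_eq row .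
  }
  fix \<xi> :: "real^'n::_" assume "\<xi> \<in> {\<xi>. \<xi> $ \<iota> \<noteq> 0}"
  then have nz: "\<xi> $ \<iota> \<noteq> 0" by simp
  obtain s where s: "s \<in> S" "\<And>k. k \<noteq> \<iota> \<Longrightarrow> s $ \<iota> $ k = \<xi> $ k / \<xi> $ \<iota>"
    using row_onto[of "\<lambda>k. \<xi> $ k / \<xi> $ \<iota>"] by blast
  let ?h = "dilation lam (ln \<bar>\<xi> $ \<iota>\<bar>) ** s"
  have h: "?h \<in> H" using group(2) dilation_in s(1) S_subset by blast
  have row_h: "?h $ \<iota> $ k = \<bar>\<xi> $ \<iota>\<bar> * (\<xi> $ k / \<xi> $ \<iota>)" for k
    using entries[of 1 "ln \<bar>\<xi> $ \<iota>\<bar>" s \<iota> k] s(2)[of k] diag_entry[OF s(1), of \<iota>] nz lam_first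
    by (cases "k = \<iota>") simp_all
  show "\<xi> \<in> dual_orbit H (axis \<iota> 1)"
  proof (cases "\<xi> $ \<iota> > 0")
    case True
    then have "\<xi> = transpose ?h *v axis \<iota> 1" unfolding vec_eq_iff row row_h by simp
    then show ?thesis using h by (auto simp only: dual_orbit_def)
  next
    case False
    then have "\<xi> = transpose (- ?h) *v axis \<iota> 1" unfolding vec_eq_iff row vector_uminus_component row_h using nz by simp
    then show ?thesis using neg_in[OF h] by (auto simp only: dual_orbit_def)
  qed
qed

text \<open>Any open orbit meets the dense set of points with nonzero first coordinate, which is an orbit itself, and
  orbits are disjoint or equal.\<close>

lemma open_orbit: "open_dual_orbit H = {\<xi>. \<xi> $ \<iota> \<noteq> 0}"
  unfolding open_dual_orbit_def
proof (rule the_equality)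
  have op: "open {\<xi> :: real^'n::_. \<xi> $ \<iota> \<noteq> 0}" by (intro open_Collect_neq continuous_intros)
  then show "open {\<xi> :: real^'n::_. \<xi> $ \<iota> \<noteq> 0} \<and> (\<exists>\<xi>. {\<xi>. \<xi> $ \<iota> \<noteq> 0} = dual_orbit H \<xi>)"
    using orbit_first_axis[symmetric] by (intro conjI exI)
  fix U assume U: "open U \<and> (\<exists>\<xi>. U = dual_orbit H \<xi>)"
  then obtain \<xi> where \<xi>: "U = dual_orbit H \<xi>" by blast
  have "\<xi> = transpose (mat 1) *v \<xi>" by (simp add: transpose_mat)
  then have mem: "\<xi> \<in> U" unfolding \<xi> dual_orbit_def using group(1) by blast
  obtain e where e: "e > 0" "ball \<xi> e \<subseteq> U" using U mem open_contains_ball by blast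
  obtain x where x: "x \<in> U" "x $ \<iota> \<noteq> 0"
  proof (cases "\<xi> $ \<iota> = 0")
    case True
    let ?x = "\<xi> + (e / 2) *\<^sub>R axis \<iota> 1"
    have "dist \<xi> ?x = e / 2" using e by (simp add: dist_norm)
    then have "?x \<in> U" using e by (intro subsetD[OF e(2)]) simp
    moreover have "?x $ \<iota> \<noteq> 0" using True e by (simp add: axis_def)
    ultimately show thesis by (rule that)
  next
    case False
    then show thesis using mem that by blast
  qed
  have "U = dual_orbit H x" using dual_orbit_eq[OF subgroup, of x \<xi>] x(1) \<xi> by simp
  also have "\<dots> = dual_orbit H (axis \<iota> 1)" using x(2) by (intro dual_orbit_eq[OF subgroup]) (simp add: orbit_first_axis)
  finally show "U = {\<xi>. \<xi> $ \<iota> \<noteq> 0}" by (simp add: orbit_first_axis)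
qed

section \<open>Elements that carry frequencies into the cone\<close>

lemma shear_norm_bounds:
  obtains b where "b > 0" "\<And>s t. s \<in> S \<Longrightarrow> t \<in> S \<Longrightarrow> t ** s = mat 1 \<Longrightarrow>
    (\<And>k. k \<noteq> \<iota> \<Longrightarrow> \<bar>s $ \<iota> $ k\<bar> \<le> 2) \<Longrightarrow> norm_bounded b s \<and> norm_bounded b t"
proof -
  obtain C1 where C1: "\<And>s i k. s \<in> S \<Longrightarrow> (\<And>k. k \<noteq> \<iota> \<Longrightarrow> \<bar>s $ \<iota> $ k\<bar> \<le> 2) \<Longrightarrow> \<bar>s $ i $ k\<bar> \<le> C1"
    using bounded_row_bounded_entries[of 2] by auto
  obtain C2 where C2: "\<And>s t i k. s \<in> S \<Longrightarrow> t \<in> S \<Longrightarrow> t ** s = mat 1 \<Longrightarrow>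
      (\<And>k. k \<noteq> \<iota> \<Longrightarrow> \<bar>s $ \<iota> $ k\<bar> \<le> 2) \<Longrightarrow> \<bar>t $ i $ k\<bar> \<le> C2"
    using bounded_row_bounded_inverse[of 2] by auto
  let ?C = "max 1 (max C1 C2)"
  let ?b = "real CARD('n) * real CARD('n) * ?C"
  have "norm_bounded ?b s \<and> norm_bounded ?b t"
    if st: "s \<in> S" "t \<in> S" "t ** s = mat 1" and b: "\<And>k. k \<noteq> \<iota> \<Longrightarrow> \<bar>s $ \<iota> $ k\<bar> \<le> 2" for s t
  proof (intro conjI norm_bounded_components)
    fix i k
    show "\<bar>s $ i $ k\<bar> \<le> ?C" using C1[OF st(1) b, of i k] by simp
    show "\<bar>t $ i $ k\<bar> \<le> ?C" using C2[OF st b, of i k] by simp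
  qed
  then show thesis by (intro that[of ?b]) auto
qed

definition cap :: "(real^'n::_) set" where
  "cap = {w \<in> sphere 0 1. w $ \<iota> > 1 / 2}"

text \<open>Let \<open>x\<close> be the point of the cone that \<open>transpose h\<close> carries to \<open>v\<close> in the ball, and let \<open>h = u ** dilation lam r\<close>. The
  vector \<open>x / x $ \<iota>\<close> is bounded because \<open>x\<close> lies in the cone. Its image under \<open>transpose u\<close> is \<open>v / v $ \<iota>\<close> with the
  \<open>k\<close>-th coordinate multiplied by \<open>exp (r (1 - lam k))\<close>, and is bounded because \<open>r < 0\<close> and \<open>lam k \<le> 1\<close>. Elements of \<open>S\<close> are
  controlled by their first rows: with \<open>\<sigma>\<close> in \<open>S\<close> having first row \<open>x / x $ \<iota>\<close>, both \<open>\<sigma>\<close> and \<open>\<sigma> ** u\<close> have bounded first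
  rows, and so \<open>u\<close> is bounded.

  The radius \<open>3\<close> ensures \<open>r < 0\<close>: in the cap the first coordinate exceeds half of the norm, so
  \<open>x $ \<iota> > 3 / 2 > v $ \<iota>\<close>, while \<open>v $ \<iota> = exp r * x $ \<iota>\<close>.\<close>

lemma outer_decomposition:
  obtains b where "b > 0"
    "\<And>h. h \<in> K_outer H cap (ball (axis \<iota> 1) (1/2)) 3 \<Longrightarrow>
      \<exists>u t r. u \<in> S \<and> t \<in> S \<and> t ** u = mat 1 \<and> u ** t = mat 1 \<and> r < 0 \<and> h = u ** dilation lam r
        \<and> norm_bounded b u \<and> norm_bounded b t"
proof -
  obtain b where b: "b > 0" "\<And>s t. s \<in> S \<Longrightarrow> t \<in> S \<Longrightarrow> t ** s = mat 1 \<Longrightarrow>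
    (\<And>k. k \<noteq> \<iota> \<Longrightarrow> \<bar>s $ \<iota> $ k\<bar> \<le> 2) \<Longrightarrow> norm_bounded b s \<and> norm_bounded b t"
    using shear_norm_bounds by blast
  show thesis
  proof (rule that[of "b * b"])
    show "b * b > 0" using b(1) by simp
    fix h assume hK: "h \<in> K_outer H cap (ball (axis \<iota> 1) (1/2)) 3"
    define k' where "k' = matrix_inv h"
    obtain v where h: "h \<in> H" and v: "v \<in> ball (axis \<iota> 1) (1/2)"
      and xv: "transpose k' *v v \<in> truncated_cone cap 3"
      using hK by (auto simp: K_outer_def k'_def simp del: transpose_matrix_vector)
    define x where "x = transpose k' *v v"
    have hx: "transpose h *v x = v"
    proof -
      have "transpose h *v x = transpose (k' ** h) *v v" unfolding x_def by (simp only: transpose_mult_vec)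
      then show ?thesis using matrix_inv_left[OF group(4)[OF h]] by (simp add: k'_def transpose_mat)
    qed
    have vdiff: "\<bar>(axis \<iota> 1 - v) $ k\<bar> < 1 / 2" for k
      using v component_le_norm_cart[of "axis \<iota> 1 - v" k] by (simp add: dist_norm)
    have "\<bar>1 - v $ \<iota>\<bar> < 1 / 2" using vdiff[of \<iota>] by (simp add: axis_def)
    then have v1: "v $ \<iota> > 1 / 2" "v $ \<iota> < 3 / 2" by linarith+
    have vk: "\<bar>v $ k\<bar> < 1 / 2" if "k \<noteq> \<iota>" for k using vdiff[of k] that by (simp add: axis_def)
    obtain \<rho> w where w: "x = \<rho> *\<^sub>R w" "w \<in> cap" "\<rho> > 0" and x3: "norm x > 3"
      using xv by (auto simp: truncated_cone_def direction_cone_def x_def simp del: transpose_matrix_vector)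
    have nw: "norm w = 1" and w1: "w $ \<iota> > 1 / 2" using w(2) by (auto simp: cap_def)
    have \<rho>3: "\<rho> > 3" using x3 w(1,3) nw by simp
    have x1: "x $ \<iota> > 3 / 2"
    proof -
      have "3 * (1/2) < \<rho> * w $ \<iota>" using \<rho>3 w1 by (intro mult_strict_mono) auto
      then show ?thesis by (simp add: w(1))
    qed
    have xk: "\<bar>x $ k\<bar> \<le> 2 * x $ \<iota>" for k
    proof -
      have "\<bar>x $ k\<bar> \<le> norm x" by (rule component_le_norm_cart)
      also have "\<dots> = \<rho>" using w nw by simp
      also have "\<rho> * 1 \<le> \<rho> * (2 * w $ \<iota>)" using w1 w(3) by (intro mult_left_mono) auto
      then have "\<rho> \<le> 2 * x $ \<iota>" by (simp add: w(1))
      finally show ?thesis .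
    qed
    obtain \<epsilon> r s where s: "\<epsilon> \<in> {1, -1}" "s \<in> S" "h = \<epsilon> *\<^sub>R (dilation lam r ** s)" using decompose[OF h] by blast
    have h11: "h $ \<iota> $ \<iota> = \<epsilon> * exp r" unfolding s(3) entries by (simp add: diag_entry[OF s(2)] lam_first)
    have vx: "v $ \<iota> = x $ \<iota> * (\<epsilon> * exp r)"
      using transpose_first[OF first_column[OF h], of x] unfolding hx h11 .
    have \<epsilon>: "\<epsilon> = 1"
    proof (rule ccontr)
      assume "\<epsilon> \<noteq> 1"
      then have "v $ \<iota> = - (x $ \<iota> * exp r)" using s(1) vx by simp
      moreover have "x $ \<iota> * exp r > 0" using x1 by (intro mult_pos_pos) auto
      ultimately show False using v1 by linarith
    qed
    have er: "exp r = v $ \<iota> / x $ \<iota>" using vx x1 \<epsilon> by simp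
    also have "\<dots> < 1" using v1 x1 by simp
    finally have r: "r < 0" by simp
    define u where "u = scale_conj lam r s"
    have u: "u \<in> S" unfolding u_def by (rule scale_in[OF s(2)])
    have hu: "h = u ** dilation lam r"
    proof -
      have "u ** dilation lam r = dilation lam r ** s ** (dilation lam (- r) ** dilation lam r)"
        unfolding u_def scale_conj_eq by (simp only: matrix_mul_assoc)
      then show ?thesis unfolding dilation_inverse by (simp add: s(3) \<epsilon>)
    qed
    obtain t where t: "t \<in> S" "u ** t = mat 1" "t ** u = mat 1" using inv_in[OF u] by blast
    obtain \<sigma> where \<sigma>: "\<sigma> \<in> S" "\<And>k. k \<noteq> \<iota> \<Longrightarrow> \<sigma> $ \<iota> $ k = x $ k / x $ \<iota>"
      using row_onto[of "\<lambda>k. x $ k / x $ \<iota>"] by blast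
    obtain \<tau> where \<tau>: "\<tau> \<in> S" "\<sigma> ** \<tau> = mat 1" "\<tau> ** \<sigma> = mat 1" using inv_in[OF \<sigma>(1)] by blast
    have \<sigma>row: "\<sigma> $ \<iota> $ k = x $ k / x $ \<iota>" for k
      using \<sigma>(2)[of k] diag_entry[OF \<sigma>(1), of \<iota>] x1 by (cases "k = \<iota>") auto
    have \<sigma>b: "\<bar>\<sigma> $ \<iota> $ k\<bar> \<le> 2" for k
      using xk[of k] x1 by (simp add: \<sigma>row abs_divide pos_divide_le_eq)
    have \<sigma>u_row: "(\<sigma> ** u) $ \<iota> $ k = exp (r * (1 - lam k)) * (v $ k / v $ \<iota>)" for k
    proof -
      have "v $ k = (\<Sum>l\<in>UNIV. x $ l * h $ l $ k)" using transpose_row[of h x k] unfolding hx .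
      also have "\<dots> = x $ \<iota> * exp (r * lam k) * (\<Sum>l\<in>UNIV. \<sigma> $ \<iota> $ l * u $ l $ k)"
        unfolding sum_distrib_left hu diag_mult_right using x1 by (intro sum.cong) (auto simp: \<sigma>row)
      finally have "v $ k = x $ \<iota> * exp (r * lam k) * (\<sigma> ** u) $ \<iota> $ k" by (simp add: matrix_matrix_mult_def)
      moreover have "exp (r * (1 - lam k)) = v $ \<iota> / x $ \<iota> / exp (r * lam k)"
        by (simp add: er[symmetric] exp_diff[symmetric] algebra_simps)
      ultimately show ?thesis using x1 v1 by (simp add: field_simps)
    qed
    have \<sigma>ub: "\<bar>(\<sigma> ** u) $ \<iota> $ k\<bar> \<le> 2" if k: "k \<noteq> \<iota>" for k
    proof -
      have "exp (r * (1 - lam k)) \<le> 1" using r lam_less[OF k] by (simp add: mult_nonpos_nonneg)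
      moreover have "\<bar>v $ k / v $ \<iota>\<bar> \<le> 1" using vk[OF k] v1 by (simp add: abs_divide)
      ultimately have "exp (r * (1 - lam k)) * \<bar>v $ k / v $ \<iota>\<bar> \<le> 1 * 1" by (intro mult_mono) auto
      then show ?thesis by (simp add: \<sigma>u_row abs_mult)
    qed
    have \<sigma>bd: "norm_bounded b \<sigma>" "norm_bounded b \<tau>" using b(2)[OF \<sigma>(1) \<tau>(1,3) \<sigma>b] by blast+
    have "(t ** \<tau>) ** (\<sigma> ** u) = t ** (\<tau> ** \<sigma>) ** u" by (simp only: matrix_mul_assoc)
    then have "(t ** \<tau>) ** (\<sigma> ** u) = mat 1" by (simp add: \<tau>(3) t(3))
    then have \<sigma>ubd: "norm_bounded b (\<sigma> ** u)" "norm_bounded b (t ** \<tau>)"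
      using b(2)[OF mult_in[OF \<sigma>(1) u] mult_in[OF t(1) \<tau>(1)] _ \<sigma>ub] by blast+
    have "norm_bounded (b * b) (\<tau> ** (\<sigma> ** u))" "norm_bounded (b * b) ((t ** \<tau>) ** \<sigma>)"
      using \<sigma>bd \<sigma>ubd b(1) by (auto intro!: norm_bounded_mult)
    moreover have "\<tau> ** (\<sigma> ** u) = u" by (simp add: matrix_mul_assoc \<tau>(3))
    moreover have "(t ** \<tau>) ** \<sigma> = t" by (simp add: matrix_mul_assoc[symmetric] \<tau>(3))
    ultimately show "\<exists>u t r. u \<in> S \<and> t \<in> S \<and> t ** u = mat 1 \<and> u ** t = mat 1 \<and> r < 0 \<and> h = u ** dilation lam r
        \<and> norm_bounded (b * b) u \<and> norm_bounded (b * b) t"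
      using u t r hu by auto
  qed
qed

section \<open>Microlocal admissibility\<close>

theorem microlocally_admissible_first_axis:
  assumes cl: "closedin (top_of_set (carrier GL)) H"
    and haar: "left_haar_measure (matrix_group H) \<mu>"
    and l: "l > 0" "l \<le> 1" "\<And>i. l \<le> lam i"
  shows "microlocally_admissible H \<mu> (ball (axis \<iota> 1) (1/2)) (axis \<iota> 1)"
proof -
  let ?V = "ball (axis \<iota> 1) (1/2) :: (real^'n::_) set"
  let ?K = "K_outer H cap ?V 3"
  obtain b where b: "b > 0" and dec: "\<And>h. h \<in> ?K \<Longrightarrow>
      \<exists>u t r. u \<in> S \<and> t \<in> S \<and> t ** u = mat 1 \<and> u ** t = mat 1 \<and> r < 0 \<and> h = u ** dilation lam r
        \<and> norm_bounded b u \<and> norm_bounded b t"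
    using outer_decomposition by blast
  have lam1: "lam i \<le> 1" for i using lam_less[of i] lam_first by (cases "i = \<iota>") auto
  have contract: "norm_bounded (exp (r * l)) (dilation lam r)" if "r \<le> 0" for r
    using that l(3) by (intro norm_bounded_dilation mult_left_mono_neg) auto
  have expand: "norm_bounded (exp r) (dilation lam r)" if "r \<ge> 0" for r
    using that lam1 mult_left_mono[of _ 1 r] by (intro norm_bounded_dilation) fastforce
  have cap_open: "openin (top_of_set (sphere 0 1)) cap"
  proof -
    have "open {w :: real^'n::_. w $ \<iota> > 1 / 2}" by (intro open_Collect_less continuous_intros)
    moreover have "cap = sphere 0 1 \<inter> {w. w $ \<iota> > 1 / 2}" by (auto simp: cap_def)
    ultimately show ?thesis by (auto simp: openin_open)
  qed
  have axis_cap: "axis \<iota> 1 \<in> cap" by (simp add: cap_def)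
  have cap_orbit: "cap \<subseteq> sphere 0 1 \<inter> open_dual_orbit H" by (auto simp: cap_def open_orbit)
  have inverse_le: "op_norm (matrix_inv h) \<le> b * b powr (1 / l) * op_norm h powr (- (1 / l))" if hK: "h \<in> ?K" for h
  proof -
    obtain u t r where u: "u \<in> S" "t ** u = mat 1" "u ** t = mat 1" "r < 0" "h = u ** dilation lam r"
        "norm_bounded b u" "norm_bounded b t" using dec[OF hK] by blast
    have "invertible h" using hK group(4) by (simp add: K_outer_def)
    then have pos: "op_norm h > 0" by (rule op_norm_pos)
    have inv: "matrix_inv h = dilation lam (- r) ** t"
    proof (rule matrix_inv_unique)
      have "h ** (dilation lam (- r) ** t) = u ** (dilation lam r ** dilation lam (- r)) ** t"
        unfolding u(5) by (simp only: matrix_mul_assoc)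
      then show "h ** (dilation lam (- r) ** t) = mat 1" unfolding dilation_inverse by (simp add: u(3))
      have "dilation lam (- r) ** t ** h = dilation lam (- r) ** (t ** u) ** dilation lam r"
        unfolding u(5) by (simp only: matrix_mul_assoc)
      then show "dilation lam (- r) ** t ** h = mat 1" by (simp only: u(2) matrix_mul_rid dilation_inverse)
    qed
    have "norm_bounded (exp (- r) * b) (dilation lam (- r) ** t)"
      using u by (intro norm_bounded_mult expand) auto
    then have 1: "op_norm (matrix_inv h) \<le> exp (- r) * b" unfolding inv by (rule op_norm_le)
    have "norm_bounded (b * exp (r * l)) h"
      unfolding u(5) using u b by (intro norm_bounded_mult contract) auto
    then have "op_norm h \<le> b * exp (r * l)" by (rule op_norm_le)
    then have "(b * exp (r * l)) powr (- (1 / l)) \<le> op_norm h powr (- (1 / l))"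
      using pos l by (intro powr_mono2') auto
    moreover have "(b * exp (r * l)) powr (- (1 / l)) = b powr (- (1 / l)) * exp (- r)"
    proof -
      have "exp (r * l) powr (- (1 / l)) = exp (- r)" using l by (simp add: powr_def)
      then show ?thesis using b by (simp add: powr_mult)
    qed
    ultimately have "b powr (1 / l) * (b powr (- (1 / l)) * exp (- r)) \<le> b powr (1 / l) * op_norm h powr (- (1 / l))"
      by (intro mult_left_mono) auto
    moreover have "b powr (1 / l) * b powr (- (1 / l)) = 1" using b by (simp add: powr_add[symmetric])
    ultimately have "exp (- r) \<le> b powr (1 / l) * op_norm h powr (- (1 / l))"
      by (simp only: mult.assoc[symmetric] mult_1_left)
    then have "exp (- r) * b \<le> b powr (1 / l) * op_norm h powr (- (1 / l)) * b"
      using b by (intro mult_right_mono) auto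
    then show ?thesis using 1 by (simp add: mult_ac)
  qed
  have inverse_bound: "\<exists>\<alpha>>0. \<exists>C>0. \<forall>h\<in>?K. op_norm (matrix_inv h) \<le> C * op_norm h powr (- \<alpha>)"
    by (rule exI[of _ "1 / l"], rule conjI, use l in simp, rule exI[of _ "b * b powr (1 / l)"])
       (use b inverse_le in simp)
  have integral_bound: "\<exists>\<alpha>>0. (\<integral>\<^sup>+h\<in>?K. ennreal (op_norm h powr \<alpha>) \<partial>\<mu>) < \<infinity>"
  proof -
    \<comment> \<open>large enough to absorb a dilation with parameter in the unit interval\<close>
    define B where "B = max 2 (b * exp 1)"
    have B: "B \<ge> 2" "b * exp 1 \<le> B" by (auto simp: B_def)
    let ?E = "\<lambda>k. (\<lambda>h. h ** dilation lam (- real k)) ` bounded_part H B"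
    obtain N :: nat and m :: real where Nm: "N \<ge> 1" "m \<ge> 0" "\<And>k. ?E k \<in> sets \<mu>"
        "\<And>k. emeasure \<mu> (?E k) \<le> ennreal (real N ^ k * m)"
      using dilated_parts_measure[OF subgroup cl haar B(1) dilation_in] by blast
    have cover: "?K \<subseteq> (\<Union>k. ?E k)"
    proof
      fix h assume "h \<in> ?K"
      then obtain u t r where u: "u \<in> S" "t ** u = mat 1" "r < 0" "h = u ** dilation lam r"
        "norm_bounded b u" "norm_bounded b t" using dec by blast
      \<comment> \<open>the integral part of \<open>- r\<close> selects the covering set, the rest goes into \<open>K\<close>\<close>
      define k where "k = nat \<lfloor>- r\<rfloor>"
      define \<theta> where "\<theta> = - r - real k"
      have \<theta>: "0 \<le> \<theta>" "\<theta> \<le> 1" "r = - \<theta> + - real k" using u(3) by (auto simp: \<theta>_def k_def) linarith+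
      let ?u = "u ** dilation lam (- \<theta>)"
      have "?u \<in> bounded_part H B"
      proof (rule bounded_partI)
        show "?u \<in> H" using group(2) u(1) S_subset dilation_in by blast
        have "norm_bounded (b * exp (- \<theta> * l)) ?u"
          using u(5) b \<theta> by (intro norm_bounded_mult contract) auto
        moreover have "b * exp (- \<theta> * l) \<le> b * exp 1" using b \<theta> l by (simp add: mult_nonneg_nonneg order_trans[of _ 0])
        ultimately show "norm_bounded (b * exp 1) ?u" by (rule norm_bounded_mono)
        have "norm_bounded (exp \<theta> * b) (dilation lam \<theta> ** t)"
          using u(6) \<theta> by (intro norm_bounded_mult expand) auto
        moreover have "exp \<theta> * b \<le> b * exp 1" using b \<theta> by (simp add: mult.commute)
        ultimately show "norm_bounded (b * exp 1) (dilation lam \<theta> ** t)" by (rule norm_bounded_mono)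
        have "dilation lam \<theta> ** t ** ?u = dilation lam \<theta> ** (t ** u) ** dilation lam (- \<theta>)"
          by (simp only: matrix_mul_assoc)
        then show "dilation lam \<theta> ** t ** ?u = mat 1" by (simp only: u(2) matrix_mul_rid dilation_inverse)
      qed (rule B(2))
      moreover have "h = ?u ** dilation lam (- real k)"
        unfolding u(4) matrix_mul_assoc[symmetric] dilation_add by (simp only: \<theta>(3)[symmetric])
      ultimately show "h \<in> (\<Union>k. ?E k)" by blast
    qed
    have small: "0 \<le> op_norm h \<and> op_norm h \<le> B * exp (- (real k * l))" if h: "h \<in> ?E k" for k h
    proof -
      obtain u where u: "u \<in> bounded_part H B" "h = u ** dilation lam (- real k)" using h by blast
      have "norm_bounded B u" using u(1) by (auto simp: bounded_part_def norm_bounded_def)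
      then have "norm_bounded (B * exp (- real k * l)) h"
        unfolding u(2) using B(1) by (intro norm_bounded_mult contract) auto
      then have "op_norm h \<le> B * exp (- real k * l)" by (rule op_norm_le)
      moreover have "op_norm h \<ge> 0" unfolding op_norm_def by (rule onorm_pos_le) simp
      ultimately show ?thesis by simp
    qed
    show ?thesis
      using B(1) by (intro nn_integral_geometric_cover[OF Nm(3,4,1,2) cover l(1) _ small]) auto
  qed
  show ?thesis
    unfolding microlocally_admissible_def
    using cap_open axis_cap cap_orbit inverse_bound integral_bound
    by (intro exI[of _ cap] exI[of _ "3::real"]) simp
qed

end

text \<open>The only property that is not contained in the definition is that the dilations normalize \<open>S\<close>. A conjugate
  \<open>exp (r Y) s exp (- r Y)\<close> has diagonal entries one, and comparing the first of them with that of its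
  decomposition \<open>\<epsilon> exp (r' Y) t\<close> forces \<open>\<epsilon> = 1\<close> and \<open>r' = 0\<close>.\<close>

lemma shearlet_dilationI:
  fixes H S D :: "(real^'n::{finite,wellorder}^'n::_) set" and lam :: "'n \<Rightarrow> real"
  assumes gsd: "generalized_shearlet_dilation_group H S D (diag_matrix lam)"
    and lam_first: "lam first_index = 1"
    and lam_less: "\<And>i. i \<noteq> first_index \<Longrightarrow> lam i < 1"
  shows "shearlet_dilation S lam H"
proof -
  note defs = generalized_shearlet_dilation_group_def irreducibly_admissible_def closed_subgroup_GL_def
  have H_sub: "subgroup H GL" using gsd unfolding defs by (elim conjE)
  have H_irr: "quasi_regular_irreducible H" using gsd unfolding defs by (elim conjE)
  have S_H: "S \<subseteq> H" using gsd unfolding defs by (elim conjE)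
  have S_sub: "subgroup S GL" using gsd unfolding defs by (elim conjE)
  have S_unip: "S \<subseteq> unipotent_upper" using gsd unfolding defs by (elim conjE)
  have D_H: "D \<subseteq> H" using gsd unfolding defs by (elim conjE)
  have comm_all: "\<forall>s\<in>S. \<forall>t\<in>S. s ** t = t ** s" using gsd unfolding defs by (elim conjE)
  have D_eq: "D = range (\<lambda>r. matrix_exp (r *\<^sub>R diag_matrix lam))"
    using gsd unfolding defs by (elim conjE)
  have comm: "s ** t = t ** s" if "s \<in> S" "t \<in> S" for s t using comm_all that by blast
  have uniq: "\<exists>!p. case p of (\<epsilon>::real, d, s) \<Rightarrow> \<epsilon> \<in> {1, -1} \<and> d \<in> D \<and> s \<in> S \<and> h = \<epsilon> *\<^sub>R (d ** s)"
    if "h \<in> H" for h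
    using gsd that unfolding defs by (elim conjE) (erule (1) bspec)
  note HG = subgroup_GL[OF H_sub] and SG = subgroup_GL[OF S_sub]
  have D': "D = range (dilation lam)" unfolding D_eq matrix_exp_diag ..
  have dil: "dilation lam r \<in> H" for r using D_H unfolding D' by blast
  have dec: "\<exists>\<epsilon>\<in>{1, -1}. \<exists>r. \<exists>s\<in>S. h = \<epsilon> *\<^sub>R (dilation lam r ** s)" if hH: "h \<in> H" for h
  proof -
    obtain \<epsilon> d s where "\<epsilon> \<in> {1, -1}" "d \<in> D" "s \<in> S" "h = \<epsilon> *\<^sub>R (d ** s)"
      using ex1_implies_ex[OF uniq[OF hH]] by auto
    then show ?thesis unfolding D' by blast
  qed
  have diag: "s $ i $ i = 1" if "s \<in> S" for s i using that S_unip by (auto simp: unipotent_upper_def)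
  have scale: "scale_conj lam r s \<in> S" if s: "s \<in> S" for r s
  proof -
    have "scale_conj lam r s \<in> H" unfolding scale_conj_eq using HG(2) dil s S_H by blast
    then obtain \<epsilon> r' t where t: "\<epsilon> \<in> {1, -1}" "t \<in> S" "scale_conj lam r s = \<epsilon> *\<^sub>R (dilation lam r' ** t)"
      using dec by blast
    have "scale_conj lam r s $ first_index $ first_index = 1" by (simp add: scale_conj_def diag[OF s])
    then have "\<epsilon> * exp r' = 1" unfolding t(3) by (simp add: diag_mult_left diag[OF t(2)] lam_first)
    moreover have "exp r' \<noteq> -1" using exp_gt_zero[of r'] by linarith
    ultimately have "\<epsilon> = 1" "r' = 0" using t(1) by auto
    then have "scale_conj lam r s = t" using t(3) by (simp add: diag_one)
    then show ?thesis using t(2) by simp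
  qed
  show ?thesis
  proof (intro shearlet_dilation.intro shear_group.intro shearlet_dilation_axioms.intro)
    show "mat 1 \<in> S" by (rule SG(1))
    show "s ** t \<in> S" if "s \<in> S" "t \<in> S" for s t using that by (rule SG(2))
    show "\<exists>t\<in>S. s ** t = mat 1 \<and> t ** s = mat 1" if "s \<in> S" for s
      using SG(3)[OF that] matrix_inverse[OF SG(4)[OF that]] by blast
    show "S \<subseteq> unipotent_upper" by (rule S_unip)
    show "s ** t = t ** s" if "s \<in> S" "t \<in> S" for s t using that by (rule comm)
    show "scale_conj lam r s \<in> S" if "s \<in> S" for r s using that by (rule scale)
    show "lam first_index = 1" by (rule lam_first)
    show "lam i < 1" if "i \<noteq> first_index" for i using that by (rule lam_less)
    show "subgroup H GL" by (rule H_sub)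
    show "quasi_regular_irreducible H" by (rule H_irr)
    show "S \<subseteq> H" by (rule S_H)
    show "dilation lam r \<in> H" for r by (rule dil)
    show "\<exists>\<epsilon>\<in>{1, -1}. \<exists>r. \<exists>s\<in>S. h = \<epsilon> *\<^sub>R (dilation lam r ** s)" if "h \<in> H" for h
      using that by (rule dec)
  qed
qed

text \<open>The neighbourhood \<open>V\<close> is the ball of radius \<open>1 / 2\<close> around the first axis, and the exponent \<open>l\<close> is the smallest
  entry of \<open>lam\<close>.\<close>

theorem proposition32:
  fixes H S D :: "(real^'n::{finite,wellorder}^'n::_) set"
    and \<mu> :: "(real^'n::_^'n::_) measure"
    and lam :: "'n \<Rightarrow> real"
  assumes "CARD('n) \<ge> 2"
    and "generalized_shearlet_dilation_group H S D (diag_matrix lam)"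
    and "lam first_index = 1"
    and "left_haar_measure (matrix_group H) \<mu>"
    and "0 < Min (lam ` (UNIV - {first_index}))"
    and "Min (lam ` (UNIV - {first_index})) \<le> Max (lam ` (UNIV - {first_index}))"
    and "Max (lam ` (UNIV - {first_index})) < 1"
  shows "axis first_index 1 \<in> sphere 0 1 \<inter> open_dual_orbit H \<and>
    (\<exists>V. open V \<and> V \<noteq> {} \<and> compactly_inside V (open_dual_orbit H) \<and>
       microlocally_admissible H \<mu> V (axis first_index 1))"
proof -
  let ?l = "Min (lam ` (UNIV - {first_index}))" and ?V = "ball (axis first_index 1) (1/2) :: (real^'n::_) set"
  have lam_le: "lam i \<le> Max (lam ` (UNIV - {first_index}))" and lam_ge: "?l \<le> lam i" if "i \<noteq> first_index" for i
    using that by (auto intro!: Max_ge Min_le)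
  have lam_less: "lam i < 1" if "i \<noteq> first_index" for i using lam_le[OF that] assms(7) by linarith
  interpret shearlet_dilation S lam H by (rule shearlet_dilationI[OF assms(2,3) lam_less])
  have l: "?l \<le> 1" using assms(6,7) by linarith
  have l_le: "?l \<le> lam i" for i using lam_ge[of i] l assms(3) by (cases "i = first_index") auto
  have closed: "closedin (top_of_set (carrier GL)) H"
    using assms(2) by (simp add: generalized_shearlet_dilation_group_def irreducibly_admissible_def closed_subgroup_GL_def)
  have adm: "microlocally_admissible H \<mu> ?V (axis first_index 1)"
    using microlocally_admissible_first_axis[OF closed assms(4,5) l l_le] .
  have inside: "cball (axis first_index 1) (1/2) \<subseteq> open_dual_orbit H"
  proof
    fix v :: "real^'n::_" assume "v \<in> cball (axis first_index 1) (1/2)"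
    then have "\<bar>(axis first_index 1 - v) $ first_index\<bar> \<le> 1 / 2"
      using component_le_norm_cart[of "axis first_index 1 - v" first_index] by (simp add: dist_norm)
    then show "v \<in> open_dual_orbit H" by (auto simp: open_orbit axis_def)
  qed
  have "compactly_inside ?V (open_dual_orbit H)"
    unfolding compactly_inside_def
  proof
    show "?V \<subseteq> open_dual_orbit H" using inside ball_subset_cball by blast
    have "open_dual_orbit H \<inter> closure ?V = cball (axis first_index 1) (1/2)" using inside by auto
    then show "compact (open_dual_orbit H \<inter> closure ?V)" by simp
  qed
  moreover have "axis first_index 1 \<in> sphere 0 1 \<inter> open_dual_orbit H" by (simp add: open_orbit)
  ultimately show ?thesis using adm by (intro conjI exI[of _ ?V]) auto
qed

end
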